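(* Let $\acute N$ be a radical screen transversal lightlike submanifold of a locally metallic semi-Riemannian manifold $(\breve N,\breve g,\breve J)$. Then the screen distribution $S(T\acute N)$ is integrable if and only if, for all $W,U\in\Gamma(S(T\acute N))$, there is no component of $h^s(W,\breve JU)-h^s(U,\breve JW)$ in $\breve J\,ltr(T\acute N)$.
   Context: Fix positive integers $p,q$. A metallic semi-Riemannian manifold $(\breve N,\breve g,\breve J)$ is a semi-Riemannian manifold $(\breve N,\breve g)$ with a $(1,1)$-tensor field $\breve J$ such that $\breve J^2=p\breve J+qI$ and $\breve g(\breve JW,U)=\breve g(W,\breve JU)$ for all vector fields $W,U$ on $\breve N$. It is locally metallic if $\breve\nabla\breve J=0$, where $\breve\nabla$ is the Levi-Civita connection of $\breve g$. A submanifold $\acute N$ of dimension $m$ in $\breve N$ is lightlike if the metric $g$ induced from $\breve g$ is degenerate and $Rad(T\acute N)=T\acute N\cap T\acute N^{\perp}$ is a distribution of constant rank $r$, $1\le r\le m$. Fix a screen distribution $S(T\acute N)$ (non-degenerate complement of $Rad(T\acute N)$ in $T\acute N$), a screen transversal bundle $S(T\acute N^{\perp})$ (non-degenerate complement of $Rad(T\acute N)$ in $T\acute N^{\perp}$), and the associated lightlike transversal bundle $ltr(T\acute N)$: it is orthogonal to $S(T\acute N)$ and $S(T\acute N^\perp)$, and for any local basis $\{\xi_i\}$ of $Rad(T\acute N)$ it is locally spanned by $\{N_i\}$ with $\breve g(\xi_i,N_j)=\delta_{ij}$, $\breve g(N_i,N_j)=0$. With $\oplus_{ort}$ denoting orthogonal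 direct sum, $T\breve N|_{\acute N}=S(T\acute N)\oplus_{ort}[Rad(T\acute N)\oplus ltr(T\acute N)]\oplus_{ort}S(T\acute N^{\perp})$. For $W,U\in\Gamma(T\acute N)$ write $\breve\nabla_WU=\nabla_WU+h^{\ell}(W,U)+h^s(W,U)$ with $\nabla_WU\in\Gamma(T\acute N)$, $h^\ell(W,U)\in\Gamma(ltr(T\acute N))$, $h^s(W,U)\in\Gamma(S(T\acute N^\perp))$. $\acute N$ is radical screen transversal if $\breve J\,Rad(T\acute N)\subset S(T\acute N^{\perp})$ and $\breve J\,S(T\acute N)=S(T\acute N)$. Throughout, $\breve J\,ltr(T\acute N)\subset S(T\acute N^\perp)$ as well, and $S(T\acute N^\perp)=\{\breve J Rad(T\acute N)\oplus\breve J\,ltr(T\acute N)\}\oplus_{ort}D_o$, where $D_o$ is the non-degenerate orthogonal complement. A section $X$ is said to have no component in $\breve J\,ltr(T\acute N)$ if $\breve g(X,\breve JN)=0$ for all $N\in\Gamma(ltr(T\acute N))$. *)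

theory Defs
  imports "HOL-Analysis.Analysis" "HOL-Library.Function_Algebras"
begin

section \<open>Smooth manifolds\<close>

text \<open>Pointwise scalar multiplication; tangent vectors below are real-valued functionals and form
  vector spaces under the pointwise operations.\<close>

instantiation "fun" :: (type, real_vector) real_vector
begin

definition scaleR_fun :: "real \<Rightarrow> ('a \<Rightarrow> 'b) \<Rightarrow> 'a \<Rightarrow> 'b"
  where "scaleR_fun c f = (\<lambda>x. c *\<^sub>R f x)"

instance
  by standard (auto simp: scaleR_fun_def fun_eq_iff plus_fun_def algebra_simps)

end

text \<open>\<open>C_k_on k f S\<close> is meant for open \<open>S\<close>: all iterated directional derivatives of \<open>f\<close> up to order
  \<open>k\<close> exist, \<open>f\<close> and those of order below \<open>k\<close> are Frechet differentiable, those of order \<open>k\<close> are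
  continuous.\<close>

primrec C_k_on ::
  "nat \<Rightarrow> ('a::euclidean_space \<Rightarrow> 'b::real_normed_vector) \<Rightarrow> 'a set \<Rightarrow> bool" where
  "C_k_on 0 f S \<longleftrightarrow> continuous_on S f"
| "C_k_on (Suc k) f S \<longleftrightarrow>
     (\<forall>x\<in>S. f differentiable (at x)) \<and> (\<forall>v. C_k_on k (\<lambda>x. frechet_derivative f (at x) v) S)"

definition smooth_on :: "('a::euclidean_space \<Rightarrow> 'b::real_normed_vector) \<Rightarrow> 'a set \<Rightarrow> bool" where
  "smooth_on f S \<longleftrightarrow> (\<forall>k. C_k_on k f S)"

type_synonym ('m, 'e) chart = "'m set \<times> ('m \<Rightarrow> 'e)"

definition is_chart :: "('m::topological_space, 'e::euclidean_space) chart \<Rightarrow> bool" where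
  "is_chart c \<longleftrightarrow> (case c of (U, \<phi>) \<Rightarrow>
     open U \<and> open (\<phi> ` U) \<and> homeomorphism U (\<phi> ` U) \<phi> (inv_into U \<phi>))"

text \<open>A manifold is a (Hausdorff, second countable) type together with a smooth atlas modelled on
  the Euclidean space \<open>'e\<close>, so its dimension is \<open>DIM('e)\<close>. The atlas need not be maximal.\<close>

definition smooth_atlas ::
  "('m::{t2_space,second_countable_topology}, 'e::euclidean_space) chart set \<Rightarrow> bool" where
  "smooth_atlas A \<longleftrightarrow>
     (\<forall>c\<in>A. is_chart c) \<and> (\<Union>(U, \<phi>)\<in>A. U) = UNIV \<and>
     (\<forall>(U, \<phi>)\<in>A. \<forall>(V, \<psi>)\<in>A. smooth_on (\<lambda>y. \<psi> (inv_into U \<phi> y)) (\<phi> ` (U \<inter> V)))"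

definition euclidean_atlas :: "('e::euclidean_space, 'e) chart set" where
  "euclidean_atlas = {(UNIV, \<lambda>x. x)}"

text \<open>In the following two definitions \<open>V\<close> is meant to be open.\<close>

definition smooth_fun ::
  "('m::topological_space, 'e::euclidean_space) chart set \<Rightarrow> 'm set \<Rightarrow> ('m \<Rightarrow> real) \<Rightarrow> bool" where
  "smooth_fun A V f \<longleftrightarrow> (\<forall>(U, \<phi>)\<in>A. smooth_on (\<lambda>y. f (inv_into U \<phi> y)) (\<phi> ` (U \<inter> V)))"

definition smooth_map ::
  "('n::topological_space, 'd::euclidean_space) chart set \<Rightarrow>
   ('m::topological_space, 'e::euclidean_space) chart set \<Rightarrow> 'n set \<Rightarrow> ('n \<Rightarrow> 'm) \<Rightarrow> bool" where
  "smooth_map A B V F \<longleftrightarrow> continuous_on V F \<and>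
     (\<forall>(U, \<phi>)\<in>A. \<forall>(U', \<psi>)\<in>B.
        smooth_on (\<lambda>y. \<psi> (F (inv_into U \<phi> y))) (\<phi> ` (U \<inter> V \<inter> F -` U')))"

definition smooth_near ::
  "('m::topological_space, 'e::euclidean_space) chart set \<Rightarrow> 'm \<Rightarrow> ('m \<Rightarrow> real) \<Rightarrow> bool" where
  "smooth_near A x f \<longleftrightarrow> (\<exists>V. open V \<and> x \<in> V \<and> smooth_fun A V f)"

text \<open>A tangent vector is a directional derivative operator on the functions that are smooth near
  the point; on all other functions it takes the junk value 0, so that equality of tangent vectors
  is equality of functionals.\<close>

type_synonym 'm tvec = "('m \<Rightarrow> real) \<Rightarrow> real"

text \<open>The image of \<open>w\<close> under the differential at \<open>y\<close> of a map \<open>F\<close> from a Euclidean space.\<close>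

definition velocity ::
  "('m::topological_space, 'e::euclidean_space) chart set \<Rightarrow> ('d::euclidean_space \<Rightarrow> 'm) \<Rightarrow>
   'd \<Rightarrow> 'd \<Rightarrow> 'm tvec" where
  "velocity A F y w =
     (\<lambda>f. if smooth_near A (F y) f then frechet_derivative (\<lambda>z. f (F z)) (at y) w else 0)"

definition tangent_space ::
  "('m::topological_space, 'e::euclidean_space) chart set \<Rightarrow> 'm \<Rightarrow> 'm tvec set" where
  "tangent_space A x = {velocity A (inv_into U \<phi>) (\<phi> x) w | U \<phi> w. (U, \<phi>) \<in> A \<and> x \<in> U}"

text \<open>The differential of \<open>F\<close> at \<open>x\<close>.\<close>

definition push ::
  "('m::topological_space, 'e::euclidean_space) chart set \<Rightarrow> ('n \<Rightarrow> 'm) \<Rightarrow> 'n \<Rightarrow>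
   'n tvec \<Rightarrow> 'm tvec" where
  "push B F x v = (\<lambda>f. if smooth_near B (F x) f then v (\<lambda>z. f (F z)) else 0)"

text \<open>Smooth sections over the open set \<open>V\<close> of the pullback of the tangent bundle along \<open>F\<close>.\<close>

definition field_along ::
  "('n::topological_space, 'd::euclidean_space) chart set \<Rightarrow>
   ('m::topological_space, 'e::euclidean_space) chart set \<Rightarrow> ('n \<Rightarrow> 'm) \<Rightarrow> 'n set \<Rightarrow>
   ('n \<Rightarrow> 'm tvec) \<Rightarrow> bool" where
  "field_along A B F V Z \<longleftrightarrow>
     (\<forall>x\<in>V. Z x \<in> tangent_space B (F x)) \<and>
     (\<forall>Q f. open Q \<longrightarrow> smooth_fun B Q f \<longrightarrow> smooth_fun A (V \<inter> F -` Q) (\<lambda>x. Z x f))"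

definition vector_field ::
  "('m::topological_space, 'e::euclidean_space) chart set \<Rightarrow> ('m \<Rightarrow> 'm tvec) \<Rightarrow> bool" where
  "vector_field A X \<longleftrightarrow> field_along A A (\<lambda>x. x) UNIV X"

definition lie_bracket ::
  "('m::topological_space, 'e::euclidean_space) chart set \<Rightarrow> ('m \<Rightarrow> 'm tvec) \<Rightarrow> ('m \<Rightarrow> 'm tvec) \<Rightarrow>
   'm \<Rightarrow> 'm tvec" where
  "lie_bracket A X Y x =
     (\<lambda>f. if smooth_near A x f then X x (\<lambda>z. Y z f) - Y x (\<lambda>z. X z f) else 0)"

section \<open>Distributions\<close>

text \<open>A family \<open>E\<close> of subspaces \<open>E x\<close> of the tangent spaces at \<open>F x\<close> is a smooth subbundle of rank
  \<open>k\<close> if it has smooth local frames of length \<open>k\<close>.\<close>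

definition frame_on ::
  "('n::topological_space, 'd::euclidean_space) chart set \<Rightarrow>
   ('m::topological_space, 'e::euclidean_space) chart set \<Rightarrow> ('n \<Rightarrow> 'm) \<Rightarrow> 'n set \<Rightarrow> nat \<Rightarrow>
   ('n \<Rightarrow> 'm tvec set) \<Rightarrow> (nat \<Rightarrow> 'n \<Rightarrow> 'm tvec) \<Rightarrow> bool" where
  "frame_on A B F V k E \<epsilon> \<longleftrightarrow>
     (\<forall>j<k. field_along A B F V (\<epsilon> j)) \<and>
     (\<forall>x\<in>V. inj_on (\<lambda>j. \<epsilon> j x) {..<k} \<and> independent ((\<lambda>j. \<epsilon> j x) ` {..<k}) \<and>
             span ((\<lambda>j. \<epsilon> j x) ` {..<k}) = E x)"

definition subbundle_along ::
  "('n::topological_space, 'd::euclidean_space) chart set \<Rightarrow>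
   ('m::topological_space, 'e::euclidean_space) chart set \<Rightarrow> ('n \<Rightarrow> 'm) \<Rightarrow> nat \<Rightarrow>
   ('n \<Rightarrow> 'm tvec set) \<Rightarrow> bool" where
  "subbundle_along A B F k E \<longleftrightarrow> (\<forall>x. \<exists>V \<epsilon>. open V \<and> x \<in> V \<and> frame_on A B F V k E \<epsilon>)"

text \<open>Global smooth sections.\<close>

definition section_of ::
  "('n::topological_space, 'd::euclidean_space) chart set \<Rightarrow>
   ('m::topological_space, 'e::euclidean_space) chart set \<Rightarrow> ('n \<Rightarrow> 'm) \<Rightarrow>
   ('n \<Rightarrow> 'm tvec set) \<Rightarrow> ('n \<Rightarrow> 'm tvec) \<Rightarrow> bool" where
  "section_of A B F E Z \<longleftrightarrow> field_along A B F UNIV Z \<and> (\<forall>x. Z x \<in> E x)"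

text \<open>A distribution \<open>E\<close> is integrable if there is an integral manifold through every point. Since
  its dimension \<open>k\<close> is a number and not a type, the integral manifold is given by a parametrization
  defined on a neighbourhood of 0 in a \<open>k\<close>-dimensional linear subspace \<open>K\<close> of the model space: the
  restriction of \<open>c\<close> to \<open>K\<close> is an injective immersion with tangent spaces \<open>E\<close>. (Every smooth map on
  an open subset of \<open>K\<close> is the restriction of one on an open set.)\<close>

definition integrable_distribution ::
  "('n::topological_space, 'd::euclidean_space) chart set \<Rightarrow> ('n \<Rightarrow> 'n tvec set) \<Rightarrow> bool" where
  "integrable_distribution A E \<longleftrightarrow>
     (\<forall>x. \<exists>(K :: 'd set) Q (c :: 'd \<Rightarrow> 'n).
        subspace K \<and> open Q \<and> 0 \<in> Q \<and> smooth_map euclidean_atlas A Q c \<and> c 0 = x \<and>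
        inj_on c (Q \<inter> K) \<and>
        (\<forall>y \<in> Q \<inter> K. inj_on (velocity A c y) K \<and> velocity A c y ` K = E (c y)))"

section \<open>Metallic semi-Riemannian manifolds\<close>

definition nondegenerate_on :: "('v::zero \<Rightarrow> 'v \<Rightarrow> real) \<Rightarrow> 'v set \<Rightarrow> bool" where
  "nondegenerate_on b E \<longleftrightarrow> (\<forall>u\<in>E. (\<forall>v\<in>E. b u v = 0) \<longrightarrow> u = 0)"

definition has_index :: "('v::real_vector \<Rightarrow> 'v \<Rightarrow> real) \<Rightarrow> 'v set \<Rightarrow> nat \<Rightarrow> bool" where
  "has_index b E \<nu> \<longleftrightarrow>
     (\<exists>H. subspace H \<and> H \<subseteq> E \<and> (\<forall>u\<in>H - {0}. b u u < 0) \<and> dim H = \<nu>) \<and>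
     (\<forall>H. subspace H \<and> H \<subseteq> E \<and> (\<forall>u\<in>H - {0}. b u u < 0) \<longrightarrow> dim H \<le> \<nu>)"

definition semi_riemannian ::
  "('m::{t2_space,second_countable_topology}, 'e::euclidean_space) chart set \<Rightarrow>
   ('m \<Rightarrow> 'm tvec \<Rightarrow> 'm tvec \<Rightarrow> real) \<Rightarrow> bool" where
  "semi_riemannian A g \<longleftrightarrow>
     smooth_atlas A \<and>
     (\<forall>x. \<forall>u\<in>tangent_space A x. \<forall>v\<in>tangent_space A x. g x u v = g x v u) \<and>
     (\<forall>x. \<forall>u\<in>tangent_space A x. \<forall>v\<in>tangent_space A x. \<forall>w\<in>tangent_space A x. \<forall>a b.
        g x (a *\<^sub>R u + b *\<^sub>R v) w = a * g x u w + b * g x v w) \<and>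
     (\<forall>X Y. vector_field A X \<longrightarrow> vector_field A Y \<longrightarrow>
        smooth_fun A UNIV (\<lambda>x. g x (X x) (Y x))) \<and>
     (\<forall>x. nondegenerate_on (g x) (tangent_space A x)) \<and>
     (\<exists>\<nu>. \<forall>x. has_index (g x) (tangent_space A x) \<nu>)"

definition endomorphism_field ::
  "('m::topological_space, 'e::euclidean_space) chart set \<Rightarrow> ('m \<Rightarrow> 'm tvec \<Rightarrow> 'm tvec) \<Rightarrow> bool" where
  "endomorphism_field A J \<longleftrightarrow>
     (\<forall>x. J x ` tangent_space A x \<subseteq> tangent_space A x) \<and>
     (\<forall>x. \<forall>u\<in>tangent_space A x. \<forall>v\<in>tangent_space A x. \<forall>a b.
        J x (a *\<^sub>R u + b *\<^sub>R v) = a *\<^sub>R J x u + b *\<^sub>R J x v) \<and>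
     (\<forall>X. vector_field A X \<longrightarrow> vector_field A (\<lambda>x. J x (X x)))"

definition metallic_semi_riemannian ::
  "nat \<Rightarrow> nat \<Rightarrow> ('m::{t2_space,second_countable_topology}, 'e::euclidean_space) chart set \<Rightarrow>
   ('m \<Rightarrow> 'm tvec \<Rightarrow> 'm tvec \<Rightarrow> real) \<Rightarrow> ('m \<Rightarrow> 'm tvec \<Rightarrow> 'm tvec) \<Rightarrow> bool" where
  "metallic_semi_riemannian p q A g J \<longleftrightarrow>
     semi_riemannian A g \<and> endomorphism_field A J \<and>
     (\<forall>x. \<forall>u\<in>tangent_space A x. J x (J x u) = real p *\<^sub>R J x u + real q *\<^sub>R u) \<and>
     (\<forall>x. \<forall>u\<in>tangent_space A x. \<forall>v\<in>tangent_space A x. g x (J x u) v = g x u (J x v))"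

text \<open>Connections are only constrained on vector fields; \<open>\<nabla> X Y\<close> is the covariant derivative of \<open>Y\<close>
  in the direction \<open>X\<close>.\<close>

definition affine_connection ::
  "('m::topological_space, 'e::euclidean_space) chart set \<Rightarrow>
   (('m \<Rightarrow> 'm tvec) \<Rightarrow> ('m \<Rightarrow> 'm tvec) \<Rightarrow> 'm \<Rightarrow> 'm tvec) \<Rightarrow> bool" where
  "affine_connection A nabla \<longleftrightarrow>
     (\<forall>X Y. vector_field A X \<longrightarrow> vector_field A Y \<longrightarrow> vector_field A (nabla X Y)) \<and>
     (\<forall>f X X' Y. smooth_fun A UNIV f \<longrightarrow> vector_field A X \<longrightarrow> vector_field A X' \<longrightarrow>
        vector_field A Y \<longrightarrow>
        (\<forall>x. nabla (\<lambda>z. f z *\<^sub>R X z + X' z) Y x = f x *\<^sub>R nabla X Y x + nabla X' Y x)) \<and>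
     (\<forall>X Y Y'. vector_field A X \<longrightarrow> vector_field A Y \<longrightarrow> vector_field A Y' \<longrightarrow>
        (\<forall>x. nabla X (\<lambda>z. Y z + Y' z) x = nabla X Y x + nabla X Y' x)) \<and>
     (\<forall>f X Y. smooth_fun A UNIV f \<longrightarrow> vector_field A X \<longrightarrow> vector_field A Y \<longrightarrow>
        (\<forall>x. nabla X (\<lambda>z. f z *\<^sub>R Y z) x = X x f *\<^sub>R Y x + f x *\<^sub>R nabla X Y x))"

definition levi_civita ::
  "('m::topological_space, 'e::euclidean_space) chart set \<Rightarrow>
   ('m \<Rightarrow> 'm tvec \<Rightarrow> 'm tvec \<Rightarrow> real) \<Rightarrow>
   (('m \<Rightarrow> 'm tvec) \<Rightarrow> ('m \<Rightarrow> 'm tvec) \<Rightarrow> 'm \<Rightarrow> 'm tvec) \<Rightarrow> bool" where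
  "levi_civita A g nabla \<longleftrightarrow>
     affine_connection A nabla \<and>
     (\<forall>X Y. vector_field A X \<longrightarrow> vector_field A Y \<longrightarrow>
        (\<forall>x. nabla X Y x - nabla Y X x = lie_bracket A X Y x)) \<and>
     (\<forall>X Y Z. vector_field A X \<longrightarrow> vector_field A Y \<longrightarrow> vector_field A Z \<longrightarrow>
        (\<forall>x. X x (\<lambda>z. g z (Y z) (Z z)) = g x (nabla X Y x) (Z x) + g x (Y x) (nabla X Z x)))"

definition parallel_endomorphism ::
  "('m::topological_space, 'e::euclidean_space) chart set \<Rightarrow>
   (('m \<Rightarrow> 'm tvec) \<Rightarrow> ('m \<Rightarrow> 'm tvec) \<Rightarrow> 'm \<Rightarrow> 'm tvec) \<Rightarrow> ('m \<Rightarrow> 'm tvec \<Rightarrow> 'm tvec) \<Rightarrow> bool" where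
  "parallel_endomorphism A nabla J \<longleftrightarrow>
     (\<forall>X Y. vector_field A X \<longrightarrow> vector_field A Y \<longrightarrow>
        (\<forall>x. nabla X (\<lambda>z. J z (Y z)) x = J x (nabla X Y x)))"

definition locally_metallic ::
  "nat \<Rightarrow> nat \<Rightarrow> ('m::{t2_space,second_countable_topology}, 'e::euclidean_space) chart set \<Rightarrow>
   ('m \<Rightarrow> 'm tvec \<Rightarrow> 'm tvec \<Rightarrow> real) \<Rightarrow> ('m \<Rightarrow> 'm tvec \<Rightarrow> 'm tvec) \<Rightarrow>
   (('m \<Rightarrow> 'm tvec) \<Rightarrow> ('m \<Rightarrow> 'm tvec) \<Rightarrow> 'm \<Rightarrow> 'm tvec) \<Rightarrow> bool" where
  "locally_metallic p q A g J nabla \<longleftrightarrow>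
     metallic_semi_riemannian p q A g J \<and> levi_civita A g nabla \<and> parallel_endomorphism A nabla J"

section \<open>Lightlike submanifolds\<close>

definition immersed_submanifold ::
  "('n::{t2_space,second_countable_topology}, 'd::euclidean_space) chart set \<Rightarrow>
   ('m::{t2_space,second_countable_topology}, 'e::euclidean_space) chart set \<Rightarrow> ('n \<Rightarrow> 'm) \<Rightarrow> bool" where
  "immersed_submanifold A B i \<longleftrightarrow>
     smooth_atlas A \<and> smooth_map A B UNIV i \<and> inj i \<and>
     (\<forall>x. inj_on (push B i x) (tangent_space A x))"

text \<open>The tangent bundle of the submanifold, its normal bundle and its radical, all regarded as
  families of subspaces of the ambient tangent spaces along \<open>i\<close>.\<close>

definition tangent_along ::
  "('n::topological_space, 'd::euclidean_space) chart set \<Rightarrow>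
   ('m::topological_space, 'e::euclidean_space) chart set \<Rightarrow> ('n \<Rightarrow> 'm) \<Rightarrow> 'n \<Rightarrow> 'm tvec set" where
  "tangent_along A B i x = push B i x ` tangent_space A x"

definition normal_along ::
  "('n::topological_space, 'd::euclidean_space) chart set \<Rightarrow>
   ('m::topological_space, 'e::euclidean_space) chart set \<Rightarrow> ('n \<Rightarrow> 'm) \<Rightarrow>
   ('m \<Rightarrow> 'm tvec \<Rightarrow> 'm tvec \<Rightarrow> real) \<Rightarrow> 'n \<Rightarrow> 'm tvec set" where
  "normal_along A B i g x =
     {v \<in> tangent_space B (i x). \<forall>u\<in>tangent_along A B i x. g (i x) v u = 0}"

definition radical_along ::
  "('n::topological_space, 'd::euclidean_space) chart set \<Rightarrow>
   ('m::topological_space, 'e::euclidean_space) chart set \<Rightarrow> ('n \<Rightarrow> 'm) \<Rightarrow>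
   ('m \<Rightarrow> 'm tvec \<Rightarrow> 'm tvec \<Rightarrow> real) \<Rightarrow> 'n \<Rightarrow> 'm tvec set" where
  "radical_along A B i g x = tangent_along A B i x \<inter> normal_along A B i g x"

definition lightlike_submanifold ::
  "('n::{t2_space,second_countable_topology}, 'd::euclidean_space) chart set \<Rightarrow>
   ('m::{t2_space,second_countable_topology}, 'e::euclidean_space) chart set \<Rightarrow> ('n \<Rightarrow> 'm) \<Rightarrow>
   ('m \<Rightarrow> 'm tvec \<Rightarrow> 'm tvec \<Rightarrow> real) \<Rightarrow> nat \<Rightarrow> bool" where
  "lightlike_submanifold A B i g r \<longleftrightarrow>
     immersed_submanifold A B i \<and>
     (\<forall>x. \<not> nondegenerate_on (g (i x)) (tangent_along A B i x)) \<and>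
     1 \<le> r \<and> r \<le> DIM('d) \<and>
     subbundle_along A B i r (radical_along A B i g)"

definition direct_sum :: "'v::real_vector set \<Rightarrow> 'v set \<Rightarrow> 'v set \<Rightarrow> bool" where
  "direct_sum E H T \<longleftrightarrow> E \<inter> H = {0} \<and> {u + v | u v. u \<in> E \<and> v \<in> H} = T"

definition orthogonal_sets :: "('v \<Rightarrow> 'v \<Rightarrow> real) \<Rightarrow> 'v set \<Rightarrow> 'v set \<Rightarrow> bool" where
  "orthogonal_sets b E H \<longleftrightarrow> (\<forall>u\<in>E. \<forall>v\<in>H. b u v = 0)"

definition screen_distribution ::
  "('n::topological_space, 'd::euclidean_space) chart set \<Rightarrow>
   ('m::topological_space, 'e::euclidean_space) chart set \<Rightarrow> ('n \<Rightarrow> 'm) \<Rightarrow>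
   ('m \<Rightarrow> 'm tvec \<Rightarrow> 'm tvec \<Rightarrow> real) \<Rightarrow> ('n \<Rightarrow> 'm tvec set) \<Rightarrow> bool" where
  "screen_distribution A B i g S \<longleftrightarrow>
     (\<exists>k. subbundle_along A B i k S) \<and>
     (\<forall>x. direct_sum (radical_along A B i g x) (S x) (tangent_along A B i x) \<and>
          nondegenerate_on (g (i x)) (S x))"

definition screen_transversal_bundle ::
  "('n::topological_space, 'd::euclidean_space) chart set \<Rightarrow>
   ('m::topological_space, 'e::euclidean_space) chart set \<Rightarrow> ('n \<Rightarrow> 'm) \<Rightarrow>
   ('m \<Rightarrow> 'm tvec \<Rightarrow> 'm tvec \<Rightarrow> real) \<Rightarrow> ('n \<Rightarrow> 'm tvec set) \<Rightarrow> bool" where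
  "screen_transversal_bundle A B i g Str \<longleftrightarrow>
     (\<exists>k. subbundle_along A B i k Str) \<and>
     (\<forall>x. direct_sum (radical_along A B i g x) (Str x) (normal_along A B i g x) \<and>
          nondegenerate_on (g (i x)) (Str x))"

definition lightlike_transversal_bundle ::
  "('n::topological_space, 'd::euclidean_space) chart set \<Rightarrow>
   ('m::topological_space, 'e::euclidean_space) chart set \<Rightarrow> ('n \<Rightarrow> 'm) \<Rightarrow>
   ('m \<Rightarrow> 'm tvec \<Rightarrow> 'm tvec \<Rightarrow> real) \<Rightarrow> nat \<Rightarrow>
   ('n \<Rightarrow> 'm tvec set) \<Rightarrow> ('n \<Rightarrow> 'm tvec set) \<Rightarrow> ('n \<Rightarrow> 'm tvec set) \<Rightarrow> bool" where
  "lightlike_transversal_bundle A B i g r S Str ltr \<longleftrightarrow>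
     subbundle_along A B i r ltr \<and>
     (\<forall>x. orthogonal_sets (g (i x)) (ltr x) (S x) \<and> orthogonal_sets (g (i x)) (ltr x) (Str x)) \<and>
     (\<forall>V \<xi>. open V \<longrightarrow> frame_on A B i V r (radical_along A B i g) \<xi> \<longrightarrow>
        (\<exists>N. frame_on A B i V r ltr N \<and>
           (\<forall>x\<in>V. \<forall>j<r. \<forall>k<r.
              g (i x) (\<xi> j x) (N k x) = (if j = k then 1 else 0) \<and> g (i x) (N j x) (N k x) = 0)))"

definition radical_screen_transversal ::
  "('n::topological_space, 'd::euclidean_space) chart set \<Rightarrow>
   ('m::topological_space, 'e::euclidean_space) chart set \<Rightarrow> ('n \<Rightarrow> 'm) \<Rightarrow>
   ('m \<Rightarrow> 'm tvec \<Rightarrow> 'm tvec \<Rightarrow> real) \<Rightarrow> ('m \<Rightarrow> 'm tvec \<Rightarrow> 'm tvec) \<Rightarrow>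
   ('n \<Rightarrow> 'm tvec set) \<Rightarrow> ('n \<Rightarrow> 'm tvec set) \<Rightarrow> bool" where
  "radical_screen_transversal A B i g J S Str \<longleftrightarrow>
     (\<forall>x. J (i x) ` radical_along A B i g x \<subseteq> Str x \<and> J (i x) ` S x = S x)"

text \<open>\<open>J\<close> maps \<open>ltr\<close> into \<open>Str\<close>, and \<open>Str\<close> is the orthogonal direct sum of \<open>J Rad \<oplus> J ltr\<close> and the
  non-degenerate orthogonal complement \<open>D\<^sub>o\<close> of the latter in \<open>Str\<close>.\<close>

definition screen_transversal_splitting ::
  "('n::topological_space, 'd::euclidean_space) chart set \<Rightarrow>
   ('m::topological_space, 'e::euclidean_space) chart set \<Rightarrow> ('n \<Rightarrow> 'm) \<Rightarrow>
   ('m \<Rightarrow> 'm tvec \<Rightarrow> 'm tvec \<Rightarrow> real) \<Rightarrow> ('m \<Rightarrow> 'm tvec \<Rightarrow> 'm tvec) \<Rightarrow>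
   ('n \<Rightarrow> 'm tvec set) \<Rightarrow> ('n \<Rightarrow> 'm tvec set) \<Rightarrow> bool" where
  "screen_transversal_splitting A B i g J Str ltr \<longleftrightarrow>
     (\<forall>x. J (i x) ` ltr x \<subseteq> Str x \<and>
        (\<exists>P. direct_sum (J (i x) ` radical_along A B i g x) (J (i x) ` ltr x) P \<and>
           (let D\<^sub>o = {v \<in> Str x. \<forall>u\<in>P. g (i x) v u = 0}
            in direct_sum P D\<^sub>o (Str x) \<and> nondegenerate_on (g (i x)) D\<^sub>o)))"

section \<open>Second fundamental forms\<close>

text \<open>The connection induced by an ambient connection on vector fields along \<open>i\<close> (the pullback
  connection), characterized by its universal property. \<open>D W Z\<close> is the covariant derivative of the
  field \<open>Z\<close> along \<open>i\<close> in the direction of the vector field \<open>W\<close> on the submanifold.\<close>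

definition induced_connection_along ::
  "('n::topological_space, 'd::euclidean_space) chart set \<Rightarrow>
   ('m::topological_space, 'e::euclidean_space) chart set \<Rightarrow> ('n \<Rightarrow> 'm) \<Rightarrow>
   (('m \<Rightarrow> 'm tvec) \<Rightarrow> ('m \<Rightarrow> 'm tvec) \<Rightarrow> 'm \<Rightarrow> 'm tvec) \<Rightarrow>
   (('n \<Rightarrow> 'n tvec) \<Rightarrow> ('n \<Rightarrow> 'm tvec) \<Rightarrow> 'n \<Rightarrow> 'm tvec) \<Rightarrow> bool" where
  "induced_connection_along A B i nabla D \<longleftrightarrow>
     (\<forall>W Z. vector_field A W \<longrightarrow> field_along A B i UNIV Z \<longrightarrow> field_along A B i UNIV (D W Z)) \<and>
     (\<forall>f W W' Z. smooth_fun A UNIV f \<longrightarrow> vector_field A W \<longrightarrow> vector_field A W' \<longrightarrow>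
        field_along A B i UNIV Z \<longrightarrow>
        (\<forall>x. D (\<lambda>z. f z *\<^sub>R W z + W' z) Z x = f x *\<^sub>R D W Z x + D W' Z x)) \<and>
     (\<forall>W Z Z'. vector_field A W \<longrightarrow> field_along A B i UNIV Z \<longrightarrow> field_along A B i UNIV Z' \<longrightarrow>
        (\<forall>x. D W (\<lambda>z. Z z + Z' z) x = D W Z x + D W Z' x)) \<and>
     (\<forall>f W Z. smooth_fun A UNIV f \<longrightarrow> vector_field A W \<longrightarrow> field_along A B i UNIV Z \<longrightarrow>
        (\<forall>x. D W (\<lambda>z. f z *\<^sub>R Z z) x = W x f *\<^sub>R Z x + f x *\<^sub>R D W Z x)) \<and>
     (\<forall>W X Y x. vector_field A W \<longrightarrow> vector_field B X \<longrightarrow> vector_field B Y \<longrightarrow>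
        X (i x) = push B i x (W x) \<longrightarrow> D W (\<lambda>z. Y (i z)) x = nabla X Y (i x))"

text \<open>Sections of the tangent bundle of the submanifold occur in two guises: as vector fields \<open>W\<close> on
  the submanifold, and as fields along \<open>i\<close> with values in \<open>tangent_along\<close>, the two being identified
  by \<open>push\<close>. In the decomposition below the direction \<open>W\<close> is of the first kind and the
  differentiated field \<open>U\<close> of the second kind.\<close>

definition gauss_formula ::
  "('n::topological_space, 'd::euclidean_space) chart set \<Rightarrow>
   ('m::topological_space, 'e::euclidean_space) chart set \<Rightarrow> ('n \<Rightarrow> 'm) \<Rightarrow>
   ('n \<Rightarrow> 'm tvec set) \<Rightarrow> ('n \<Rightarrow> 'm tvec set) \<Rightarrow>
   (('n \<Rightarrow> 'n tvec) \<Rightarrow> ('n \<Rightarrow> 'm tvec) \<Rightarrow> 'n \<Rightarrow> 'm tvec) \<Rightarrow>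
   (('n \<Rightarrow> 'n tvec) \<Rightarrow> ('n \<Rightarrow> 'm tvec) \<Rightarrow> 'n \<Rightarrow> 'm tvec) \<Rightarrow>
   (('n \<Rightarrow> 'n tvec) \<Rightarrow> ('n \<Rightarrow> 'm tvec) \<Rightarrow> 'n \<Rightarrow> 'm tvec) \<Rightarrow>
   (('n \<Rightarrow> 'n tvec) \<Rightarrow> ('n \<Rightarrow> 'm tvec) \<Rightarrow> 'n \<Rightarrow> 'm tvec) \<Rightarrow> bool" where
  "gauss_formula A B i ltr Str D nablaN hl hs \<longleftrightarrow>
     (\<forall>W U. vector_field A W \<longrightarrow> section_of A B i (tangent_along A B i) U \<longrightarrow>
        (\<forall>x. D W U x = nablaN W U x + hl W U x + hs W U x) \<and>
        section_of A B i (tangent_along A B i) (nablaN W U) \<and>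
        section_of A B i ltr (hl W U) \<and> section_of A B i Str (hs W U))"

text \<open>For a family \<open>S\<close> of subspaces of \<open>tangent_along\<close>: the corresponding distribution on the
  submanifold itself.\<close>

definition intrinsic_distribution ::
  "('n::topological_space, 'd::euclidean_space) chart set \<Rightarrow>
   ('m::topological_space, 'e::euclidean_space) chart set \<Rightarrow> ('n \<Rightarrow> 'm) \<Rightarrow>
   ('n \<Rightarrow> 'm tvec set) \<Rightarrow> 'n \<Rightarrow> 'n tvec set" where
  "intrinsic_distribution A B i S x = {v \<in> tangent_space A x. push B i x v \<in> S x}"

definition no_component_in_J_ltr ::
  "('n::topological_space, 'd::euclidean_space) chart set \<Rightarrow>
   ('m::topological_space, 'e::euclidean_space) chart set \<Rightarrow> ('n \<Rightarrow> 'm) \<Rightarrow>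
   ('m \<Rightarrow> 'm tvec \<Rightarrow> 'm tvec \<Rightarrow> real) \<Rightarrow> ('m \<Rightarrow> 'm tvec \<Rightarrow> 'm tvec) \<Rightarrow>
   ('n \<Rightarrow> 'm tvec set) \<Rightarrow> ('n \<Rightarrow> 'm tvec) \<Rightarrow> bool" where
  "no_component_in_J_ltr A B i g J ltr X \<longleftrightarrow>
     (\<forall>N. section_of A B i ltr N \<longrightarrow> (\<forall>x. g (i x) (X x) (J (i x) (N x)) = 0))"

end

theory Submission
  imports Defs
begin

text \<open>
  Let \<open>W\<close>, \<open>U\<close> be sections of the screen distribution, regarded as vector fields on the
  submanifold. The connection \<open>D\<close> induced along the immersion inherits two properties of the
  ambient Levi-Civita connection: it commutes with the parallel field \<open>J\<close>
  (\<open>induced_connection_parallel\<close>) and it is torsion-free, \<open>D W U - D U W = [W, U]\<close>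
  (\<open>induced_connection_torsion_free\<close>). Both are verified in coordinate fields, because \<open>D\<close> is only
  given by its axioms. For a section \<open>N\<close> of \<open>ltr\<close>, the field \<open>J N\<close> lies in the screen transversal
  bundle and is thus orthogonal to the tangential and lightlike parts in the Gauss formula, so
  that
  \<open>g (h\<^sup>s(W, J U) - h\<^sup>s(U, J W)) (J N) = g (J [W, U]) (J N) = p * g (J [W, U]) N + q * g [W, U] N\<close>.
  Decompose \<open>[W, U] = \<rho> + \<sigma>\<close> with \<open>\<rho>\<close> in the radical and \<open>\<sigma>\<close> in the screen. As \<open>J \<rho>\<close> lies in the
  screen transversal bundle, \<open>J \<sigma>\<close> and \<open>\<sigma>\<close> lie in the screen, and both bundles are orthogonal to
  \<open>ltr\<close>, the right hand side is \<open>q * g \<rho> N\<close> (\<open>screen_bracket_pairing\<close>). Since \<open>q > 0\<close> and the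
  radical is paired non-degenerately with \<open>ltr\<close> (\<open>radical_pairing_nondegenerate\<close>), the condition
  on \<open>h\<^sup>s\<close> says that the screen distribution is involutive.

  It remains to prove Frobenius' theorem, in terms of integral manifolds and global sections. That
  integrable distributions are involutive (\<open>integrable_imp_involutive\<close>) is seen by lifting the
  fields to the parameter space of an integral manifold. Conversely, an involutive distribution
  has local frames of the form \<open>F y v\<close>, linear in \<open>v\<close>, that project to constant fields on the
  fibre at a given point (\<open>adapted_frame\<close>). These commute, which is the condition of solvability
  of the total differential equation \<open>Dc(s) v = F (c s) v\<close>. Its solution
  (\<open>total_differential_equation\<close>) needs no smooth dependence of ordinary differential equations on
  parameters: Banach's fixed point theorem gives a continuous \<open>c\<close> that solves the equation along
  rays, a comparison of neighbouring rays shows that \<open>c\<close> is differentiable with the required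
  derivative, and the equation itself then yields smoothness.

  Smoothness of vectors given implicitly, such as the lifts and frames above, always comes from
  \<open>smooth_on_solution\<close>: if \<open>M y\<close> is an injective linear map depending smoothly on \<open>y\<close>, and
  \<open>M y (w y)\<close> is smooth, then so is \<open>w\<close>.
\<close>

section \<open>Calculus of smooth maps between Euclidean spaces\<close>

abbreviation dderiv :: "('a::real_normed_vector \<Rightarrow> 'b::real_normed_vector) \<Rightarrow> 'a \<Rightarrow> 'a \<Rightarrow> 'b"
  where "dderiv f x \<equiv> frechet_derivative f (at x)"

lemma dderiv_eq: "(f has_derivative f') (at x) \<Longrightarrow> dderiv f x = f'"
  by (metis frechet_derivative_at)

lemma dderiv_works: "f differentiable (at x) \<Longrightarrow> (f has_derivative dderiv f x) (at x)"
  by (simp add: frechet_derivative_works)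

lemma linear_dderiv: "f differentiable (at x) \<Longrightarrow> linear (dderiv f x)"
  using dderiv_works has_derivative_linear by blast

lemma dderiv_cong:
  assumes "open S" "x \<in> S" "\<And>y. y \<in> S \<Longrightarrow> f y = g y"
  shows "dderiv f x = dderiv g x"
proof -
  have "(f has_derivative f') (at x) \<longleftrightarrow> (g has_derivative f') (at x)" for f'
    using has_derivative_transform_within_open[OF _ assms(1,2)] assms(3) by metis
  then show ?thesis by (simp add: frechet_derivative_def)
qed

lemma differentiable_cong:
  assumes "f differentiable (at x)" "open S" "x \<in> S" "\<And>y. y \<in> S \<Longrightarrow> f y = g y"
  shows "g differentiable (at x)"
proof -
  obtain f' where "(f has_derivative f') (at x)"
    using assms(1) by (auto simp: differentiable_def)
  from has_derivative_transform_within_open[OF this assms(2,3,4)]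
  show ?thesis by (auto simp: differentiable_def)
qed

lemma linear_euclidean_expand:
  fixes f :: "'a::euclidean_space \<Rightarrow> 'b::real_vector"
  assumes "linear f"
  shows "f v = (\<Sum>b\<in>Basis. (v \<bullet> b) *\<^sub>R f b)"
  by (metis (no_types, lifting) assms euclidean_representation linear_scale linear_sum sum.cong)

lemma C_k_on_cong:
  assumes "open S" "\<And>x. x \<in> S \<Longrightarrow> f x = g x" "C_k_on k f S"
  shows "C_k_on k g S"
  using assms(2,3)
proof (induction k arbitrary: f g)
  case 0
  then show ?case using continuous_on_cong by fastforce
next
  case (Suc k)
  have "dderiv f x v = dderiv g x v" if "x \<in> S" for x v
    using dderiv_cong[OF \<open>open S\<close> that, of f g] Suc.prems(1) by simp
  then show ?case
    using Suc.prems Suc.IH[of "\<lambda>x. dderiv f x v" "\<lambda>x. dderiv g x v" for v]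
      differentiable_cong[OF _ \<open>open S\<close>, of f _ g] by auto
qed

lemma C_k_on_subset: "C_k_on k f S \<Longrightarrow> T \<subseteq> S \<Longrightarrow> C_k_on k f T"
  by (induction k arbitrary: f) (auto intro: continuous_on_subset)

lemma C_k_on_local:
  assumes "\<And>x. x \<in> S \<Longrightarrow> \<exists>T. open T \<and> x \<in> T \<and> C_k_on k f T"
  shows "C_k_on k f S"
  using assms
proof (induction k arbitrary: f)
  case 0
  then show ?case
    by (metis C_k_on.simps(1) continuous_at_imp_continuous_on continuous_on_eq_continuous_at)
next
  case (Suc k)
  have "\<exists>T. open T \<and> x \<in> T \<and> C_k_on k (\<lambda>x. dderiv f x v) T" if "x \<in> S" for x v
    using Suc.prems[OF that] by auto
  then show ?case using Suc by fastforce
qed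

lemma C_k_on_Suc_imp: "C_k_on (Suc k) f S \<Longrightarrow> C_k_on k f S"
proof (induction k arbitrary: f)
  case 0
  then show ?case
    by (auto intro!: continuous_at_imp_continuous_on differentiable_imp_continuous_within)
next
  case (Suc k)
  then show ?case by (metis C_k_on.simps(2))
qed

lemma C_k_on_const: "C_k_on k (\<lambda>x. c) S"
  by (induction k arbitrary: c) auto

lemma C_k_on_bounded_linear:
  assumes "open S" "bounded_linear h" "C_k_on k f S"
  shows "C_k_on k (\<lambda>x. h (f x)) S"
  using assms(3)
proof (induction k arbitrary: f)
  case 0
  then show ?case
    using assms(2) bounded_linear.continuous_on by auto
next
  case (Suc k)
  have d: "((\<lambda>x. h (f x)) has_derivative (\<lambda>v. h (dderiv f x v))) (at x)" if "x \<in> S" for x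
    using Suc.prems that by (auto intro!: bounded_linear.has_derivative[OF assms(2)] dderiv_works)
  have "C_k_on k (\<lambda>x. h (dderiv f x v)) S" for v
    using Suc by auto
  then have "C_k_on k (\<lambda>x. dderiv (\<lambda>x. h (f x)) x v) S" for v
    by (rule C_k_on_cong[OF assms(1), rotated]) (use dderiv_eq[OF d] in auto)
  then show ?case using d by (auto simp: differentiable_def)
qed

lemma C_k_on_ident: "C_k_on k (\<lambda>x. x) S"
  by (cases k) (auto intro: C_k_on_const)

lemma C_k_on_linear:
  fixes h :: "'a::euclidean_space \<Rightarrow> 'b::real_normed_vector"
  assumes "open S" "linear h"
  shows "C_k_on k h S"
  using C_k_on_bounded_linear[OF assms(1) _ C_k_on_ident, of h] assms(2)
  by (simp add: linear_conv_bounded_linear)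

lemma C_k_on_add:
  assumes "open S" "C_k_on k f S" "C_k_on k g S"
  shows "C_k_on k (\<lambda>x. f x + g x) S"
  using assms(2,3)
proof (induction k arbitrary: f g)
  case 0
  then show ?case by (auto intro: continuous_intros)
next
  case (Suc k)
  have d: "((\<lambda>x. f x + g x) has_derivative (\<lambda>v. dderiv f x v + dderiv g x v)) (at x)"
    if "x \<in> S" for x
    using Suc.prems that by (auto intro!: has_derivative_add dderiv_works)
  have "C_k_on k (\<lambda>x. dderiv f x v + dderiv g x v) S" for v
    using Suc by auto
  then have "C_k_on k (\<lambda>x. dderiv (\<lambda>x. f x + g x) x v) S" for v
    by (rule C_k_on_cong[OF assms(1), rotated]) (use dderiv_eq[OF d] in auto)
  then show ?case using d by (auto simp: differentiable_def)
qed

lemma C_k_on_sum: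
  assumes "open S" "\<And>i. i \<in> I \<Longrightarrow> C_k_on k (f i) S"
  shows "C_k_on k (\<lambda>x. \<Sum>i\<in>I. f i x) S"
  using assms(2)
  by (induction I rule: infinite_finite_induct) (auto intro: C_k_on_const C_k_on_add[OF assms(1)])

lemma C_k_on_bilinear:
  assumes "open S" "bounded_bilinear B" "C_k_on k f S" "C_k_on k g S"
  shows "C_k_on k (\<lambda>x. B (f x) (g x)) S"
  using assms(3,4)
proof (induction k arbitrary: f g)
  case 0
  then show ?case using bounded_bilinear.continuous_on[OF assms(2)] by auto
next
  case (Suc k)
  have d: "((\<lambda>x. B (f x) (g x)) has_derivative (\<lambda>v. B (f x) (dderiv g x v)
      + B (dderiv f x v) (g x))) (at x)"
    if "x \<in> S" for x
    using Suc.prems that by (auto intro!: bounded_bilinear.FDERIV[OF assms(2)] dderiv_works)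
  have "C_k_on k (\<lambda>x. B (f x) (dderiv g x v) + B (dderiv f x v) (g x)) S" for v
    using Suc C_k_on_Suc_imp[OF Suc.prems(1)] C_k_on_Suc_imp[OF Suc.prems(2)]
    by (intro C_k_on_add[OF assms(1)] Suc.IH) auto
  then have "C_k_on k (\<lambda>x. dderiv (\<lambda>x. B (f x) (g x)) x v) S" for v
    by (rule C_k_on_cong[OF assms(1), rotated]) (use dderiv_eq[OF d] in auto)
  then show ?case using d by (auto simp: differentiable_def)
qed

lemmas C_k_on_scaleR = C_k_on_bilinear[OF _ bounded_bilinear_scaleR]
  and C_k_on_mult = C_k_on_bilinear[OF _ bounded_bilinear_mult]
  and C_k_on_inner = C_k_on_bilinear[OF _ bounded_bilinear_inner]

lemma C_k_on_compose:
  fixes f :: "'b::euclidean_space \<Rightarrow> 'c::real_normed_vector" and g :: "'a::euclidean_space \<Rightarrow> 'b"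
  assumes "open S" "open T" "g ` S \<subseteq> T" "C_k_on k f T" "C_k_on k g S"
  shows "C_k_on k (\<lambda>x. f (g x)) S"
  using assms(4,5)
proof (induction k arbitrary: f)
  case 0
  then show ?case using assms(3) continuous_on_compose2 by auto
next
  case (Suc k)
  have d: "((\<lambda>x. f (g x)) has_derivative (\<lambda>v. \<Sum>b\<in>Basis. (dderiv g x v \<bullet> b) *\<^sub>R dderiv f (g x) b))
      (at x)"
    if "x \<in> S" for x
  proof -
    have 1: "(g has_derivative dderiv g x) (at x)" and f: "f differentiable (at (g x))"
      using Suc.prems that assms(3) by (auto intro!: dderiv_works)
    have "(\<lambda>v. dderiv f (g x) (dderiv g x v)) =
        (\<lambda>v. \<Sum>b\<in>Basis. (dderiv g x v \<bullet> b) *\<^sub>R dderiv f (g x) b)"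
      by (intro ext linear_euclidean_expand linear_dderiv f)
    then show ?thesis using has_derivative_compose[OF 1 dderiv_works[OF f]] by simp
  qed
  have "C_k_on k (\<lambda>x. \<Sum>b\<in>Basis. (dderiv g x v \<bullet> b) *\<^sub>R dderiv f (g x) b) S" for v
    using Suc.prems C_k_on_Suc_imp[OF Suc.prems(2)]
    by (intro C_k_on_sum[OF assms(1)] C_k_on_scaleR[OF assms(1)] C_k_on_inner[OF assms(1)]
      C_k_on_const Suc.IH) simp_all
  then have "C_k_on k (\<lambda>x. dderiv (\<lambda>x. f (g x)) x v) S" for v
    by (rule C_k_on_cong[OF assms(1), rotated]) (use dderiv_eq[OF d] in auto)
  then show ?case using d by (auto simp: differentiable_def)
qed

lemma smooth_on_cong:
  "open S \<Longrightarrow> (\<And>x. x \<in> S \<Longrightarrow> f x = g x) \<Longrightarrow> smooth_on f S \<Longrightarrow> smooth_on g S"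
  unfolding smooth_on_def using C_k_on_cong by blast

lemma smooth_on_subset: "smooth_on f S \<Longrightarrow> T \<subseteq> S \<Longrightarrow> smooth_on f T"
  unfolding smooth_on_def using C_k_on_subset by blast

lemma smooth_on_local:
  "(\<And>x. x \<in> S \<Longrightarrow> \<exists>T. open T \<and> x \<in> T \<and> smooth_on f T) \<Longrightarrow> smooth_on f S"
  unfolding smooth_on_def using C_k_on_local by metis

lemma smooth_on_const: "smooth_on (\<lambda>x. c) S"
  unfolding smooth_on_def using C_k_on_const by blast

lemma smooth_on_linear:
  fixes h :: "'a::euclidean_space \<Rightarrow> 'b::real_normed_vector"
  shows "open S \<Longrightarrow> linear h \<Longrightarrow> smooth_on h S"
  unfolding smooth_on_def using C_k_on_linear by blast

lemma smooth_on_add: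
  "open S \<Longrightarrow> smooth_on f S \<Longrightarrow> smooth_on g S \<Longrightarrow> smooth_on (\<lambda>x. f x + g x) S"
  unfolding smooth_on_def using C_k_on_add by blast

lemma smooth_on_sum:
  "open S \<Longrightarrow> (\<And>i. i \<in> I \<Longrightarrow> smooth_on (f i) S) \<Longrightarrow> smooth_on (\<lambda>x. \<Sum>i\<in>I. f i x) S"
  unfolding smooth_on_def using C_k_on_sum[of S I _ f] by blast

lemma smooth_on_scaleR:
  "open S \<Longrightarrow> smooth_on f S \<Longrightarrow> smooth_on g S \<Longrightarrow> smooth_on (\<lambda>x. f x *\<^sub>R g x) S"
  unfolding smooth_on_def using C_k_on_scaleR by blast

lemma smooth_on_mult:
  fixes f g :: "'a::euclidean_space \<Rightarrow> real"
  shows "open S \<Longrightarrow> smooth_on f S \<Longrightarrow> smooth_on g S \<Longrightarrow> smooth_on (\<lambda>x. f x * g x) S"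
  unfolding smooth_on_def using C_k_on_mult by blast

lemma smooth_on_bounded_linear:
  "open S \<Longrightarrow> bounded_linear h \<Longrightarrow> smooth_on f S \<Longrightarrow> smooth_on (\<lambda>x. h (f x)) S"
  unfolding smooth_on_def using C_k_on_bounded_linear by blast

lemma smooth_on_diff:
  assumes "open S" "smooth_on f S" "smooth_on g S"
  shows "smooth_on (\<lambda>x. f x - g x) S"
  using smooth_on_add[OF assms(1,2) smooth_on_bounded_linear[OF assms(1) _ assms(3), of uminus]]
  by (simp add: bounded_linear_minus[OF bounded_linear_ident])

lemma smooth_on_inner:
  "open S \<Longrightarrow> smooth_on f S \<Longrightarrow> smooth_on g S \<Longrightarrow> smooth_on (\<lambda>x. f x \<bullet> g x) S"
  unfolding smooth_on_def using C_k_on_inner by blast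

lemma smooth_on_inner_const:
  "open S \<Longrightarrow> smooth_on f S \<Longrightarrow> smooth_on (\<lambda>x. f x \<bullet> b) S"
  by (simp add: smooth_on_inner smooth_on_const)

lemma smooth_on_Pair:
  fixes f :: "'a::euclidean_space \<Rightarrow> 'b::real_normed_vector" and g :: "'a \<Rightarrow> 'c::real_normed_vector"
  assumes "open S" "smooth_on f S" "smooth_on g S"
  shows "smooth_on (\<lambda>x. (f x, g x)) S"
proof -
  have "bounded_linear (\<lambda>v::'b. (v, 0::'c))" "bounded_linear (\<lambda>v::'c. (0::'b, v))"
    by (auto intro!: bounded_linear_Pair bounded_linear_ident bounded_linear_zero)
  from smooth_on_add[OF assms(1) smooth_on_bounded_linear[OF assms(1) this(1) assms(2)]
      smooth_on_bounded_linear[OF assms(1) this(2) assms(3)]]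
  show ?thesis by simp
qed

lemma smooth_on_compose:
  fixes f :: "'b::euclidean_space \<Rightarrow> 'c::real_normed_vector" and g :: "'a::euclidean_space \<Rightarrow> 'b"
  shows "open S \<Longrightarrow> open T \<Longrightarrow> g ` S \<subseteq> T \<Longrightarrow> smooth_on f T \<Longrightarrow> smooth_on g S \<Longrightarrow>
    smooth_on (\<lambda>x. f (g x)) S"
  unfolding smooth_on_def using C_k_on_compose by blast

lemma smooth_on_differentiable: "smooth_on f S \<Longrightarrow> x \<in> S \<Longrightarrow> f differentiable (at x)"
  unfolding smooth_on_def by (metis C_k_on.simps(2))

lemma smooth_on_dderiv: "smooth_on f S \<Longrightarrow> smooth_on (\<lambda>x. dderiv f x v) S"
  unfolding smooth_on_def by (metis C_k_on.simps(2))

lemma smooth_on_continuous_on: "smooth_on f S \<Longrightarrow> continuous_on S f"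
  unfolding smooth_on_def by (metis C_k_on.simps(1))

subsection \<open>Second derivatives\<close>

lemma vector_derivative_bound:
  fixes f :: "real \<Rightarrow> 'a::real_normed_vector"
  assumes "0 \<le> b"
    and "\<And>t. t \<in> {0..b} \<Longrightarrow> (f has_vector_derivative f' t) (at t within {0..b})"
    and "\<And>t. t \<in> {0..b} \<Longrightarrow> norm (f' t) \<le> K"
  shows "norm (f b - f 0) \<le> K * b"
proof -
  have "norm (f b - f 0) \<le> K * norm (b - 0)"
  proof (rule differentiable_bound[where S = "{0..b}"])
    show "(f has_derivative (\<lambda>r. r *\<^sub>R f' t)) (at t within {0..b})" if "t \<in> {0..b}" for t
      using assms(2)[OF that] by (simp add: has_vector_derivative_def)
    show "onorm (\<lambda>r. r *\<^sub>R f' t) \<le> K" if "t \<in> {0..b}" for t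
      by (rule onorm_le) (use assms(3)[OF that] in \<open>simp add: mult.commute[of K] mult_left_mono\<close>)
  qed (use assms(1) in auto)
  then show ?thesis using assms(1) by simp
qed

text \<open>The second derivative of \<open>f\<close> in the directions \<open>h\<close> and \<open>v\<close>.\<close>

definition dderiv2 :: "('a::real_normed_vector \<Rightarrow> 'b::real_normed_vector) \<Rightarrow> 'a \<Rightarrow> 'a \<Rightarrow> 'a \<Rightarrow> 'b"
  where "dderiv2 f x h v = dderiv (\<lambda>y. dderiv f y v) x h"

lemma has_derivative_dderiv_apply:
  fixes f :: "'a::euclidean_space \<Rightarrow> 'b::real_normed_vector"
  assumes "open S" "x \<in> S" "smooth_on f S" "(u has_derivative u') (at x)"
  shows "((\<lambda>y. dderiv f y (u y)) has_derivative
           (\<lambda>h. dderiv f x (u' h) + dderiv2 f x h (u x))) (at x)"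
proof -
  have lin: "linear (dderiv f y)" if "y \<in> S" for y
    using assms(3) that by (intro linear_dderiv) (rule smooth_on_differentiable)
  have d2: "((\<lambda>y. dderiv f y v) has_derivative (\<lambda>h. dderiv2 f x h v)) (at x)" for v
    unfolding dderiv2_def using assms(2,3)
    by (intro dderiv_works smooth_on_differentiable[OF smooth_on_dderiv])
  have ux: "(\<Sum>b\<in>Basis. (u x \<bullet> b) *\<^sub>R dderiv2 f x h b) = dderiv2 f x h (u x)" for h
  proof -
    have "((\<lambda>y. \<Sum>b\<in>Basis. (u x \<bullet> b) *\<^sub>R dderiv f y b) has_derivative
       (\<lambda>h. \<Sum>b\<in>Basis. (u x \<bullet> b) *\<^sub>R dderiv2 f x h b)) (at x)"
      by (intro has_derivative_sum has_derivative_scaleR_right d2)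
    then have "((\<lambda>y. dderiv f y (u x)) has_derivative
       (\<lambda>h. \<Sum>b\<in>Basis. (u x \<bullet> b) *\<^sub>R dderiv2 f x h b)) (at x)"
      by (rule has_derivative_transform_within_open[OF _ assms(1,2)])
        (rule linear_euclidean_expand[symmetric, OF lin])
    from dderiv_eq[OF this] show ?thesis using dderiv_eq[OF d2, of "u x"] by (simp add: fun_eq_iff)
  qed
  have "((\<lambda>y. \<Sum>b\<in>Basis. (u y \<bullet> b) *\<^sub>R dderiv f y b) has_derivative
      (\<lambda>h. \<Sum>b\<in>Basis. (u x \<bullet> b) *\<^sub>R dderiv2 f x h b + (u' h \<bullet> b) *\<^sub>R dderiv f x b)) (at x)"
    by (intro has_derivative_sum has_derivative_scaleR d2 has_derivative_inner_left assms(4))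
  then have "((\<lambda>y. dderiv f y (u y)) has_derivative
      (\<lambda>h. \<Sum>b\<in>Basis. (u x \<bullet> b) *\<^sub>R dderiv2 f x h b + (u' h \<bullet> b) *\<^sub>R dderiv f x b)) (at x)"
    by (rule has_derivative_transform_within_open[OF _ assms(1,2)])
        (rule linear_euclidean_expand[symmetric, OF lin])
  moreover have "(\<Sum>b\<in>Basis. (u x \<bullet> b) *\<^sub>R dderiv2 f x h b + (u' h \<bullet> b) *\<^sub>R dderiv f x b) =
    dderiv f x (u' h) + dderiv2 f x h (u x)" for h
    using linear_euclidean_expand[OF lin[OF assms(2)], of "u' h"]
    by (simp add: sum.distrib ux)
  ultimately show ?thesis by simp
qed

lemma linear_dderiv2_left:
  assumes "smooth_on f S" "x \<in> S" shows "linear (\<lambda>h. dderiv2 f x h v)"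
  unfolding dderiv2_def using smooth_on_differentiable[OF smooth_on_dderiv[OF assms(1)] assms(2)]
  by (rule linear_dderiv)

text \<open>Symmetry of second derivatives: both sides are, up to \<open>o(1)\<close>, the second difference
  \<open>f (x + t u + t v) - f (x + t u) - f (x + t v) + f x\<close> divided by \<open>t\<^sup>2\<close>.\<close>

lemma second_difference_estimate:
  fixes f :: "'a::euclidean_space \<Rightarrow> 'b::real_normed_vector"
  assumes "open S" "x \<in> S" "smooth_on f S" "e > 0"
  shows "\<exists>d>0. \<forall>t. 0 < t \<and> t < d \<longrightarrow>
    norm (f (x + t *\<^sub>R u + t *\<^sub>R v) - f (x + t *\<^sub>R u) - f (x + t *\<^sub>R v) + f x
      - t^2 *\<^sub>R dderiv2 f x v u)
      \<le> e * t^2"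
proof -
  let ?d = "\<lambda>s r. s *\<^sub>R u + r *\<^sub>R v" and ?D = "dderiv2 f x v u"
  let ?p = "\<lambda>s r. x + ?d s r"
  define c where "c = 2 * (norm u + norm v + 1)"
  have c: "c > 0" unfolding c_def by (simp add: add_nonneg_pos)
  have d2: "((\<lambda>y. dderiv f y u) has_derivative (\<lambda>h. dderiv2 f x h u)) (at x)"
    unfolding dderiv2_def using assms(2,3)
    by (intro dderiv_works smooth_on_differentiable[OF smooth_on_dderiv])
  have lin: "linear (\<lambda>h. dderiv2 f x h u)" by (rule linear_dderiv2_left[OF assms(3,2)])
  have lin_uv: "dderiv2 f x (?d s r) u = s *\<^sub>R dderiv2 f x u u + r *\<^sub>R ?D" for s r
    using linear_add[OF lin] linear_scale[OF lin] by simp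
  obtain d1 where d1: "d1 > 0" and rem: "\<And>y. norm (y - x) < d1 \<Longrightarrow>
      norm (dderiv f y u - dderiv f x u - dderiv2 f x (y - x) u) \<le> e / c * norm (y - x)"
    using d2 c assms(4) unfolding has_derivative_at_alt by (metis divide_pos_pos)
  obtain d2 where d2: "d2 > 0" "ball x d2 \<subseteq> S"
    using assms(1,2) openE by blast
  define d where "d = min d1 d2 / c"
  show ?thesis
  proof (intro exI[of _ d] conjI allI impI)
    show "d > 0" using d1 d2 c by (simp add: d_def)
    fix t assume t: "0 < t \<and> t < d"
    have tc: "t * c < min d1 d2" using t c by (simp add: d_def pos_less_divide_eq)
    have bnd: "norm (?d s r) \<le> t * (c / 2)" if "0 \<le> s" "s \<le> t" "0 \<le> r" "r \<le> t" for s r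
    proof -
      have "norm (?d s r) \<le> s * norm u + r * norm v"
        using norm_triangle_ineq[of "s *\<^sub>R u" "r *\<^sub>R v"] that by simp
      also have "\<dots> \<le> t * norm u + t * norm v" using that by (intro add_mono mult_right_mono) auto
      also have "\<dots> \<le> t * (c/2)" using t by (simp add: c_def algebra_simps)
      finally show ?thesis .
    qed
    have tc2: "t * (c/2) < min d1 d2"
    proof -
      have "t * (c/2) \<le> t * c" using t c by (intro mult_left_mono) auto
      then show ?thesis using tc by linarith
    qed
    have bnd': "norm (?d s r) < min d1 d2" if "0 \<le> s" "s \<le> t" "0 \<le> r" "r \<le> t" for s r
      using bnd[OF that] tc2 by linarith
    have inS: "?p s r \<in> S" if "0 \<le> s" "s \<le> t" "0 \<le> r" "r \<le> t" for s r
    proof -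
      have "norm (x - (?p s r)) = norm (?d s r)"
        by (metis add_diff_cancel_left' norm_minus_commute)
      then show ?thesis using bnd'[OF that] d2(2) by (auto simp: dist_norm subset_iff)
    qed
    have rem': "norm (dderiv f (?p s r) u - dderiv f x u - dderiv2 f x (?d s r) u) \<le> e / 2 * t"
      if "0 \<le> s" "s \<le> t" "0 \<le> r" "r \<le> t" for s r
    proof -
      have "norm (dderiv f (?p s r) u - dderiv f x u - dderiv2 f x (?d s r) u)
        \<le> e / c * norm (?d s r)"
        using rem[of "x + (?d s r)"] bnd'[OF that] by simp
      also have "\<dots> \<le> e / c * (t * (c/2))"
        using bnd[OF that] assms(4) c by (intro mult_left_mono) auto
      also have "\<dots> = e / 2 * t" using c by simp
      finally show ?thesis .
    qed
    define G where "G = (\<lambda>s. f (?p s t) - f (?p s 0) - (s * t) *\<^sub>R ?D)"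
    have G': "(G has_vector_derivative
        (dderiv f (?p s t) u - dderiv f (?p s 0) u - t *\<^sub>R ?D)) (at s within {0..t})"
      if "s \<in> {0..t}" for s
    proof -
      have p: "((\<lambda>s. f (?p s r)) has_vector_derivative dderiv f (?p s r) u) (at s within {0..t})"
        if "r \<in> {0..t}" for r
      proof -
        have "(f has_derivative dderiv f (?p s r)) (at (?p s r))"
          using inS[of s r] that \<open>s \<in> {0..t}\<close>
              by (auto intro!: dderiv_works smooth_on_differentiable[OF assms(3)])
        moreover have "((\<lambda>s. x + (?d s r)) has_vector_derivative u) (at s within {0..t})"
          by (auto intro!: derivative_eq_intros)
        ultimately show ?thesis
          using vector_derivative_diff_chain_within[of "\<lambda>s. x + (?d s r)" u s "{0..t}" f]
          by (auto simp: o_def has_derivative_at_withinI)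
      qed
      have q: "((\<lambda>s. (s * t) *\<^sub>R ?D) has_vector_derivative t *\<^sub>R ?D)
          (at s within {0..t})"
        by (auto intro!: derivative_eq_intros)
      show ?thesis unfolding G_def
        by (intro has_vector_derivative_diff p q) (use t in auto)
    qed
    have "norm (G t - G 0) \<le> e * t * t"
    proof (rule vector_derivative_bound[OF _ G'])
      fix s assume s: "s \<in> {0..t}"
      let ?a = "dderiv f (?p s t) u - dderiv f x u - dderiv2 f x (?d s t) u"
      let ?b = "dderiv f (?p s 0) u - dderiv f x u - dderiv2 f x (?d s 0) u"
      have "dderiv f (?p s t) u - dderiv f (?p s 0) u - t *\<^sub>R ?D = ?a - ?b"
        using lin_uv[of s t] lin_uv[of s 0] by simp
      also have "norm \<dots> \<le> e / 2 * t + e / 2 * t"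
        using rem'[of s t] rem'[of s 0] s t norm_triangle_ineq4[of ?a ?b] by force
      finally show "norm (dderiv f (?p s t) u - dderiv f (?p s 0) u - t *\<^sub>R ?D) \<le> e * t"
        by simp
    qed (use t in auto)
    moreover have "G t - G 0 = f (x + t *\<^sub>R u + t *\<^sub>R v) - f (x + t *\<^sub>R u) - f (x + t *\<^sub>R v) + f x
        - t^2 *\<^sub>R ?D"
      by (simp add: G_def algebra_simps power2_eq_square)
    ultimately show "norm (f (x + t *\<^sub>R u + t *\<^sub>R v) - f (x + t *\<^sub>R u) - f (x + t *\<^sub>R v) + f x
        - t^2 *\<^sub>R ?D)
      \<le> e * t^2" using t by (simp add: power2_eq_square)
  qed
qed

lemma dderiv2_symmetric:
  fixes f :: "'a::euclidean_space \<Rightarrow> 'b::real_normed_vector"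
  assumes "open S" "x \<in> S" "smooth_on f S"
  shows "dderiv2 f x u v = dderiv2 f x v u"
proof (rule ccontr)
  assume ne: "dderiv2 f x u v \<noteq> dderiv2 f x v u"
  define e where "e = norm (dderiv2 f x u v - dderiv2 f x v u) / 3"
  have e: "e > 0" using ne by (simp add: e_def)
  obtain d where d: "d > 0" "\<And>t. 0 < t \<and> t < d \<Longrightarrow>
    norm (f (x + t *\<^sub>R u + t *\<^sub>R v) - f (x + t *\<^sub>R u) - f (x + t *\<^sub>R v) + f x
      - t^2 *\<^sub>R dderiv2 f x v u)
      \<le> e * t^2" using second_difference_estimate[OF assms e] by metis
  obtain d' where d': "d' > 0" "\<And>t. 0 < t \<and> t < d' \<Longrightarrow>
    norm (f (x + t *\<^sub>R v + t *\<^sub>R u) - f (x + t *\<^sub>R v) - f (x + t *\<^sub>R u) + f x - t^2 *\<^sub>R dderiv2 f x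
        u v)
      \<le> e * t^2" using second_difference_estimate[OF assms e] by metis
  define t where "t = min d d' / 2"
  have t: "0 < t" "t < d" "t < d'" using d(1) d'(1) by (auto simp: t_def)
  let ?q = "f (x + t *\<^sub>R u + t *\<^sub>R v) - f (x + t *\<^sub>R u) - f (x + t *\<^sub>R v) + f x"
  have "norm (?q - t^2 *\<^sub>R dderiv2 f x v u) \<le> e * t^2" using d t by blast
  moreover have "norm (?q - t^2 *\<^sub>R dderiv2 f x u v) \<le> e * t^2"
    using d'(2)[of t] t by (simp add: algebra_simps)
  ultimately have "norm ((?q - t^2 *\<^sub>R dderiv2 f x v u) - (?q - t^2 *\<^sub>R dderiv2 f x u v)) \<le>
      2 * e * t^2"
    using norm_triangle_ineq4[of "?q - t^2 *\<^sub>R dderiv2 f x v u" "?q - t^2 *\<^sub>R dderiv2 f x u v"]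
    by linarith
  moreover have "(?q - t^2 *\<^sub>R dderiv2 f x v u) - (?q - t^2 *\<^sub>R dderiv2 f x u v)
     = t^2 *\<^sub>R (dderiv2 f x u v - dderiv2 f x v u)" by (simp add: algebra_simps)
  ultimately have "t^2 * (3 * e) \<le> t^2 * (2 * e)" by (simp add: e_def mult_ac)
  then show False using e t by simp
qed

subsection \<open>Solving linear equations with smooth coefficients\<close>

lemma linear_family_diff_bound:
  fixes M :: "'p \<Rightarrow> 'b::euclidean_space \<Rightarrow> 'c::real_normed_vector"
  assumes "linear (M y)" "linear (M x)"
  shows "norm (M y v - M x v) \<le> norm v * (\<Sum>b\<in>Basis. norm (M y b - M x b))"
proof -
  have "M y v - M x v = (\<Sum>b\<in>Basis. (v \<bullet> b) *\<^sub>R (M y b - M x b))"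
    using linear_euclidean_expand[OF assms(1), of v] linear_euclidean_expand[OF assms(2), of v]
    by (simp add: algebra_simps sum_subtractf)
  also have "norm \<dots> \<le> (\<Sum>b\<in>Basis. norm v * norm (M y b - M x b))"
    by (intro sum_norm_le) (simp add: mult_right_mono Basis_le_norm)
  finally show ?thesis by (simp add: sum_distrib_left)
qed

lemma linear_family_bounded_below:
  fixes M :: "'a::euclidean_space \<Rightarrow> 'b::euclidean_space \<Rightarrow> 'c::euclidean_space"
  assumes "open S" "\<And>y. y \<in> S \<Longrightarrow> linear (M y)" "x \<in> S" "inj (M x)"
    and "\<And>b. b \<in> Basis \<Longrightarrow> continuous_on S (\<lambda>y. M y b)"
  shows "\<exists>B>0. \<exists>T. open T \<and> x \<in> T \<and> T \<subseteq> S \<and> (\<forall>y\<in>T. \<forall>v. B * norm v \<le> norm (M y v))"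
proof -
  define K where "K = (\<lambda>y. \<Sum>b\<in>Basis. norm (M y b - M x b))"
  have cK: "continuous_on S K"
    unfolding K_def by (intro continuous_intros assms(5))
  obtain B where B: "B > 0" "\<And>v. B * norm v \<le> norm (M x v)"
    using linear_inj_bounded_below_pos[OF assms(2)[OF assms(3)] assms(4)] by blast
  define T where "T = S \<inter> K -` {..<B/2}"
  have "open T" unfolding T_def by (intro continuous_open_preimage cK assms(1)) auto
  moreover have "x \<in> T" using assms(3) B by (simp add: T_def K_def)
  moreover have "B/2 * norm v \<le> norm (M y v)" if "y \<in> T" for y v
  proof -
    have "norm (M y v - M x v) \<le> norm v * K y"
      using linear_family_diff_bound[of M y x] assms(2,3) that by (simp add: K_def T_def)
    also have "\<dots> \<le> norm v * (B/2)" using that by (intro mult_left_mono) (auto simp: T_def)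
    finally have "norm (M x v) \<le> norm (M y v) + norm v * (B/2)"
      using norm_triangle_ineq2[of "M x v" "M y v"] norm_minus_commute[of "M x v" "M y v"]
          by linarith
    then show ?thesis using B(2)[of v] by (simp add: algebra_simps)
  qed
  ultimately show ?thesis using B(1) by (intro exI[of _ "B/2"] conjI exI[of _ T]) (auto simp: T_def)
qed

lemma has_derivative_zero_if_little_o:
  assumes "(f has_derivative f') (at x)" "f x = 0" "R x = 0" "open T" "x \<in> T"
    and "isCont K x" "K x = 0" "\<And>y. y \<in> T \<Longrightarrow> norm (R y) \<le> K y * norm (f y)"
  shows "(R has_derivative (\<lambda>h. 0)) (at x)"
proof -
  obtain C where C: "C > 0" "\<And>h. norm (f' h) \<le> norm h * C"
    using has_derivative_bounded_linear[OF assms(1)] bounded_linear.pos_bounded by blast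
  obtain d1 where d1: "d1 > 0" "\<And>y. norm (y - x) < d1 \<Longrightarrow>
      norm (f y - f x - f' (y - x)) \<le> 1 * norm (y - x)"
    using assms(1) unfolding has_derivative_at_alt by (metis zero_less_one)
  obtain d2 where d2: "d2 > 0" "ball x d2 \<subseteq> T" using assms(4,5) openE by blast
  have fb: "norm (f y) \<le> (C + 1) * norm (y - x)" if "norm (y - x) < d1" for y
  proof -
    have "norm (f y) \<le> norm (f y - f x - f' (y - x)) + norm (f' (y - x))"
      using norm_triangle_ineq[of "f y - f x - f' (y - x)" "f' (y - x)"] assms(2) by simp
    then show ?thesis using d1(2)[OF that] C(2)[of "y - x"] by (simp add: algebra_simps)
  qed
  show ?thesis unfolding has_derivative_at_alt
  proof (intro conjI bounded_linear_zero allI impI)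
    fix e :: real assume "e > 0"
    then obtain d3 where d3: "d3 > 0" "\<And>y. norm (y - x) < d3 \<Longrightarrow> \<bar>K y\<bar> < e / (C + 1)"
      using assms(6,7) C(1) unfolding continuous_at_eps_delta
      by (metis add_pos_pos diff_zero dist_norm divide_pos_pos real_norm_def zero_less_one)
    show "\<exists>d>0. \<forall>y. norm (y - x) < d \<longrightarrow> norm (R y - R x - 0) \<le> e * norm (y - x)"
    proof (intro exI[of _ "min d1 (min d2 d3)"] conjI allI impI)
      fix y assume y: "norm (y - x) < min d1 (min d2 d3)"
      then have "y \<in> T" using d2 by (auto simp: dist_norm norm_minus_commute subset_iff)
      then have "norm (R y) \<le> K y * norm (f y)" by (rule assms(8))
      also have "\<dots> \<le> \<bar>K y\<bar> * norm (f y)" by (intro mult_right_mono) auto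
      also have "\<dots> \<le> e / (C + 1) * ((C + 1) * norm (y - x))"
        using fb[of y] d3(2)[of y] y C(1) \<open>e > 0\<close> by (intro mult_mono) auto
      also have "\<dots> = e * norm (y - x)" using C(1) by simp
      finally show "norm (R y - R x - 0) \<le> e * norm (y - x)" using assms(3) by simp
    qed (use d1 d2 d3 in auto)
  qed
qed

text \<open>Solutions of linear equations inherit differentiability without an inverse of \<open>M y\<close> being
  constructed. At \<open>x\<close>, put \<open>E y = M y (w y) - M y (w x)\<close>, which is differentiable and controls
  \<open>w y - w x\<close>; with a linear left inverse \<open>N\<close> of \<open>M x\<close>, the increment \<open>w y - w x\<close> is \<open>N (E y)\<close>
  up to a term of order \<open>o(y - x)\<close>.\<close>

lemma solution_differentiable:
  fixes M :: "'a::euclidean_space \<Rightarrow> 'b::euclidean_space \<Rightarrow> 'c::euclidean_space"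
  assumes "open S" "\<And>y. y \<in> S \<Longrightarrow> linear (M y)" "x \<in> S" "inj (M x)"
    and "\<And>b y. b \<in> Basis \<Longrightarrow> y \<in> S \<Longrightarrow> (\<lambda>y. M y b) differentiable (at y)"
    and "(\<lambda>y. M y (w y)) differentiable (at x)"
  shows "w differentiable (at x)"
    and "M x (dderiv w x h) =
      dderiv (\<lambda>y. M y (w y)) x h - (\<Sum>b\<in>Basis. (w x \<bullet> b) *\<^sub>R dderiv (\<lambda>y. M y b) x h)"
proof -
  define E where "E = (\<lambda>y. M y (w y) - (\<Sum>b\<in>Basis. (w x \<bullet> b) *\<^sub>R M y b))"
  define E' where "E' = (\<lambda>h. dderiv (\<lambda>y. M y (w y)) x h
      - (\<Sum>b\<in>Basis. (w x \<bullet> b) *\<^sub>R dderiv (\<lambda>y. M y b) x h))"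
  have E: "E y = M y (w y) - M y (w x)" if "y \<in> S" for y
    unfolding E_def using linear_euclidean_expand[OF assms(2)[OF that], of "w x"] by simp
  have dE: "(E has_derivative E') (at x)" unfolding E_def E'_def
    by (intro has_derivative_diff has_derivative_sum has_derivative_scaleR_right dderiv_works assms)
  have cM: "continuous_on S (\<lambda>y. M y b)" if "b \<in> Basis" for b
    using assms(5)[OF that] differentiable_imp_continuous_within
    by (intro continuous_at_imp_continuous_on) blast
  have "\<exists>B>0. \<exists>T. open T \<and> x \<in> T \<and> T \<subseteq> S \<and> (\<forall>y\<in>T. \<forall>v. B * norm v \<le> norm (M y v))"
    by (rule linear_family_bounded_below[OF assms(1) _ assms(3)]) (use assms(2,4) cM in blast)+
  then obtain B T where B: "B > 0" and T: "open T" "x \<in> T" "T \<subseteq> S"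
    and low: "\<And>y v. y \<in> T \<Longrightarrow> B * norm v \<le> norm (M y v)" by blast
  obtain N where N: "linear N" "N \<circ> M x = id"
    using linear_injective_left_inverse[OF assms(2)[OF assms(3)] assms(4)] by blast
  then have bN: "bounded_linear N" by (simp add: linear_conv_bounded_linear)
  obtain CN where CN: "CN > 0" "\<And>h. norm (N h) \<le> norm h * CN"
    using bounded_linear.pos_bounded[OF bN] by blast
  define K where "K = (\<lambda>y. \<Sum>b\<in>Basis. norm (M y b - M x b))"
  have cK: "isCont K x"
    unfolding K_def using cM assms(1,3) continuous_on_eq_continuous_at
    by (intro continuous_intros) blast
  define R where "R = (\<lambda>y. N (E y) - (w y - w x))"
  have R: "norm (R y) \<le> (CN / B * K y) * norm (E y)" if "y \<in> T" for y
  proof -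
    have yS: "y \<in> S" using that T by blast
    have lin: "linear (M y)" "linear (M x)" using yS assms by auto
    have Ey: "E y = M y (w y - w x)"
      using E[OF yS] lin by (simp add: linear_diff)
    have "R y = N (M y (w y - w x)) - N (M x (w y - w x))"
      unfolding R_def Ey using N(2) by (metis comp_apply id_apply)
    also have "\<dots> = N (M y (w y - w x) - M x (w y - w x))" using N(1) by (simp add: linear_diff)
    also have "norm \<dots> \<le> norm (M y (w y - w x) - M x (w y - w x)) * CN" by (rule CN)
    also have "\<dots> \<le> (norm (w y - w x) * K y) * CN"
      using linear_family_diff_bound[of M y x] lin CN(1) unfolding K_def
          by (intro mult_right_mono) auto
    also have "\<dots> \<le> ((norm (E y) / B) * K y) * CN"
      using low[OF that, of "w y - w x"] B CN(1) unfolding Ey[symmetric]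
      by (intro mult_right_mono) (auto simp: K_def field_simps intro: sum_nonneg)
    finally show ?thesis by (simp add: field_simps)
  qed
  have "(R has_derivative (\<lambda>h. 0)) (at x)"
  proof (rule has_derivative_zero_if_little_o[OF dE _ _ T(1,2) _ _ R])
    show "E x = 0" using E[OF assms(3)] by simp
    then show "R x = 0" using N(1) by (simp add: R_def linear_0)
    show "isCont (\<lambda>y. CN / B * K y) x" by (intro continuous_intros cK)
    show "CN / B * K x = 0" by (simp add: K_def)
  qed
  then have "((\<lambda>y. w x + (N (E y) - R y)) has_derivative (\<lambda>h. 0 + (N (E' h) - 0))) (at x)"
    by (intro has_derivative_add has_derivative_const has_derivative_diff
      bounded_linear.has_derivative[OF bN] dE)
  then have dw: "(w has_derivative (\<lambda>h. N (E' h))) (at x)"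
    by (simp add: R_def)
  then show "w differentiable (at x)" by (auto simp: differentiable_def)
  \<comment> \<open>The formula for the derivative follows by differentiating \<open>M y (w y)\<close> as a product.\<close>
  have "((\<lambda>y. \<Sum>b\<in>Basis. (w y \<bullet> b) *\<^sub>R M y b) has_derivative
      (\<lambda>h. \<Sum>b\<in>Basis. (w x \<bullet> b) *\<^sub>R dderiv (\<lambda>y. M y b) x h + (dderiv w x h \<bullet> b) *\<^sub>R M x b)) (at x)"
    using dw by (intro has_derivative_sum has_derivative_scaleR has_derivative_inner_left
      dderiv_works assms) (auto simp: differentiable_def assms(3))
  then have "((\<lambda>y. M y (w y)) has_derivative
      (\<lambda>h. \<Sum>b\<in>Basis. (w x \<bullet> b) *\<^sub>R dderiv (\<lambda>y. M y b) x h + (dderiv w x h \<bullet> b) *\<^sub>R M x b)) (at x)"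
    by (rule has_derivative_transform_within_open[OF _ assms(1,3)])
      (rule linear_euclidean_expand[OF assms(2), symmetric])
  from dderiv_eq[OF this] show "M x (dderiv w x h) =
      dderiv (\<lambda>y. M y (w y)) x h - (\<Sum>b\<in>Basis. (w x \<bullet> b) *\<^sub>R dderiv (\<lambda>y. M y b) x h)"
    using linear_euclidean_expand[OF assms(2)[OF assms(3)], of "dderiv w x h"]
    by (simp add: sum.distrib)
qed

lemma C_k_on_solution:
  fixes M :: "'a::euclidean_space \<Rightarrow> 'b::euclidean_space \<Rightarrow> 'c::euclidean_space"
  assumes "open S" "\<And>y. y \<in> S \<Longrightarrow> linear (M y)" "\<And>y. y \<in> S \<Longrightarrow> inj (M y)"
    and "\<And>b. b \<in> Basis \<Longrightarrow> C_k_on k (\<lambda>y. M y b) S" "C_k_on k (\<lambda>y. M y (w y)) S"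
  shows "C_k_on k w S"
  using assms(4,5)
proof (induction k arbitrary: w)
  case 0
  have "isCont w x" if x: "x \<in> S" for x
  proof -
    have cM: "continuous_on S (\<lambda>y. M y b)" if "b \<in> Basis" for b using 0(1)[OF that] by simp
    have "\<exists>B>0. \<exists>T. open T \<and> x \<in> T \<and> T \<subseteq> S \<and> (\<forall>y\<in>T. \<forall>v. B * norm v \<le> norm (M y v))"
      by (rule linear_family_bounded_below[OF assms(1) _ x]) (use assms(2,3) x cM in blast)+
    then obtain B T where B: "B > 0" and T: "open T" "x \<in> T" "T \<subseteq> S"
      and low: "\<And>y v. y \<in> T \<Longrightarrow> B * norm v \<le> norm (M y v)" by blast
    let ?E = "\<lambda>y. M y (w y) - (\<Sum>b\<in>Basis. (w x \<bullet> b) *\<^sub>R M y b)"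
    have "isCont ?E x"
    proof (intro continuous_intros)
      show "isCont (\<lambda>y. M y (w y)) x"
        using 0(2) x by (simp add: continuous_on_eq_continuous_at[OF assms(1)])
      show "isCont (\<lambda>y. M y b) x" if "b \<in> Basis" for b
        using cM[OF that] x by (simp add: continuous_on_eq_continuous_at[OF assms(1)])
    qed
    moreover have "?E x = 0"
      using linear_euclidean_expand[OF assms(2)[OF x], of "w x"] by simp
    ultimately have "(?E \<longlongrightarrow> 0) (at x)" by (simp add: isCont_def)
    then have lim: "((\<lambda>y. norm (?E y) / B) \<longlongrightarrow> 0) (at x)"
      using tendsto_divide[OF tendsto_norm tendsto_const, of ?E 0 "at x" B] B by simp
    have "\<forall>\<^sub>F y in at x. norm (w y - w x) \<le> norm (?E y) / B"
    proof (rule eventually_at_topological[THEN iffD2], intro exI[of _ T] conjI T ballI impI)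
      fix y assume "y \<in> T"
      then have "?E y = M y (w y - w x)"
        using linear_euclidean_expand[OF assms(2), of y "w x"] T assms(2)[of y]
        by (metis (no_types) linear_diff subsetD)
      then show "norm (w y - w x) \<le> norm (?E y) / B"
        using low[OF \<open>y \<in> T\<close>, of "w y - w x"] B by (simp add: field_simps)
    qed
    from Lim_null_comparison[OF this lim] show ?thesis
      unfolding isCont_def by (simp add: LIM_zero_iff)
  qed
  then show ?case by (simp add: continuous_at_imp_continuous_on)
next
  case (Suc k)
  have dM: "(\<lambda>y. M y b) differentiable (at y)" if "b \<in> Basis" "y \<in> S" for b y
    using Suc.prems(1)[OF that(1)] that(2) by simp
  have dz: "(\<lambda>y. M y (w y)) differentiable (at y)" if "y \<in> S" for y
    using Suc.prems(2) that by simp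
  note sd = solution_differentiable[where M = M and w = w, OF assms(1,2) _ assms(3) dM dz]
  have w: "C_k_on k w S"
    by (rule Suc.IH) (use Suc.prems in \<open>blast intro: C_k_on_Suc_imp\<close>)+
  have "C_k_on k (\<lambda>x. dderiv w x h) S" for h
  proof (rule Suc.IH)
    show "C_k_on k (\<lambda>y. M y b) S" if "b \<in> Basis" for b
      using Suc.prems(1)[OF that] by (rule C_k_on_Suc_imp)
    have "C_k_on k (\<lambda>x. dderiv (\<lambda>y. M y (w y)) x h
        + (\<Sum>b\<in>Basis. ((w x \<bullet> b) * -1) *\<^sub>R dderiv (\<lambda>y. M y b) x h)) S"
      using Suc.prems w
      by (intro C_k_on_add[OF assms(1)] C_k_on_sum[OF assms(1)] C_k_on_scaleR[OF assms(1)]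
          C_k_on_mult[OF assms(1)] C_k_on_inner[OF assms(1)] C_k_on_const) auto
    then show "C_k_on k (\<lambda>y. M y (dderiv w y h)) S"
      by (rule C_k_on_cong[OF assms(1), rotated]) (simp add: sd(2) sum_negf)
  qed
  then show ?case using sd(1) by simp
qed

lemma smooth_on_solution:
  fixes M :: "'a::euclidean_space \<Rightarrow> 'b::euclidean_space \<Rightarrow> 'c::euclidean_space"
  assumes "open S" "\<And>y. y \<in> S \<Longrightarrow> linear (M y)" "\<And>y. y \<in> S \<Longrightarrow> inj (M y)"
    and "\<And>b. b \<in> Basis \<Longrightarrow> smooth_on (\<lambda>y. M y b) S" "smooth_on (\<lambda>y. M y (w y)) S"
  shows "smooth_on w S"
  using assms(4,5) C_k_on_solution[of S M _ w, OF assms(1-3)] unfolding smooth_on_def by blast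

subsection \<open>Bump functions\<close>

text \<open>The derivatives of \<open>flat 0\<close>, that is of \<open>exp (- 1 / t)\<close> extended by 0, are combinations of
  the functions \<open>flat n\<close>.\<close>

definition flat :: "nat \<Rightarrow> real \<Rightarrow> real"
  where "flat n t = (if t > 0 then exp (- 1 / t) / t ^ n else 0)"

lemma flat_tendsto_0: "(flat n \<longlongrightarrow> 0) (at 0)"
proof -
  have "((\<lambda>t::real. (inverse t) ^ n / exp (inverse t)) \<longlongrightarrow> 0) (at_right 0)"
    using filterlim_compose[OF tendsto_power_div_exp_0 filterlim_inverse_at_top_right] by blast
  then have "(flat n \<longlongrightarrow> 0) (at_right 0)"
  proof (rule Lim_transform_eventually)
    show "\<forall>\<^sub>F t in at_right 0. (inverse t) ^ n / exp (inverse t) = flat n t"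
      by (auto simp: eventually_at_filter flat_def exp_minus field_simps)
  qed
  moreover have "(flat n \<longlongrightarrow> 0) (at_left 0)"
    by (rule Lim_transform_eventually[OF tendsto_const]) (auto simp: eventually_at_filter flat_def)
  ultimately show ?thesis by (simp add: filterlim_at_split)
qed

lemma flat_has_derivative: "(flat n has_real_derivative flat (n + 2) t - n * flat (n + 1) t) (at t)"
proof -
  consider "t > 0" | "t = 0" | "t < 0" by linarith
  then show ?thesis
  proof cases
    case 1
    have "((\<lambda>t. exp (- 1 / t) / t ^ n) has_real_derivative flat (n + 2) t - n * flat (n
        + 1) t) (at t)"
    proof (rule DERIV_cong[OF DERIV_divide])
      show "((\<lambda>t. t ^ n) has_real_derivative n * (t ^ n / t)) (at t)"
        using 1 by (intro DERIV_cong[OF DERIV_pow]) (cases n, auto)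
      show "((\<lambda>t. exp (- 1 / t)) has_real_derivative exp (- 1 / t) * (1 / t ^ 2)) (at t)"
        using 1 by (auto intro!: derivative_eq_intros simp: power2_eq_square)
      show "t ^ n \<noteq> 0" using 1 by simp
      show "(exp (- 1 / t) * (1 / t\<^sup>2) * t ^ n
          - exp (- 1 / t) * (real n * (t ^ n / t))) / (t ^ n * t ^ n) =
          flat (n + 2) t - real n * flat (n + 1) t"
        using 1 by (simp add: flat_def field_simps power2_eq_square)
    qed
    then show ?thesis
      by (rule has_field_derivative_transform_within_open[of _ _ _ "{0<..}"])
        (use 1 in \<open>auto simp: flat_def\<close>)
  next
    case 2
    have "((\<lambda>y. (flat n y - flat n 0) / (y - 0)) \<longlongrightarrow> 0) (at 0)"
      by (rule Lim_transform_eventually[OF flat_tendsto_0[of "n + 1"]])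
        (auto simp: flat_def eventually_at_filter)
    then show ?thesis using 2 by (simp add: has_field_derivative_iff flat_def)
  next
    case 3
    show ?thesis
      by (rule has_field_derivative_transform_within_open[of "\<lambda>_. 0" _ _ "{..<0}"])
        (use 3 in \<open>auto simp: flat_def\<close>)
  qed
qed

lemma smooth_on_flat: "smooth_on (flat n) UNIV"
proof -
  have d: "(flat n has_derivative (\<lambda>v. (flat (n + 2) t + (- n) * flat (n + 1) t) * v)) (at t)"
      for n t
    using flat_has_derivative[of n t] by (simp add: has_field_derivative_def)
  have "C_k_on k (flat n) UNIV" for k
  proof (induction k arbitrary: n)
    case 0
    show ?case using has_derivative_continuous[OF d]
      by (auto intro!: continuous_at_imp_continuous_on)
  next
    case (Suc k)
    have "C_k_on k (\<lambda>t. (flat (n + 2) t + (- n) * flat (n + 1) t) * v) UNIV" for v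
      by (intro C_k_on_mult C_k_on_add C_k_on_const Suc) auto
    then show ?case using dderiv_eq[OF d[of n]] d[of n] by (auto simp: differentiable_def)
  qed
  then show ?thesis by (simp add: smooth_on_def)
qed

lemma exists_bump:
  fixes a :: "'a::euclidean_space"
  assumes "0 < r" "r < R"
  obtains \<beta> :: "'a \<Rightarrow> real" where "smooth_on \<beta> UNIV" "\<And>y. y \<in> ball a r \<Longrightarrow> \<beta> y = 1"
    "\<And>y. y \<notin> ball a R \<Longrightarrow> \<beta> y = 0"
proof
  let ?n = "\<lambda>y. (y - a) \<bullet> (y - a)"
  let ?c = "flat 0 (R^2 - r^2)"
  have c: "?c > 0" using assms by (simp add: flat_def power_strict_mono)
  have c0: "flat 0 ?c > 0" using c by (simp add: flat_def)
  \<comment> \<open>The inner \<open>flat 0\<close> vanishes on the small ball and is at least \<open>?c\<close> outside the large one.\<close>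
  define \<beta> where "\<beta> = (\<lambda>y. flat 0 (?c - flat 0 (?n y - r^2)) * inverse (flat 0 ?c))"
  have n: "smooth_on (\<lambda>y. ?n y - r^2) UNIV"
    by (intro smooth_on_diff smooth_on_inner smooth_on_const smooth_on_linear) (auto simp:
        linear_id[unfolded id_def])
  show "smooth_on \<beta> UNIV" unfolding \<beta>_def
    by (intro smooth_on_mult smooth_on_const smooth_on_compose[OF _ _ _ smooth_on_flat]
      smooth_on_diff n) auto
  show "\<beta> y = 1" if "y \<in> ball a r" for y
  proof -
    have "?n y < r^2" using that assms
      by (simp add: dist_norm norm_minus_commute power2_norm_eq_inner[symmetric] power_strict_mono)
    then have "flat 0 (?n y - r^2) = 0" by (simp add: flat_def)
    then show ?thesis using c0 by (simp add: \<beta>_def)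
  qed
  show "\<beta> y = 0" if "y \<notin> ball a R" for y
  proof -
    have "?n y \<ge> R^2" using that assms
      by (simp add: dist_norm norm_minus_commute power2_norm_eq_inner[symmetric] power_mono)
    moreover have "R^2 - r^2 > 0" using assms by (simp add: power_strict_mono)
    ultimately have "flat 0 (?n y - r^2) \<ge> ?c"
      by (simp add: flat_def frac_le)
    then show ?thesis by (simp add: \<beta>_def flat_def[of 0 "_ - _"])
  qed
qed

section \<open>Total differential equations\<close>

subsection \<open>Uniform bounds on compact convex sets\<close>

lemma smooth_on_derivative_bound:
  fixes f :: "'a::euclidean_space \<Rightarrow> 'b::real_normed_vector"
  assumes "smooth_on f S" "compact K" "K \<subseteq> S"
  shows "\<exists>C\<ge>0. \<forall>y\<in>K. \<forall>h. norm (dderiv f y h) \<le> C * norm h"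
proof -
  have "\<exists>C\<ge>0. \<forall>y\<in>K. norm (dderiv f y e) \<le> C" for e
  proof -
    have "compact ((\<lambda>y. dderiv f y e) ` K)"
      using smooth_on_continuous_on[OF smooth_on_dderiv[OF assms(1)]] assms(2,3)
      by (intro compact_continuous_image) (auto intro: continuous_on_subset)
    then show ?thesis
      by (metis (no_types, lifting) bounded_pos compact_imp_bounded image_eqI less_imp_le)
  qed
  then obtain C where C: "\<And>e. C e \<ge> 0" "\<And>e y. y \<in> K \<Longrightarrow> norm (dderiv f y e) \<le> C e" by metis
  have "norm (dderiv f y h) \<le> (\<Sum>e\<in>Basis. C e) * norm h" if "y \<in> K" for y h
  proof -
    have "dderiv f y h = (\<Sum>e\<in>Basis. (h \<bullet> e) *\<^sub>R dderiv f y e)"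
      using that assms by (intro linear_euclidean_expand linear_dderiv smooth_on_differentiable[OF
          assms(1)]) auto
    also have "norm \<dots> \<le> (\<Sum>e\<in>Basis. norm h * C e)"
      by (intro sum_norm_le) (auto intro!: mult_mono simp: Basis_le_norm C that)
    finally show ?thesis by (simp add: sum_distrib_left mult.commute)
  qed
  then show ?thesis using C(1) by (intro exI[of _ "\<Sum>e\<in>Basis. C e"]) (auto intro: sum_nonneg)
qed

lemma smooth_on_Lipschitz:
  fixes f :: "'a::euclidean_space \<Rightarrow> 'b::real_normed_vector"
  assumes "smooth_on f S" "compact K" "convex K" "K \<subseteq> S"
  shows "\<exists>C\<ge>0. \<forall>y\<in>K. \<forall>z\<in>K. norm (f y - f z) \<le> C * norm (y - z)"
proof -
  obtain C where C: "C \<ge> 0" "\<And>y h. y \<in> K \<Longrightarrow> norm (dderiv f y h) \<le> C * norm h"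
    using smooth_on_derivative_bound[OF assms(1,2,4)] by blast
  have "norm (f y - f z) \<le> C * norm (y - z)" if "y \<in> K" "z \<in> K" for y z
  proof (rule differentiable_bound[OF assms(3) _ _ that])
    show "(f has_derivative dderiv f x) (at x within K)" if "x \<in> K" for x
      using that assms(1,4)
      by (intro has_derivative_at_withinI[OF dderiv_works] smooth_on_differentiable[OF assms(1)])
          auto
    show "onorm (dderiv f x) \<le> C" if "x \<in> K" for x
      by (rule onorm_le, rule C(2)[OF that])
  qed
  then show ?thesis using C(1) by blast
qed

lemma smooth_on_Taylor_bound:
  fixes f :: "'a::euclidean_space \<Rightarrow> 'b::real_normed_vector"
  assumes "smooth_on f S" "compact K" "convex K" "K \<subseteq> S"
  shows "\<exists>C\<ge>0. \<forall>y\<in>K. \<forall>z\<in>K. norm (f z - f y - dderiv f y (z - y)) \<le> C * (norm (z - y))^2"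
proof -
  have "\<exists>C\<ge>0. \<forall>y\<in>K. \<forall>z\<in>K. norm (dderiv f y e - dderiv f z e) \<le> C * norm (y - z)" for e
    by (rule smooth_on_Lipschitz[OF smooth_on_dderiv[OF assms(1)] assms(2-4)])
  then obtain C where C: "\<And>e. C e \<ge> 0"
    "\<And>e y z. y \<in> K \<Longrightarrow> z \<in> K \<Longrightarrow> norm (dderiv f y e - dderiv f z e) \<le> C e * norm (y - z)"
    by metis
  define D where "D = (\<Sum>e\<in>Basis. C e)"
  have D: "norm (dderiv f x h - dderiv f y h) \<le> (D * norm (x - y)) * norm h"
    if "x \<in> K" "y \<in> K" for x y h
  proof -
    have "norm (dderiv f x h - dderiv f y h) \<le>
        norm h * (\<Sum>e\<in>Basis. norm (dderiv f x e - dderiv f y e))"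
      using that assms(1,4)
      by (intro linear_family_diff_bound linear_dderiv smooth_on_differentiable[OF assms(1)]) auto
    also have "\<dots> \<le> norm h * (\<Sum>e\<in>Basis. C e * norm (x - y))"
      by (intro mult_left_mono sum_mono C that) auto
    finally show ?thesis by (simp add: D_def sum_distrib_right mult_ac)
  qed
  have "norm (f z - f y - dderiv f y (z - y)) \<le> norm (z - y) * (D * norm (z - y))"
    if yz: "y \<in> K" "z \<in> K" for y z
  proof (rule differentiable_bound_linearization[where S = "closed_segment y z"])
    have sub: "closed_segment y z \<subseteq> K" using yz assms(3) by (simp add: closed_segment_subset)
    show "y + t *\<^sub>R (z - y) \<in> closed_segment y z" if "t \<in> {0..1}" for t
      unfolding closed_segment_def
      by (intro CollectI exI[of _ t]) (use that in \<open>auto simp: algebra_simps\<close>)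
    show "(f has_derivative dderiv f x) (at x within closed_segment y z)"
      if "x \<in> closed_segment y z" for x
      using that assms(1,4) sub
      by (intro has_derivative_at_withinI[OF dderiv_works] smooth_on_differentiable[OF assms(1)])
          auto
    show "onorm (dderiv f x - dderiv f y) \<le> D * norm (z - y)"
      if x: "x \<in> closed_segment y z" for x
    proof (rule onorm_le)
      fix h
      have "norm (dderiv f x h - dderiv f y h) \<le> (D * norm (x - y)) * norm h"
        using D x sub yz by auto
      also have "\<dots> \<le> (D * norm (z - y)) * norm h"
        using segment_bound(1)[OF x] C(1)
        by (intro mult_right_mono mult_left_mono) (auto simp: D_def norm_minus_commute intro:
            sum_nonneg)
      finally show "norm ((dderiv f x - dderiv f y) h) \<le> D * norm (z - y) * norm h" by simp
    qed
  qed simp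
  then have "norm (f z - f y - dderiv f y (z - y)) \<le> D * (norm (z - y))^2" if "y \<in> K" "z \<in> K"
      for y z
    using that by (simp add: power2_eq_square mult_ac)
  then show ?thesis using C(1) by (intro exI[of _ D]) (auto simp: D_def intro: sum_nonneg)
qed

lemma linear_family_bound:
  fixes G :: "'p \<Rightarrow> 'b::euclidean_space \<Rightarrow> 'c::real_normed_vector"
  assumes "\<And>p. p \<in> K \<Longrightarrow> linear (G p)"
    and "\<And>b. b \<in> Basis \<Longrightarrow> \<exists>C\<ge>0. \<forall>p\<in>K. norm (G p b) \<le> C * k p"
  shows "\<exists>C\<ge>0. \<forall>p\<in>K. \<forall>v. norm (G p v) \<le> C * k p * norm v"
proof -
  obtain C where C: "\<And>b. b \<in> Basis \<Longrightarrow> C b \<ge> 0"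
    "\<And>b p. b \<in> Basis \<Longrightarrow> p \<in> K \<Longrightarrow> norm (G p b) \<le> C b * k p"
    using assms(2) by metis
  have "norm (G p v) \<le> (\<Sum>b\<in>Basis. C b) * k p * norm v" if p: "p \<in> K" for p v
  proof -
    have "G p v = (\<Sum>b\<in>Basis. (v \<bullet> b) *\<^sub>R G p b)"
      by (rule linear_euclidean_expand[OF assms(1)[OF p]])
    also have "norm \<dots> \<le> (\<Sum>b\<in>Basis. norm v * (C b * k p))"
      by (intro sum_norm_le) (auto intro!: mult_mono simp: Basis_le_norm C p)
    also have "\<dots> = (\<Sum>b\<in>Basis. C b) * k p * norm v"
      by (simp add: sum_distrib_left sum_distrib_right mult_ac)
    finally show ?thesis .
  qed
  then show ?thesis
    by (intro exI[of _ "\<Sum>b\<in>Basis. C b"]) (auto intro: sum_nonneg C(1))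
qed

text \<open>The derivative at \<open>y\<close> of a smooth family of linear maps \<open>F y\<close> is, in each direction \<open>h\<close>,
  linear in the argument of the family.\<close>

lemma linear_dderiv_family:
  fixes F :: "'a::euclidean_space \<Rightarrow> 'b::real_vector \<Rightarrow> 'c::real_normed_vector"
  assumes "open S" "\<And>y. y \<in> S \<Longrightarrow> linear (F y)" "\<And>v. smooth_on (\<lambda>y. F y v) S" "y \<in> S"
  shows "linear (\<lambda>v. dderiv (\<lambda>y. F y v) y h)"
proof (rule linearI)
  have d: "((\<lambda>y. F y v) has_derivative dderiv (\<lambda>y. F y v) y) (at y)" for v
    using assms by (intro dderiv_works smooth_on_differentiable)
  show "dderiv (\<lambda>y. F y (v + w)) y h = dderiv (\<lambda>y. F y v) y h + dderiv (\<lambda>y. F y w) y h" for v w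
  proof -
    have "((\<lambda>y. F y (v + w)) has_derivative (\<lambda>h. dderiv (\<lambda>y. F y v) y h
        + dderiv (\<lambda>y. F y w) y h)) (at y)"
      by (rule has_derivative_transform_within_open[OF has_derivative_add[OF d d] assms(1,4)])
        (simp add: assms(2) linear_add)
    from dderiv_eq[OF this] show ?thesis by simp
  qed
  show "dderiv (\<lambda>y. F y (r *\<^sub>R v)) y h = r *\<^sub>R dderiv (\<lambda>y. F y v) y h" for r v
  proof -
    have "((\<lambda>y. F y (r *\<^sub>R v)) has_derivative (\<lambda>h. r *\<^sub>R dderiv (\<lambda>y. F y v) y h)) (at y)"
      by (rule has_derivative_transform_within_open[OF has_derivative_scaleR_right[OF d]
          assms(1,4)])
        (simp add: assms(2) linear_scale)
    from dderiv_eq[OF this] show ?thesis by simp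
  qed
qed

subsection \<open>The integral equation\<close>

text \<open>A continuous solution of \<open>c s = y0 + (\<integral>t\<in>[0,1]. F (c (t s)) s)\<close> on a small ball, by Banach's
  fixed point theorem in the space of bounded continuous functions. To make the integral
  operator act on that whole space, arguments and values are first projected onto the balls
  concerned.\<close>

lemma integral_equation_solution:
  fixes F :: "'a::euclidean_space \<Rightarrow> 'a \<Rightarrow> 'a"
  assumes lin: "\<And>y. y \<in> cball y0 R \<Longrightarrow> linear (F y)"
    and bnd: "\<And>y v. y \<in> cball y0 R \<Longrightarrow> norm (F y v) \<le> B * norm v"
    and Lip: "\<And>y z v. y \<in> cball y0 R \<Longrightarrow> z \<in> cball y0 R \<Longrightarrow>
      norm (F y v - F z v) \<le> L * norm (y - z) * norm v"
    and pos: "R > 0" "\<rho> > 0" "L \<ge> 0" "B \<ge> 0" and small: "L * \<rho> \<le> 1 / 2" "B * \<rho> \<le> R"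
  shows "\<exists>c. continuous_on UNIV c \<and> (\<forall>s. c s \<in> cball y0 R) \<and>
    (\<forall>s\<in>cball 0 \<rho>. c s = y0 + integral {0..1} (\<lambda>t. F (c (t *\<^sub>R s)) s))"
proof -
  define \<pi> where "\<pi> = closest_point (cball (0::'a) \<rho>)"
  define \<kappa> where "\<kappa> = closest_point (cball y0 R)"
  have \<pi>: "\<pi> s \<in> cball 0 \<rho>" for s
    unfolding \<pi>_def using pos by (intro closest_point_in_set) auto
  have \<pi>n: "norm (\<pi> s) \<le> \<rho>" for s using \<pi>[of s] by simp
  have \<pi>id: "\<pi> s = s" if "s \<in> cball 0 \<rho>" for s
    unfolding \<pi>_def using that by (rule closest_point_self)
  have \<kappa>: "\<kappa> y \<in> cball y0 R" for y
    unfolding \<kappa>_def using pos by (intro closest_point_in_set) auto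
  have \<kappa>id: "\<kappa> y = y" if "y \<in> cball y0 R" for y
    unfolding \<kappa>_def using that by (rule closest_point_self)
  have c\<pi>: "continuous_on UNIV \<pi>" and c\<kappa>: "continuous_on UNIV \<kappa>"
    unfolding \<pi>_def \<kappa>_def using pos by (auto intro!: continuous_on_closest_point)
  have \<kappa>L: "norm (\<kappa> y - \<kappa> z) \<le> norm (y - z)" for y z
    using closest_point_lipschitz[of "cball y0 R" y z] pos by (simp add: \<kappa>_def dist_norm)
  have cF: "continuous_on (cball y0 R) (\<lambda>y. F y v)" for v
  proof (rule lipschitz_on_continuous_on)
    show "(L * norm v)-lipschitz_on (cball y0 R) (\<lambda>y. F y v)"
      using Lip[of _ _ v] pos by (intro lipschitz_onI) (auto simp: dist_norm mult_ac)
  qed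
  define I where "I = (\<lambda>u s t. F (\<kappa> (u (t *\<^sub>R \<pi> s))) (\<pi> s))"
  have cI: "continuous_on (UNIV \<times> {0..1}) (\<lambda>(s, t::real). I u s t)" if "continuous_on UNIV u" for u
  proof -
    have "(\<lambda>(s, t). I u s t) = (\<lambda>p. \<Sum>b\<in>Basis. (\<pi> (fst p) \<bullet> b) *\<^sub>R F (\<kappa> (u (snd p *\<^sub>R \<pi> (fst p))))
        b)"
      unfolding I_def by (auto simp: fun_eq_iff intro!: linear_euclidean_expand lin \<kappa>)
    moreover have "continuous_on (UNIV \<times> {0..1}) \<dots>"
      by (intro continuous_intros continuous_on_compose2[OF c\<pi>] continuous_on_compose2[OF cF]
        continuous_on_compose2[OF c\<kappa>] continuous_on_compose2[OF that]) (use \<kappa> in auto)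
    ultimately show ?thesis by simp
  qed
  define \<Phi> where "\<Phi> = (\<lambda>u s. y0 + integral {0..1} (I u s))"
  have cIs: "continuous_on {0..1} (I u s)" if "continuous_on UNIV u" for u s
  proof -
    have "continuous_on {0..1} (\<lambda>t. case (s, t) of (s, t) \<Rightarrow> I u s t)"
      by (rule continuous_on_compose2[OF cI[OF that]]) (auto intro!: continuous_intros)
    then show ?thesis by simp
  qed
  have nI: "norm (I u s t) \<le> R" for u s t
  proof -
    have "norm (I u s t) \<le> B * norm (\<pi> s)" unfolding I_def by (rule bnd[OF \<kappa>])
    also have "\<dots> \<le> B * \<rho>" using \<pi>n pos by (intro mult_left_mono) auto
    finally show ?thesis using small by simp
  qed
  have \<Phi>R: "\<Phi> u s \<in> cball y0 R" if "continuous_on UNIV u" for u s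
  proof -
    have "norm (integral {0..1} (I u s)) \<le> R * (1 - 0)"
      by (intro integral_bound cIs that nI) auto
    then show ?thesis by (simp add: \<Phi>_def dist_norm)
  qed
  have c\<Phi>: "continuous_on UNIV (\<Phi> u)" if "continuous_on UNIV u" for u
    unfolding \<Phi>_def using integral_continuous_on_param[of UNIV 0 1 "I u"] cI[OF that]
    by (auto intro!: continuous_intros)
  have b\<Phi>: "\<Phi> u \<in> bcontfun" if "continuous_on UNIV u" for u
  proof (rule bcontfun_normI[OF c\<Phi>[OF that]])
    fix s show "norm (\<Phi> u s) \<le> norm y0 + R"
      using \<Phi>R[OF that, of s] norm_triangle_ineq2[of "\<Phi> u s" y0]
      by (simp add: dist_norm norm_minus_commute)
  qed
  define T where "T = (\<lambda>u. Bcontfun (\<Phi> (apply_bcontfun u)))"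
  have T: "apply_bcontfun (T u) = \<Phi> (apply_bcontfun u)" for u
    unfolding T_def by (intro Bcontfun_inverse b\<Phi>) simp
  have "dist (T u) (T w) \<le> 1 / 2 * dist u w" for u w
  proof (rule dist_bound)
    fix s
    have "norm (I u s t - I w s t) \<le> 1 / 2 * dist u w" for t
    proof -
      have "norm (I u s t - I w s t) \<le> L * norm (\<kappa> (u (t *\<^sub>R \<pi> s))
          - \<kappa> (w (t *\<^sub>R \<pi> s))) * norm (\<pi> s)"
        unfolding I_def by (rule Lip[OF \<kappa> \<kappa>])
      also have "\<dots> \<le> L * dist u w * \<rho>"
        using \<kappa>L[of "u (t *\<^sub>R \<pi> s)" "w (t *\<^sub>R \<pi> s)"] dist_bounded[of u "t *\<^sub>R \<pi> s" w] \<pi>n pos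
        by (intro mult_mono) (auto simp: dist_norm intro: order_trans)
      also have "\<dots> = (L * \<rho>) * dist u w" by simp
      also have "\<dots> \<le> 1 / 2 * dist u w" using small by (intro mult_right_mono) auto
      finally show ?thesis .
    qed
    then have "norm (integral {0..1} (\<lambda>t. I u s t - I w s t)) \<le> 1 / 2 * dist u w * (1 - 0)"
      by (intro integral_bound continuous_on_diff cIs) auto
    moreover have "integral {0..1} (\<lambda>t. I u s t - I w s t) = \<Phi> u s - \<Phi> w s"
      unfolding \<Phi>_def by (subst integral_diff) (auto intro!: integrable_continuous_real cIs)
    ultimately show "dist (T u s) (T w s) \<le> 1 / 2 * dist u w" by (simp add: T dist_norm)
  qed
  then obtain u where "T u = u"
    using banach_fix_type[of "1/2" T] by auto
  then have u: "\<Phi> u = apply_bcontfun u" using T by metis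
  show ?thesis
  proof (intro exI[of _ "apply_bcontfun u"] conjI allI ballI)
    show inR: "u s \<in> cball y0 R" for s using \<Phi>R[of u s] u by simp
    show "u s = y0 + integral {0..1} (\<lambda>t. F (u (t *\<^sub>R s)) s)" if "s \<in> cball 0 \<rho>" for s
    proof -
      have "u s = \<Phi> u s" using u by simp
      then show ?thesis using \<pi>id[OF that] \<kappa>id[OF inR] by (simp add: \<Phi>_def I_def)
    qed
  qed simp
qed

lemma integral_equation_ray_derivative:
  fixes F :: "'a::euclidean_space \<Rightarrow> 'a \<Rightarrow> 'a"
  assumes c: "continuous_on UNIV c" "\<And>s. c s \<in> K"
    and cF: "\<And>v. continuous_on K (\<lambda>y. F y v)" and lin: "\<And>y. y \<in> K \<Longrightarrow> linear (F y)"
    and eq: "\<And>s. s \<in> cball 0 \<rho> \<Longrightarrow> c s = y0 + integral {0..1} (\<lambda>t. F (c (t *\<^sub>R s)) s)"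
    and s: "s \<in> cball 0 \<rho>" and l: "l \<in> {0..1}"
  shows "((\<lambda>l. c (l *\<^sub>R s)) has_vector_derivative F (c (l *\<^sub>R s)) s) (at l within {0..1})"
proof -
  define f where "f = (\<lambda>t. F (c (t *\<^sub>R s)) s)"
  define \<Gamma> where "\<Gamma> = (\<lambda>m. integral {0..m} f)"
  have cf: "continuous_on {0..1} f" unfolding f_def
    by (rule continuous_on_compose2[OF cF continuous_on_compose2[OF c(1)]])
      (auto intro!: continuous_intros c)
  have d\<Gamma>: "(\<Gamma> has_vector_derivative f m) (at m within {0..1})" if "m \<in> {0..1}" for m
    unfolding \<Gamma>_def by (rule integral_has_vector_derivative[OF cf that])
  have c\<Gamma>: "c (m *\<^sub>R s) = y0 + \<Gamma> m" if m: "m \<in> {0..1}" for m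
  proof -
    have "((\<lambda>t. m *\<^sub>R f (t * m)) has_integral (\<Gamma> (1 * m) - \<Gamma> (0 * m))) {0..1}"
    proof (rule fundamental_theorem_of_calculus)
      fix t :: real assume t: "t \<in> {0..1}"
      have "((\<lambda>t. t * m) has_vector_derivative m) (at t within {0..1})"
        by (auto intro!: derivative_eq_intros)
      moreover have "(\<lambda>t. t * m) ` {0..1} \<subseteq> {0..1}"
        using m by (auto simp: mult_le_one)
      then have "(\<Gamma> has_vector_derivative f (t * m)) (at (t * m) within (\<lambda>t. t * m) ` {0..1})"
        using t m by (intro has_vector_derivative_within_subset[OF d\<Gamma>]) (auto simp: mult_le_one)
      ultimately show "((\<lambda>t. \<Gamma> (t * m)) has_vector_derivative m *\<^sub>R f (t * m)) (at t within {0..1})"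
        using vector_diff_chain_within[of "\<lambda>t. t * m" m t "{0..1}" \<Gamma>] by (simp add: o_def)
    qed simp
    then have "integral {0..1} (\<lambda>t. m *\<^sub>R f (t * m)) = \<Gamma> (1 * m) - \<Gamma> (0 * m)"
      by (rule integral_unique)
    moreover have "F (c (t *\<^sub>R (m *\<^sub>R s))) (m *\<^sub>R s) = m *\<^sub>R f (t * m)" for t
      unfolding f_def using lin[OF c(2)] by (simp add: linear_scale)
    moreover have "m *\<^sub>R s \<in> cball 0 \<rho>"
      using s m mult_mono[of "\<bar>m\<bar>" 1 "norm s" \<rho>] by auto
    ultimately have "c (m *\<^sub>R s) = y0 + (\<Gamma> (1 * m) - \<Gamma> (0 * m))"
      using eq[of "m *\<^sub>R s"] by (simp only:)
    then show ?thesis by (simp add: \<Gamma>_def)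
  qed
  have "((\<lambda>l. y0 + \<Gamma> l) has_vector_derivative f l) (at l within {0..1})"
    using has_vector_derivative_add[OF has_vector_derivative_const d\<Gamma>[OF l], of y0] by simp
  then show ?thesis unfolding f_def
    by (rule has_vector_derivative_transform[OF l, rotated]) (use c\<Gamma> in auto)
qed

text \<open>Frobenius' theorem for a total differential equation \<open>Dc(s) v = F (c s) v\<close>. Let \<open>c\<close> solve
  the equation along rays. Differentiability of \<open>c\<close> at \<open>s\<close> comes from a comparison on \<open>[0,1]\<close>
  of the ray \<open>\<eta> l = c (l (s + v))\<close> with \<open>\<zeta> l = \<gamma> l + l F (\<gamma> l) v\<close>, where \<open>\<gamma> l = c (l s)\<close>: by
  the symmetry condition, \<open>\<zeta>\<close> satisfies the differential equation of \<open>\<eta>\<close> up to an error of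
  order \<open>norm v\<^sup>2\<close>, hence \<open>\<eta> 1 - \<zeta> 1 = c (s + v) - c s - F (c s) v\<close> is of that order too.\<close>

lemma total_differential_equation_estimate:
  fixes F :: "'a::euclidean_space \<Rightarrow> 'a \<Rightarrow> 'a" and F' :: "'a \<Rightarrow> 'a \<Rightarrow> 'a \<Rightarrow> 'a"
  assumes lin: "\<And>y. y \<in> cball y0 R \<Longrightarrow> linear (F y)"
    and lin': "\<And>y h. y \<in> cball y0 R \<Longrightarrow> linear (F' y h)"
    and lin'': "\<And>y v. y \<in> cball y0 R \<Longrightarrow> linear (\<lambda>h. F' y h v)"
    and der: "\<And>y v. y \<in> cball y0 R \<Longrightarrow> ((\<lambda>y. F y v) has_derivative (\<lambda>h. F' y h v)) (at y)"
    and bnd: "\<And>y v. y \<in> cball y0 R \<Longrightarrow> norm (F y v) \<le> B * norm v"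
    and bnd': "\<And>y h v. y \<in> cball y0 R \<Longrightarrow> norm (F' y h v) \<le> L * norm h * norm v"
    and Lip: "\<And>y z v. y \<in> cball y0 R \<Longrightarrow> z \<in> cball y0 R \<Longrightarrow>
      norm (F y v - F z v) \<le> L * norm (y - z) * norm v"
    and Tay: "\<And>y z v. y \<in> cball y0 R \<Longrightarrow> z \<in> cball y0 R \<Longrightarrow>
      norm (F z v - F y v - F' y (z - y) v) \<le> C * (norm (z - y))^2 * norm v"
    and sym: "\<And>y v w. y \<in> cball y0 R \<Longrightarrow> F' y (F y v) w = F' y (F y w) v"
    and pos: "R > 0" "\<rho> > 0" "L \<ge> 0" "B \<ge> 0" "C \<ge> 0" and small: "L * \<rho> \<le> 1 / 2" "B * \<rho> \<le> R / 2"
    and c: "\<And>s. s \<in> cball 0 \<rho> \<Longrightarrow> c s \<in> cball y0 (R / 2)" "c 0 = y0"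
    and ray: "\<And>s l. s \<in> cball 0 \<rho> \<Longrightarrow> l \<in> {0..1} \<Longrightarrow>
      ((\<lambda>l. c (l *\<^sub>R s)) has_vector_derivative F (c (l *\<^sub>R s)) s) (at l within {0..1})"
    and s: "s \<in> cball 0 \<rho>" "s + v \<in> cball 0 \<rho>" and v: "B * norm v \<le> R / 2"
  shows "norm (c (s + v) - c s - F (c s) v) \<le> 2 * (L * B + C * B^2 * \<rho>) * (norm v)^2"
proof -
  define \<gamma> where "\<gamma> = (\<lambda>l. c (l *\<^sub>R s))"
  define \<eta> where "\<eta> = (\<lambda>l. c (l *\<^sub>R (s + v)))"
  define \<zeta> where "\<zeta> = (\<lambda>l. \<gamma> l + l *\<^sub>R F (\<gamma> l) v)"
  define \<delta> where "\<delta> = (\<lambda>l. \<eta> l - \<zeta> l)"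
  define \<zeta>' where "\<zeta>' = (\<lambda>l. F (\<gamma> l) s + (l *\<^sub>R F' (\<gamma> l) (F (\<gamma> l) s) v + F (\<gamma> l) v))"
  define C' where "C' = (L * B + C * B^2 * \<rho>) * (norm v)^2"
  have scaled: "l *\<^sub>R u \<in> cball 0 \<rho>" if "l \<in> {0..1}" "u \<in> cball 0 \<rho>" for l and u :: 'a
    using that mult_mono[of "\<bar>l\<bar>" 1 "norm u" \<rho>] by auto
  have \<gamma>2: "\<gamma> l \<in> cball y0 (R / 2)" if "l \<in> {0..1}" for l
    unfolding \<gamma>_def using that s by (intro c scaled)
  have \<gamma>R: "\<gamma> l \<in> cball y0 R" if "l \<in> {0..1}" for l
    using \<gamma>2[OF that] pos by simp
  have \<eta>R: "\<eta> l \<in> cball y0 R" if "l \<in> {0..1}" for l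
  proof -
    have "\<eta> l \<in> cball y0 (R / 2)"
      unfolding \<eta>_def using that s by (intro c scaled)
    then show ?thesis using pos by simp
  qed
  have lF: "norm (l *\<^sub>R F (\<gamma> l) v) \<le> B * norm v" if "l \<in> {0..1}" for l
    using bnd[OF \<gamma>R[OF that], of v] that mult_mono[of "\<bar>l\<bar>" 1 "norm (F (\<gamma> l) v)" "B * norm v"]
        by auto
  have \<zeta>R: "\<zeta> l \<in> cball y0 R" if "l \<in> {0..1}" for l
  proof -
    have "norm (\<zeta> l - y0) \<le> norm (\<gamma> l - y0) + norm (l *\<^sub>R F (\<gamma> l) v)"
      unfolding \<zeta>_def using norm_triangle_ineq[of "\<gamma> l - y0" "l *\<^sub>R F (\<gamma> l) v"]
          by (simp add: algebra_simps)
    also have "\<dots> \<le> R / 2 + R / 2"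
      using \<gamma>2[OF that] lF[OF that] v by (intro add_mono) (auto simp: dist_norm norm_minus_commute)
    finally show ?thesis by (simp add: dist_norm norm_minus_commute)
  qed
  have d\<gamma>: "(\<gamma> has_vector_derivative F (\<gamma> l) s) (at l within {0..1})" if "l \<in> {0..1}" for l
    unfolding \<gamma>_def by (rule ray[OF s(1) that])
  have d\<eta>: "(\<eta> has_vector_derivative F (\<eta> l) (s + v)) (at l within {0..1})" if "l \<in> {0..1}" for l
    unfolding \<eta>_def by (rule ray[OF s(2) that])
  have d\<zeta>: "(\<zeta> has_vector_derivative \<zeta>' l) (at l within {0..1})" if l: "l \<in> {0..1}" for l
  proof -
    have "((\<lambda>l. F (\<gamma> l) v) has_vector_derivative F' (\<gamma> l) (F (\<gamma> l) s) v) (at l within {0..1})"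
      using vector_derivative_diff_chain_within[OF d\<gamma>[OF l] has_derivative_at_withinI[OF der[OF
          \<gamma>R[OF l]]]]
      by (simp add: o_def)
    then have "((\<lambda>l. l *\<^sub>R F (\<gamma> l) v) has_vector_derivative
        (l *\<^sub>R F' (\<gamma> l) (F (\<gamma> l) s) v + 1 *\<^sub>R F (\<gamma> l) v)) (at l within {0..1})"
      by (intro has_vector_derivative_scaleR) (auto intro!: derivative_eq_intros)
    then show ?thesis unfolding \<zeta>_def \<zeta>'_def
      by (intro has_vector_derivative_add d\<gamma> l) simp
  qed
  have d\<delta>: "(\<delta> has_vector_derivative (F (\<eta> l) (s + v) - \<zeta>' l)) (at l within {0..1})"
      if "l \<in> {0..1}" for l
    unfolding \<delta>_def by (intro has_vector_derivative_diff d\<eta> d\<zeta> that)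
  have err: "norm (F (\<zeta> l) (s + v) - \<zeta>' l) \<le> C'" if l: "l \<in> {0..1}" for l
  proof -
    note g = \<gamma>R[OF l]
    define rem where "rem = F (\<zeta> l) (s + v) - F (\<gamma> l) (s + v) - F' (\<gamma> l) (\<zeta> l - \<gamma> l) (s + v)"
    have "F' (\<gamma> l) (\<zeta> l - \<gamma> l) (s + v) = l *\<^sub>R (F' (\<gamma> l) (F (\<gamma> l) v) s + F' (\<gamma> l) (F (\<gamma> l) v) v)"
      unfolding \<zeta>_def using lin'[OF g] linear_scale[OF lin''[OF g]] by (simp add: linear_add)
    then have "F (\<zeta> l) (s + v) - \<zeta>' l = rem + l *\<^sub>R F' (\<gamma> l) (F (\<gamma> l) v) v"
      unfolding rem_def \<zeta>'_def using lin[OF g] sym[OF g, of s v]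
          by (simp add: linear_add algebra_simps)
    moreover have "norm (l *\<^sub>R F' (\<gamma> l) (F (\<gamma> l) v) v) \<le> L * B * (norm v)^2"
    proof -
      have "norm (l *\<^sub>R F' (\<gamma> l) (F (\<gamma> l) v) v) \<le> 1 * norm (F' (\<gamma> l) (F (\<gamma> l) v) v)"
        using l unfolding norm_scaleR by (intro mult_right_mono) auto
      also have "\<dots> \<le> L * norm (F (\<gamma> l) v) * norm v" using bnd'[OF g] by simp
      also have "\<dots> \<le> L * (B * norm v) * norm v"
        using bnd[OF g] pos by (intro mult_right_mono mult_left_mono) auto
      finally show ?thesis by (simp add: power2_eq_square mult_ac)
    qed
    moreover have "norm rem \<le> C * B^2 * \<rho> * (norm v)^2"
    proof -
      have "norm rem \<le> C * (norm (\<zeta> l - \<gamma> l))^2 * norm (s + v)"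
        unfolding rem_def by (rule Tay[OF g \<zeta>R[OF l]])
      also have "\<dots> \<le> C * (B * norm v)^2 * \<rho>"
        using lF[OF l] s(2) pos unfolding \<zeta>_def
        by (intro mult_mono mult_left_mono power_mono) auto
      finally show ?thesis by (simp add: power_mult_distrib mult_ac)
    qed
    ultimately show ?thesis unfolding C'_def
      using norm_triangle_ineq[of rem "l *\<^sub>R F' (\<gamma> l) (F (\<gamma> l) v) v"] by (simp add: algebra_simps)
  qed
  have "continuous_on {0..1} \<delta>"
    by (auto simp: continuous_on_eq_continuous_within intro: has_vector_derivative_continuous[OF
        d\<delta>])
  then have "compact ((\<lambda>l. norm (\<delta> l)) ` {0..1})"
    by (intro compact_continuous_image continuous_intros) auto
  then obtain m where m: "m \<in> {0..1}" "\<And>l. l \<in> {0..1} \<Longrightarrow> norm (\<delta> l) \<le> norm (\<delta> m)"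
    using compact_attains_sup[of "(\<lambda>l. norm (\<delta> l)) ` {0..1}"] by auto
  have K: "norm (F (\<eta> l) (s + v) - \<zeta>' l) \<le> 1 / 2 * norm (\<delta> m) + C'" if l: "l \<in> {0..1}" for l
  proof -
    have "norm (F (\<eta> l) (s + v) - F (\<zeta> l) (s + v)) \<le> L * norm (\<delta> l) * norm (s + v)"
      unfolding \<delta>_def by (rule Lip[OF \<eta>R[OF l] \<zeta>R[OF l]])
    also have "\<dots> \<le> L * norm (\<delta> m) * \<rho>" using s(2) m l pos by (intro mult_mono mult_left_mono) auto
    also have "\<dots> = (L * \<rho>) * norm (\<delta> m)" by simp
    also have "\<dots> \<le> 1 / 2 * norm (\<delta> m)" using small by (intro mult_right_mono) auto
    finally show ?thesis using err[OF l]
      norm_triangle_ineq[of "F (\<eta> l) (s + v) - F (\<zeta> l) (s + v)" "F (\<zeta> l) (s + v) - \<zeta>' l"] by simp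
  qed
  have "\<delta> 0 = 0" using c(2) by (simp add: \<delta>_def \<eta>_def \<zeta>_def \<gamma>_def)
  then have "norm (\<delta> m) = norm (\<delta> m - \<delta> 0)" by simp
  also have "\<dots> \<le> (1 / 2 * norm (\<delta> m) + C') * m"
  proof (rule vector_derivative_bound)
    show "(\<delta> has_vector_derivative F (\<eta> l) (s + v) - \<zeta>' l) (at l within {0..m})" if "l \<in> {0..m}"
        for l
      using m that by (intro has_vector_derivative_within_subset[OF d\<delta>]) auto
  qed (use m K in auto)
  also have "\<dots> \<le> (1 / 2 * norm (\<delta> m) + C') * 1"
    using m pos by (intro mult_left_mono) (auto simp: C'_def)
  finally have "norm (\<delta> m) \<le> 2 * C'" by simp
  then have "norm (\<delta> 1) \<le> 2 * C'" using m(2)[of 1] by simp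
  then show ?thesis by (simp add: \<delta>_def \<eta>_def \<zeta>_def \<gamma>_def C'_def algebra_simps)
qed

lemma mult_divide_succ_le: "0 \<le> b \<Longrightarrow> 0 \<le> r \<Longrightarrow> b * (r / (b + 1)) \<le> (r::real)"
  using mult_right_mono[of "b / (b + 1)" 1 r] by (simp add: mult.commute)

text \<open>The symmetry condition says that the vector fields \<open>\<lambda>y. F y v\<close> commute. Once \<open>c\<close> is known to
  be differentiable, its smoothness follows from the equation by induction on the order.\<close>

theorem total_differential_equation:
  fixes F :: "'a::euclidean_space \<Rightarrow> 'a \<Rightarrow> 'a"
  assumes S: "open S" "y0 \<in> S" and lin: "\<And>y. y \<in> S \<Longrightarrow> linear (F y)"
    and smooth: "\<And>v. smooth_on (\<lambda>y. F y v) S"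
    and sym: "\<And>y v w. y \<in> S \<Longrightarrow>
      dderiv (\<lambda>y. F y w) y (F y v) = dderiv (\<lambda>y. F y v) y (F y w)"
  obtains \<rho> c where "\<rho> > 0" "c 0 = y0" "c ` ball 0 \<rho> \<subseteq> S"
    "\<And>s. s \<in> ball 0 \<rho> \<Longrightarrow> (c has_derivative F (c s)) (at s)" "smooth_on c (ball 0 \<rho>)"
proof -
  obtain R where R: "R > 0" "cball y0 R \<subseteq> S" using S open_contains_cball by blast
  let ?K = "cball y0 R"
  have K: "compact ?K" "convex ?K" by auto
  define F' where "F' = (\<lambda>y h v. dderiv (\<lambda>y. F y v) y h)"
  have inS: "y \<in> ?K \<Longrightarrow> y \<in> S" for y using R by blast
  have lin': "linear (F' y h)" if "y \<in> S" for y h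
    unfolding F'_def by (rule linear_dderiv_family[where F = F, OF S(1) lin smooth that])
  have der: "((\<lambda>y. F y v) has_derivative (\<lambda>h. F' y h v)) (at y)" if "y \<in> S" for y v
    unfolding F'_def by (intro dderiv_works smooth_on_differentiable[OF smooth that])
  have lin'': "linear (\<lambda>h. F' y h v)" if "y \<in> S" for y v
    using der[OF that] by (rule has_derivative_linear)
  have "\<exists>C\<ge>0. \<forall>y\<in>?K. \<forall>v. norm (F y v) \<le> C * 1 * norm v"
  proof (rule linear_family_bound[where G = F and k = "\<lambda>_. 1"])
    fix b
    have "compact ((\<lambda>y. F y b) ` ?K)"
      using smooth_on_continuous_on[OF smooth] R K
      by (intro compact_continuous_image) (auto intro: continuous_on_subset)
    then show "\<exists>C\<ge>0. \<forall>y\<in>?K. norm (F y b) \<le> C * 1"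
      by (metis (no_types, lifting) bounded_pos compact_imp_bounded image_eqI less_imp_le
          mult.right_neutral)
  qed (use lin inS in auto)
  then obtain B where B: "B \<ge> 0" "\<And>y v. y \<in> ?K \<Longrightarrow> norm (F y v) \<le> B * norm v" by auto
  have "\<exists>C\<ge>0. \<forall>p\<in>?K \<times> UNIV. \<forall>v. norm (F' (fst p) (snd p) v) \<le> C * norm (snd p) * norm v"
  proof (rule linear_family_bound)
    show "linear (F' (fst p) (snd p))" if "p \<in> ?K \<times> UNIV" for p
      using that by (intro lin' inS) auto
    show "\<exists>C\<ge>0. \<forall>p\<in>?K \<times> UNIV. norm (F' (fst p) (snd p) b) \<le> C * norm (snd p)" for b
      using smooth_on_derivative_bound[OF smooth[of b] K(1) R(2)] unfolding F'_def
          by (metis mem_Times_iff)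
  qed
  then obtain L1 where L1: "L1 \<ge> 0" "\<And>y h v. y \<in> ?K \<Longrightarrow> norm (F' y h v) \<le> L1 * norm h * norm v"
    by auto
  have "\<exists>C\<ge>0. \<forall>p\<in>?K \<times> ?K. \<forall>v. norm (F (fst p) v - F (snd p) v) \<le> C * norm (fst p - snd p) * norm v"
  proof (rule linear_family_bound)
    show "linear (\<lambda>v. F (fst p) v - F (snd p) v)" if "p \<in> ?K \<times> ?K" for p
      using that by (intro linear_compose_sub lin inS) auto
    show "\<exists>C\<ge>0. \<forall>p\<in>?K \<times> ?K. norm (F (fst p) b - F (snd p) b) \<le> C * norm (fst p - snd p)" for b
      using smooth_on_Lipschitz[OF smooth[of b] K R(2)] by (metis mem_Times_iff)
  qed
  then obtain L2 where L2: "L2 \<ge> 0" "\<And>y z v. y \<in> ?K \<Longrightarrow> z \<in> ?K \<Longrightarrow>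
      norm (F y v - F z v) \<le> L2 * norm (y - z) * norm v"
    by auto
  have "\<exists>C\<ge>0. \<forall>p\<in>?K \<times> ?K. \<forall>v. norm (F (snd p) v - F (fst p) v - F' (fst p) (snd p - fst p) v)
      \<le> C * (norm (snd p - fst p))^2 * norm v"
  proof (rule linear_family_bound)
    show "linear (\<lambda>v. F (snd p) v - F (fst p) v - F' (fst p) (snd p - fst p) v)"
      if "p \<in> ?K \<times> ?K" for p
      using that by (intro linear_compose_sub lin lin' inS) auto
    show "\<exists>C\<ge>0. \<forall>p\<in>?K \<times> ?K. norm (F (snd p) b - F (fst p) b - F' (fst p) (snd p - fst p) b)
        \<le> C * (norm (snd p - fst p))^2" for b
      using smooth_on_Taylor_bound[OF smooth[of b] K R(2)] unfolding F'_def by (metis mem_Times_iff)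
  qed
  then obtain C where C: "C \<ge> 0" "\<And>y z v. y \<in> ?K \<Longrightarrow> z \<in> ?K \<Longrightarrow>
      norm (F z v - F y v - F' y (z - y) v) \<le> C * (norm (z - y))^2 * norm v"
    by auto
  define L where "L = L1 + L2"
  have L0: "L \<ge> 0" using L1 L2 by (simp add: L_def)
  have bnd': "norm (F' y h v) \<le> L * norm h * norm v" if "y \<in> ?K" for y h v
    by (rule order_trans[OF L1(2)[OF that]]) (use L1 L2 in \<open>auto intro!: mult_right_mono simp:
        L_def\<close>)
  have Lip: "norm (F y v - F z v) \<le> L * norm (y - z) * norm v" if "y \<in> ?K" "z \<in> ?K" for y z v
    by (rule order_trans[OF L2(2)[OF that]]) (use L1 L2 in \<open>auto intro!: mult_right_mono simp:
        L_def\<close>)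
  define \<rho> where "\<rho> = min (R / 2 / (B + 1)) (1 / 2 / (L + 1))"
  have \<rho>: "\<rho> > 0" using R(1) B(1) L0 by (simp add: \<rho>_def)
  have "L * \<rho> \<le> L * (1 / 2 / (L + 1))" using L0 by (intro mult_left_mono) (auto simp: \<rho>_def)
  also have "\<dots> \<le> 1 / 2" using L0 by (intro mult_divide_succ_le) auto
  finally have small1: "L * \<rho> \<le> 1 / 2" .
  have "B * \<rho> \<le> B * (R / 2 / (B + 1))" using B(1) by (intro mult_left_mono) (auto simp: \<rho>_def)
  also have "\<dots> \<le> R / 2" using B(1) R(1) by (intro mult_divide_succ_le) auto
  finally have small2: "B * \<rho> \<le> R / 2" .
  have sub: "y \<in> ?K" if "y \<in> cball y0 (R / 2)" for y using that R(1) by simp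
  have "\<exists>c. continuous_on UNIV c \<and> (\<forall>s. c s \<in> cball y0 (R / 2)) \<and>
    (\<forall>s\<in>cball 0 \<rho>. c s = y0 + integral {0..1} (\<lambda>t. F (c (t *\<^sub>R s)) s))"
  proof (rule integral_equation_solution[where B = B and L = L])
    show "linear (F y)" if "y \<in> cball y0 (R / 2)" for y by (rule lin[OF inS[OF sub[OF that]]])
    show "norm (F y v) \<le> B * norm v" if "y \<in> cball y0 (R / 2)" for y v
      by (rule B(2)[OF sub[OF that]])
    show "norm (F y v - F z v) \<le> L * norm (y - z) * norm v"
      if "y \<in> cball y0 (R / 2)" "z \<in> cball y0 (R / 2)" for y z v
      by (rule Lip[OF sub[OF that(1)] sub[OF that(2)]])
  qed (use R(1) \<rho> L0 B(1) small1 small2 in simp_all)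
  then obtain c where c: "continuous_on UNIV c" "\<And>s. c s \<in> cball y0 (R / 2)"
    and eq: "\<And>s. s \<in> cball 0 \<rho> \<Longrightarrow> c s = y0 + integral {0..1} (\<lambda>t. F (c (t *\<^sub>R s)) s)"
    by blast
  have cK: "c s \<in> ?K" for s using c(2) sub by blast
  have c0: "c 0 = y0"
    using eq[of 0] \<rho> linear_0[OF lin[OF inS[OF cK]]] by simp
  have ray: "((\<lambda>l. c (l *\<^sub>R s)) has_vector_derivative F (c (l *\<^sub>R s)) s) (at l within {0..1})"
    if "s \<in> cball 0 \<rho>" "l \<in> {0..1}" for s l
  proof (rule integral_equation_ray_derivative[where K = ?K, OF c(1) cK _ _ eq that])
    show "continuous_on ?K (\<lambda>y. F y v)" for v
      using smooth_on_continuous_on[OF smooth] R(2) by (rule continuous_on_subset)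
  qed (use lin inS in auto)
  define Q where "Q = 2 * (L * B + C * B^2 * \<rho>)"
  have est: "norm (c (s + v) - c s - F (c s) v) \<le> Q * (norm v)^2"
    if "s \<in> cball 0 \<rho>" "s + v \<in> cball 0 \<rho>" "B * norm v \<le> R / 2" for s v
    unfolding Q_def
  proof (rule total_differential_equation_estimate[where F = F and F' = F' and ?y0.0 = y0
      and R = R])
    show "F' y (F y v) w = F' y (F y w) v" if "y \<in> ?K" for y v w
      using sym[OF inS[OF that]] by (simp add: F'_def)
    show "c s \<in> cball y0 (R / 2)" for s by (rule c(2))
  qed (fact lin[OF inS] lin'[OF inS] lin''[OF inS] der[OF inS] B bnd' Lip C R(1) \<rho> L0 small1 small2
    c0 ray that)+
  have Q0: "Q \<ge> 0" using L0 B(1) C(1) \<rho> by (simp add: Q_def)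
  have dc: "(c has_derivative F (c s)) (at s)" if s: "s \<in> ball 0 \<rho>" for s
    unfolding has_derivative_at_alt
  proof (intro conjI allI impI)
    show "bounded_linear (F (c s))"
      using lin[OF inS[OF cK]] by (simp add: linear_conv_bounded_linear)
    fix e :: real assume e: "e > 0"
    define d where "d = min (\<rho> - norm s) (min (R / 2 / (B + 1)) (e / (Q + 1)))"
    show "\<exists>d>0. \<forall>y. norm (y - s) < d \<longrightarrow> norm (c y - c s - F (c s) (y - s)) \<le> e * norm (y - s)"
    proof (intro exI[of _ d] conjI allI impI)
      show "d > 0" using s R(1) B(1) Q0 e by (simp add: d_def)
      fix y assume y: "norm (y - s) < d"
      then have yd: "norm (y - s) < \<rho> - norm s" "norm (y - s) < R / 2 / (B + 1)"
        "norm (y - s) < e / (Q + 1)"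
        unfolding d_def by (simp_all only: min_less_iff_conj)
      have "norm y \<le> norm s + norm (y - s)" using norm_triangle_ineq[of s "y - s"] by simp
      then have y1: "s + (y - s) \<in> cball 0 \<rho>" using yd(1) by simp
      have "B * norm (y - s) \<le> B * (R / 2 / (B + 1))"
        using yd(2) B(1) by (intro mult_left_mono) (rule less_imp_le)
      also have "\<dots> \<le> R / 2" using B(1) R(1) by (intro mult_divide_succ_le) auto
      finally have y2: "B * norm (y - s) \<le> R / 2" .
      have "norm (c y - c s - F (c s) (y - s)) \<le> (Q * norm (y - s)) * norm (y - s)"
        using est[OF _ y1 y2] s by (simp add: power2_eq_square mult_ac)
      also have "\<dots> \<le> e * norm (y - s)"
      proof (rule mult_right_mono)
        have "Q * norm (y - s) \<le> Q * (e / (Q + 1))" using yd(3) Q0 by (intro mult_left_mono) auto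
        also have "\<dots> \<le> e" using Q0 e by (intro mult_divide_succ_le) auto
        finally show "Q * norm (y - s) \<le> e" .
      qed simp
      finally show "norm (c y - c s - F (c s) (y - s)) \<le> e * norm (y - s)" .
    qed
  qed
  have "C_k_on k c (ball 0 \<rho>)" for k
  proof (induction k)
    case 0
    show ?case using c(1) by (auto intro: continuous_on_subset)
  next
    case (Suc k)
    have "C_k_on k (\<lambda>s. F (c s) v) (ball 0 \<rho>)" for v
      using C_k_on_compose[OF open_ball S(1) _ _ Suc, of "\<lambda>y. F y v"] smooth cK inS
      by (auto simp: smooth_on_def)
    then have "C_k_on k (\<lambda>s. dderiv c s v) (ball 0 \<rho>)" for v
      by (rule C_k_on_cong[OF open_ball, rotated]) (use dderiv_eq[OF dc] in simp)
    moreover have "c differentiable (at s)" if "s \<in> ball 0 \<rho>" for s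
      using dc[OF that] by (auto simp: differentiable_def)
    ultimately show ?case by simp
  qed
  then have "smooth_on c (ball 0 \<rho>)" by (simp add: smooth_on_def)
  moreover have "c ` ball 0 \<rho> \<subseteq> S" using cK inS by blast
  ultimately show ?thesis using that[OF \<rho> c0 _ dc] by blast
qed

section \<open>Smooth functions and tangent vectors on manifolds\<close>

subsection \<open>Charts and smooth functions\<close>

lemma atlas_chart:
  assumes "smooth_atlas A" "(U, \<phi>) \<in> A"
  shows "open U" "open (\<phi> ` U)" "continuous_on U \<phi>" "continuous_on (\<phi> ` U) (inv_into U \<phi>)"
    "inj_on \<phi> U" "\<And>x. x \<in> U \<Longrightarrow> inv_into U \<phi> (\<phi> x) = x"
    "\<And>y. y \<in> \<phi> ` U \<Longrightarrow> \<phi> (inv_into U \<phi> y) = y" "\<And>y. y \<in> \<phi> ` U \<Longrightarrow> inv_into U \<phi> y \<in> U"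
proof -
  have c: "is_chart (U, \<phi>)" using assms by (auto simp: smooth_atlas_def)
  then have h: "homeomorphism U (\<phi> ` U) \<phi> (inv_into U \<phi>)" by (simp add: is_chart_def)
  show "open U" "open (\<phi> ` U)" using c by (auto simp: is_chart_def)
  show "continuous_on U \<phi>" "continuous_on (\<phi> ` U) (inv_into U \<phi>)"
    using h by (auto simp: homeomorphism_def)
  show i: "inv_into U \<phi> (\<phi> x) = x" if "x \<in> U" for x using h that by (auto simp: homeomorphism_def)
  show "inj_on \<phi> U" using i by (metis inj_onI)
  show "\<phi> (inv_into U \<phi> y) = y" if "y \<in> \<phi> ` U" for y using that by (rule f_inv_into_f)
  show "inv_into U \<phi> y \<in> U" if "y \<in> \<phi> ` U" for y using that by (rule inv_into_into)
qed

lemma atlas_covers: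
  assumes "smooth_atlas A" obtains U \<phi> where "(U, \<phi>) \<in> A" "x \<in> U"
proof -
  have "x \<in> (\<Union>(U, \<phi>)\<in>A. U)" using assms by (simp add: smooth_atlas_def)
  then show ?thesis using that by blast
qed

lemma open_chart_image:
  assumes "smooth_atlas A" "(U, \<phi>) \<in> A" "open V"
  shows "open (\<phi> ` (U \<inter> V))"
proof -
  note c = atlas_chart[OF assms(1,2)]
  have "\<phi> ` (U \<inter> V) = \<phi> ` U \<inter> inv_into U \<phi> -` V" using c(6) by auto
  then show ?thesis using continuous_open_preimage[OF c(4,2) assms(3)] by simp
qed

lemma transition_smooth:
  assumes "smooth_atlas A" "(U, \<phi>) \<in> A" "(V, \<psi>) \<in> A"
  shows "smooth_on (\<lambda>y. \<psi> (inv_into U \<phi> y)) (\<phi> ` (U \<inter> V))"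
  using assms unfolding smooth_atlas_def by fastforce

lemma smooth_fun_chartD:
  "smooth_fun A V f \<Longrightarrow> (U, \<phi>) \<in> A \<Longrightarrow> smooth_on (\<lambda>y. f (inv_into U \<phi> y)) (\<phi> ` (U \<inter> V))"
  by (auto simp: smooth_fun_def)

lemma smooth_fun_subset:
  assumes "smooth_fun A V f" "W \<subseteq> V" shows "smooth_fun A W f"
  unfolding smooth_fun_def
  using assms by (auto intro!: smooth_on_subset[OF smooth_fun_chartD[OF assms(1)]])

text \<open>One chart around each point suffices, the transition maps being smooth.\<close>

lemma smooth_fun_chartI:
  assumes A: "smooth_atlas A" and V: "open V"
    and loc: "\<And>x. x \<in> V \<Longrightarrow> \<exists>U \<phi> Q. (U, \<phi>) \<in> A \<and> x \<in> U \<and> open Q \<and> x \<in> Q \<and>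
      smooth_on (\<lambda>y. f (inv_into U \<phi> y)) (\<phi> ` (U \<inter> Q))"
  shows "smooth_fun A V f"
  unfolding smooth_fun_def
proof (clarify)
  fix U' \<phi>' assume c': "(U', \<phi>') \<in> A"
  note C' = atlas_chart[OF A c']
  show "smooth_on (\<lambda>y. f (inv_into U' \<phi>' y)) (\<phi>' ` (U' \<inter> V))"
  proof (rule smooth_on_local)
    fix y assume "y \<in> \<phi>' ` (U' \<inter> V)"
    then obtain x where x: "x \<in> U'" "x \<in> V" "y = \<phi>' x" by blast
    obtain U \<phi> Q where c: "(U, \<phi>) \<in> A" and Q: "x \<in> U" "open Q" "x \<in> Q"
      and sm: "smooth_on (\<lambda>y. f (inv_into U \<phi> y)) (\<phi> ` (U \<inter> Q))" using loc[OF x(2)] by blast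
    note C = atlas_chart[OF A c]
    let ?T = "\<phi>' ` (U' \<inter> (U \<inter> Q))"
    have oT: "open ?T" using Q C(1) by (intro open_chart_image[OF A c']) auto
    have "smooth_on (\<lambda>y. f (inv_into U \<phi> (\<phi> (inv_into U' \<phi>' y)))) ?T"
    proof (rule smooth_on_compose[OF oT open_chart_image[OF A c Q(2)] _ sm])
      show "(\<lambda>y. \<phi> (inv_into U' \<phi>' y)) ` ?T \<subseteq> \<phi> ` (U \<inter> Q)" using C'(6) by auto
      show "smooth_on (\<lambda>y. \<phi> (inv_into U' \<phi>' y)) ?T"
        by (rule smooth_on_subset[OF transition_smooth[OF A c' c]]) auto
    qed
    then have "smooth_on (\<lambda>y. f (inv_into U' \<phi>' y)) ?T"
      by (rule smooth_on_cong[OF oT, rotated]) (use C(6) C'(6) in auto)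
    then show "\<exists>T. open T \<and> y \<in> T \<and> smooth_on (\<lambda>y. f (inv_into U' \<phi>' y)) T"
      using oT x Q by blast
  qed
qed

lemma smooth_fun_local:
  assumes A: "smooth_atlas A" and "open V"
    and loc: "\<And>x. x \<in> V \<Longrightarrow> \<exists>Q. open Q \<and> x \<in> Q \<and> smooth_fun A Q f"
  shows "smooth_fun A V f"
proof (rule smooth_fun_chartI[OF A assms(2)])
  fix x assume "x \<in> V"
  then obtain Q where Q: "open Q" "x \<in> Q" "smooth_fun A Q f" using loc by blast
  obtain U \<phi> where "(U, \<phi>) \<in> A" "x \<in> U" using atlas_covers[OF A] by blast
  then show "\<exists>U \<phi> Q. (U, \<phi>) \<in> A \<and> x \<in> U \<and> open Q \<and> x \<in> Q \<and>
      smooth_on (\<lambda>y. f (inv_into U \<phi> y)) (\<phi> ` (U \<inter> Q))"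
    using Q smooth_fun_chartD by blast
qed

lemma smooth_fun_cong:
  assumes A: "smooth_atlas A" and "open V" "\<And>x. x \<in> V \<Longrightarrow> f x = g x" "smooth_fun A V f"
  shows "smooth_fun A V g"
  unfolding smooth_fun_def
proof clarify
  fix U \<phi> assume c: "(U, \<phi>) \<in> A"
  show "smooth_on (\<lambda>y. g (inv_into U \<phi> y)) (\<phi> ` (U \<inter> V))"
    by (rule smooth_on_cong[OF open_chart_image[OF A c assms(2)] _ smooth_fun_chartD[OF assms(4)
        c]])
      (use atlas_chart(6)[OF A c] assms(3) in auto)
qed

lemma smooth_fun_const: "smooth_fun A V (\<lambda>x. c)"
  by (auto simp: smooth_fun_def smooth_on_const)

lemma smooth_fun_add:
  assumes "smooth_atlas A" "open V" "smooth_fun A V f" "smooth_fun A V g"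
  shows "smooth_fun A V (\<lambda>x. f x + g x)"
  using assms open_chart_image[OF assms(1)] unfolding smooth_fun_def
  by (auto intro!: smooth_on_add)

lemma smooth_fun_mult:
  assumes "smooth_atlas A" "open V" "smooth_fun A V f" "smooth_fun A V g"
  shows "smooth_fun A V (\<lambda>x. f x * g x)"
  using assms open_chart_image[OF assms(1)] unfolding smooth_fun_def
  by (auto intro!: smooth_on_mult)

lemma smooth_fun_chart_compose:
  assumes A: "smooth_atlas A" and c: "(U, \<phi>) \<in> A" and "open V" and h: "smooth_on h (\<phi> ` (U \<inter> V))"
  shows "smooth_fun A (U \<inter> V) (\<lambda>z. h (\<phi> z))"
proof (rule smooth_fun_chartI[OF A])
  note C = atlas_chart[OF A c]
  show "open (U \<inter> V)" using C(1) assms(3) by auto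
  have "smooth_on (\<lambda>y. h (\<phi> (inv_into U \<phi> y))) (\<phi> ` (U \<inter> V))"
    by (rule smooth_on_cong[OF open_chart_image[OF A c assms(3)] _ h]) (use C(7) in auto)
  then show "\<exists>U \<phi>' Q. (U, \<phi>') \<in> A \<and> x \<in> U \<and> open Q \<and> x \<in> Q \<and>
      smooth_on (\<lambda>y. h (\<phi> (inv_into U \<phi>' y))) (\<phi>' ` (U \<inter> Q))" if "x \<in> U \<inter> V" for x
    using that c assms(3) by blast
qed

lemma smooth_fun_coordinate:
  assumes A: "smooth_atlas A" and c: "(U, \<phi>) \<in> A"
  shows "smooth_fun A U (\<lambda>z. \<phi> z \<bullet> b)"
  using smooth_fun_chart_compose[OF A c open_UNIV, of "\<lambda>y. y \<bullet> b"] atlas_chart(2)[OF A c]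
    smooth_on_linear[of "\<phi> ` U" "\<lambda>y. y \<bullet> b"]
  by (simp add: linear_conv_bounded_linear bounded_linear_inner_left)

lemma smooth_map_chartD:
  assumes "smooth_map A B UNIV F" "(U, \<phi>) \<in> A" "(U', \<psi>) \<in> B"
  shows "smooth_on (\<lambda>y. \<psi> (F (inv_into U \<phi> y))) (\<phi> ` (U \<inter> F -` U'))"
  using assms by (auto simp: smooth_map_def)

lemma smooth_map_continuous: "smooth_map A B UNIV F \<Longrightarrow> continuous_on UNIV F"
  by (simp add: smooth_map_def)

lemma smooth_map_open_vimage: "smooth_map A B UNIV F \<Longrightarrow> open Q \<Longrightarrow> open (F -` Q)"
  using open_vimage smooth_map_continuous by blast

lemma smooth_map_ident: "smooth_atlas A \<Longrightarrow> smooth_map A A UNIV (\<lambda>x. x)"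
  using transition_smooth by (fastforce simp: smooth_map_def)

lemma smooth_fun_compose:
  assumes A: "smooth_atlas A" and B: "smooth_atlas B" and F: "smooth_map A B UNIV F"
    and Q: "open Q" and f: "smooth_fun B Q f"
  shows "smooth_fun A (F -` Q) (\<lambda>x. f (F x))"
proof (rule smooth_fun_chartI[OF A smooth_map_open_vimage[OF F Q]])
  fix x assume x: "x \<in> F -` Q"
  obtain U \<phi> where c: "(U, \<phi>) \<in> A" "x \<in> U" using atlas_covers[OF A] by blast
  obtain U' \<psi> where c': "(U', \<psi>) \<in> B" "F x \<in> U'" using atlas_covers[OF B] by blast
  note C = atlas_chart[OF A c(1)] and C' = atlas_chart[OF B c'(1)]
  let ?V = "F -` (Q \<inter> U')" let ?T = "\<phi> ` (U \<inter> ?V)"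
  have oV: "open ?V" using Q C'(1) by (intro smooth_map_open_vimage[OF F]) auto
  have oT: "open ?T" by (rule open_chart_image[OF A c(1) oV])
  have "smooth_on (\<lambda>y. f (inv_into U' \<psi> (\<psi> (F (inv_into U \<phi> y))))) ?T"
  proof (rule smooth_on_compose[OF oT open_chart_image[OF B c'(1) Q] _ smooth_fun_chartD[OF f
      c'(1)]])
    show "(\<lambda>y. \<psi> (F (inv_into U \<phi> y))) ` ?T \<subseteq> \<psi> ` (U' \<inter> Q)" using C(6) by auto
    show "smooth_on (\<lambda>y. \<psi> (F (inv_into U \<phi> y))) ?T"
      by (rule smooth_on_subset[OF smooth_map_chartD[OF F c(1) c'(1)]]) auto
  qed
  then have "smooth_on (\<lambda>y. f (F (inv_into U \<phi> y))) ?T"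
    by (rule smooth_on_cong[OF oT, rotated]) (use C(6) C'(6) in auto)
  then show "\<exists>U \<phi> Q. (U, \<phi>) \<in> A \<and> x \<in> U \<and> open Q \<and> x \<in> Q \<and>
      smooth_on (\<lambda>y. f (F (inv_into U \<phi> y))) (\<phi> ` (U \<inter> Q))"
    using c oV x c'(2) by (intro exI[of _ U] exI[of _ \<phi>] exI[of _ ?V]) auto
qed

subsection \<open>Tangent vectors in coordinates\<close>

lemma smooth_nearI: "open V \<Longrightarrow> x \<in> V \<Longrightarrow> smooth_fun A V f \<Longrightarrow> smooth_near A x f"
  by (auto simp: smooth_near_def)

lemma smooth_near_cong:
  assumes A: "smooth_atlas A" and "open O'" "x \<in> O'" "\<And>z. z \<in> O' \<Longrightarrow> f z = g z"
  shows "smooth_near A x f \<longleftrightarrow> smooth_near A x g"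
proof -
  have "smooth_near A x g" if sf: "smooth_near A x f" and eq: "\<And>z. z \<in> O' \<Longrightarrow> f z = g z" for f g
  proof -
    obtain V where V: "open V" "x \<in> V" "smooth_fun A V f" using sf unfolding smooth_near_def
        by blast
    have "smooth_fun A (V \<inter> O') g"
      by (rule smooth_fun_cong[OF A _ _ smooth_fun_subset[OF V(3)]]) (use V assms(2) eq in auto)
    then show ?thesis using V assms(2,3) by (intro smooth_nearI[of "V \<inter> O'"]) auto
  qed
  then show ?thesis using assms(4) by metis
qed

lemma smooth_near_chart:
  assumes A: "smooth_atlas A" and c: "(U, \<phi>) \<in> A" "x \<in> U" and "smooth_near A x f"
  obtains T where "open T" "\<phi> x \<in> T" "T \<subseteq> \<phi> ` U" "smooth_on (\<lambda>y. f (inv_into U \<phi> y)) T"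
proof -
  obtain V where V: "open V" "x \<in> V" "smooth_fun A V f" using assms(4)
      by (auto simp: smooth_near_def)
  show ?thesis
    by (rule that[OF open_chart_image[OF A c(1) V(1)] _ _ smooth_fun_chartD[OF V(3) c(1)]])
      (use V c in auto)
qed

lemma smooth_near_differentiable:
  assumes "smooth_atlas A" "(U, \<phi>) \<in> A" "x \<in> U" "smooth_near A x f"
  shows "(\<lambda>y. f (inv_into U \<phi> y)) differentiable (at (\<phi> x))"
  by (rule smooth_near_chart[OF assms]) (blast intro: smooth_on_differentiable)

lemma smooth_near_const: "smooth_near A x (\<lambda>z. c)"
  by (rule smooth_nearI[OF open_UNIV]) (auto intro: smooth_fun_const)

lemma smooth_near_coordinate:
  assumes A: "smooth_atlas A" and c: "(U, \<phi>) \<in> A" "x \<in> U"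
  shows "smooth_near A x (\<lambda>z. \<phi> z \<bullet> b)"
  using smooth_fun_coordinate[OF A c(1)] atlas_chart(1)[OF A c(1)] c(2)
      by (rule smooth_nearI[rotated 2])

text \<open>The tangent vector at \<open>x\<close> with components \<open>w\<close> in the chart \<open>(U, \<phi>)\<close>, and the component
  vector of a tangent vector.\<close>

abbreviation chart_vec where "chart_vec A U \<phi> x \<equiv> velocity A (inv_into U \<phi>) (\<phi> x)"

definition coords :: "('m \<Rightarrow> 'e::euclidean_space) \<Rightarrow> 'm tvec \<Rightarrow> 'e"
  where "coords \<phi> v = (\<Sum>b\<in>Basis. v (\<lambda>z. \<phi> z \<bullet> b) *\<^sub>R b)"

lemma chart_vec_apply:
  assumes "smooth_atlas A" "(U, \<phi>) \<in> A" "x \<in> U"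
  shows "chart_vec A U \<phi> x w f =
    (if smooth_near A x f then dderiv (\<lambda>y. f (inv_into U \<phi> y)) (\<phi> x) w else 0)"
  by (simp add: velocity_def atlas_chart(6)[OF assms])

lemma linear_chart_vec:
  assumes "smooth_atlas A" "(U, \<phi>) \<in> A" "x \<in> U"
  shows "linear (chart_vec A U \<phi> x)"
proof (rule linearI)
  have l: "linear (dderiv (\<lambda>y. f (inv_into U \<phi> y)) (\<phi> x))" if "smooth_near A x f" for f
    by (rule linear_dderiv[OF smooth_near_differentiable[OF assms that]])
  show "chart_vec A U \<phi> x (v + w) = chart_vec A U \<phi> x v + chart_vec A U \<phi> x w" for v w
    using linear_add[OF l] by (auto simp: chart_vec_apply[OF assms] fun_eq_iff plus_fun_def)
  show "chart_vec A U \<phi> x (r *\<^sub>R v) = r *\<^sub>R chart_vec A U \<phi> x v" for r v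
    using linear_scale[OF l] by (auto simp: chart_vec_apply[OF assms] fun_eq_iff scaleR_fun_def)
qed

lemma coords_inner: "b \<in> Basis \<Longrightarrow> coords \<phi> v \<bullet> b = v (\<lambda>z. \<phi> z \<bullet> b)"
  by (simp add: coords_def inner_sum_left inner_Basis if_distrib sum.delta cong: if_cong)

lemma linear_coords: "linear (coords \<phi>)"
  by (rule linearI)
    (auto simp: coords_def plus_fun_def scaleR_fun_def sum.distrib scaleR_add_left scaleR_sum_right)

lemma coords_chart_vec:
  assumes A: "smooth_atlas A" "(U, \<phi>) \<in> A" "x \<in> U"
  shows "coords \<phi> (chart_vec A U \<phi> x w) = w"
proof (rule euclidean_eqI)
  fix b :: 'b assume b: "b \<in> Basis"
  note C = atlas_chart[OF A(1,2)]
  have "dderiv (\<lambda>y. \<phi> (inv_into U \<phi> y) \<bullet> b) (\<phi> x) = dderiv (\<lambda>y. y \<bullet> b) (\<phi> x)"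
    by (rule dderiv_cong[OF C(2)]) (use A(3) C(7) in auto)
  also have "\<dots> = (\<lambda>h. h \<bullet> b)"
    by (intro dderiv_eq bounded_linear_imp_has_derivative bounded_linear_inner_left)
  finally show "coords \<phi> (chart_vec A U \<phi> x w) \<bullet> b = w \<bullet> b"
    using smooth_near_coordinate[OF A] by (simp add: coords_inner[OF b] chart_vec_apply[OF A])
qed

lemma chart_vec_change:
  assumes A: "smooth_atlas A" and c: "(U, \<phi>) \<in> A" "x \<in> U" and d: "(V, \<psi>) \<in> A" "x \<in> V"
  shows "chart_vec A U \<phi> x w = chart_vec A V \<psi> x (dderiv (\<lambda>y. \<psi> (inv_into U \<phi> y)) (\<phi> x) w)"
proof
  fix f
  note C = atlas_chart[OF A c(1)] and D = atlas_chart[OF A d(1)]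
  show "chart_vec A U \<phi> x w f = chart_vec A V \<psi> x (dderiv (\<lambda>y. \<psi> (inv_into U \<phi> y)) (\<phi> x) w) f"
  proof (cases "smooth_near A x f")
    case True
    let ?t = "\<lambda>y. \<psi> (inv_into U \<phi> y)"
    have oT: "open (\<phi> ` (U \<inter> V))" by (rule open_chart_image[OF A c(1) D(1)])
    have t: "(?t has_derivative dderiv ?t (\<phi> x)) (at (\<phi> x))"
      using c d by (intro dderiv_works smooth_on_differentiable[OF transition_smooth[OF A c(1)
          d(1)]]) auto
    have "((\<lambda>y. f (inv_into V \<psi> y)) has_derivative dderiv (\<lambda>y. f (inv_into V \<psi> y)) (\<psi> x)) (at (?t
        (\<phi> x)))"
      using dderiv_works[OF smooth_near_differentiable[OF A d True]] C(6)[OF c(2)] by simp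
    from has_derivative_compose[OF t this]
    have "((\<lambda>y. f (inv_into V \<psi> (?t y))) has_derivative
        (\<lambda>h. dderiv (\<lambda>y. f (inv_into V \<psi> y)) (\<psi> x) (dderiv ?t (\<phi> x) h))) (at (\<phi> x))" .
    then have "((\<lambda>y. f (inv_into U \<phi> y)) has_derivative
        (\<lambda>h. dderiv (\<lambda>y. f (inv_into V \<psi> y)) (\<psi> x) (dderiv ?t (\<phi> x) h))) (at (\<phi> x))"
      by (rule has_derivative_transform_within_open[OF _ oT]) (use c d C(6) D(6) in auto)
    from dderiv_eq[OF this] show ?thesis
      using True by (simp add: chart_vec_apply[OF A c] chart_vec_apply[OF A d])
  qed (simp add: chart_vec_apply[OF A c] chart_vec_apply[OF A d])
qed

lemma chart_vec_in_tangent_space: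
  "(U, \<phi>) \<in> A \<Longrightarrow> x \<in> U \<Longrightarrow> chart_vec A U \<phi> x w \<in> tangent_space A x"
  by (auto simp: tangent_space_def)

lemma tangent_vector_chart:
  assumes A: "smooth_atlas A" and c: "(U, \<phi>) \<in> A" "x \<in> U" and v: "v \<in> tangent_space A x"
  shows "chart_vec A U \<phi> x (coords \<phi> v) = v"
proof -
  obtain V \<psi> w where d: "(V, \<psi>) \<in> A" "x \<in> V" "v = chart_vec A V \<psi> x w"
    using v by (auto simp: tangent_space_def)
  have "v = chart_vec A U \<phi> x (dderiv (\<lambda>y. \<phi> (inv_into V \<psi> y)) (\<psi> x) w)"
    unfolding d(3) by (rule chart_vec_change[OF A d(1,2) c])
  then show ?thesis using coords_chart_vec[OF A c] by metis
qed

lemma tangent_vector_apply: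
  assumes A: "smooth_atlas A" and c: "(U, \<phi>) \<in> A" "x \<in> U" and v: "v \<in> tangent_space A x"
    and f: "smooth_near A x f"
  shows "v f = dderiv (\<lambda>y. f (inv_into U \<phi> y)) (\<phi> x) (coords \<phi> v)"
proof -
  have "v f = chart_vec A U \<phi> x (coords \<phi> v) f"
    using tangent_vector_chart[OF A c v] by simp
  then show ?thesis using f by (simp add: chart_vec_apply[OF A c])
qed

lemma tangent_vector_eqI:
  assumes "smooth_atlas A" "(U, \<phi>) \<in> A" "x \<in> U" "v \<in> tangent_space A x" "w \<in> tangent_space A x"
    and "coords \<phi> v = coords \<phi> w"
  shows "v = w"
  using assms tangent_vector_chart by metis

lemma subspace_tangent_space:
  assumes A: "smooth_atlas A" shows "subspace (tangent_space A x)"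
proof -
  obtain U \<phi> where c: "(U, \<phi>) \<in> A" "x \<in> U" using atlas_covers[OF A] by blast
  have "tangent_space A x = range (chart_vec A U \<phi> x)"
    using tangent_vector_chart[OF A c] chart_vec_in_tangent_space[OF c]
    by (auto simp: image_iff) metis
  then show ?thesis using linear_subspace_image[OF linear_chart_vec[OF A c] subspace_UNIV] by simp
qed

lemma tangent_vector_cong:
  assumes A: "smooth_atlas A" and v: "v \<in> tangent_space A x"
    and "open O'" "x \<in> O'" "\<And>z. z \<in> O' \<Longrightarrow> f z = g z"
  shows "v f = v g"
proof -
  obtain U \<phi> where c: "(U, \<phi>) \<in> A" "x \<in> U" using atlas_covers[OF A] by blast
  note C = atlas_chart[OF A c(1)]
  have "dderiv (\<lambda>y. f (inv_into U \<phi> y)) (\<phi> x) = dderiv (\<lambda>y. g (inv_into U \<phi> y)) (\<phi> x)"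
    by (rule dderiv_cong[OF open_chart_image[OF A c(1) assms(3)]]) (use c(2) assms(4,5) C(6) in
        auto)
  then have "chart_vec A U \<phi> x w f = chart_vec A U \<phi> x w g" for w
    using smooth_near_cong[OF A assms(3-5)] by (simp add: chart_vec_apply[OF A c])
  then show ?thesis using tangent_vector_chart[OF A c v] by metis
qed

lemma tangent_vector_const:
  assumes A: "smooth_atlas A" and v: "v \<in> tangent_space A x"
  shows "v (\<lambda>z. c) = 0"
proof -
  obtain U \<phi> where c: "(U, \<phi>) \<in> A" "x \<in> U" using atlas_covers[OF A] by blast
  show ?thesis using tangent_vector_apply[OF A c v smooth_near_const] by simp
qed

subsection \<open>The differential of a smooth map\<close>

lemma linear_push: "linear (push B F x)"
  by (rule linearI) (auto simp: push_def fun_eq_iff plus_fun_def scaleR_fun_def)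

lemma smooth_near_compose:
  assumes A: "smooth_atlas A" and B: "smooth_atlas B" and F: "smooth_map A B UNIV F"
    and f: "smooth_near B (F x) f"
  shows "smooth_near A x (\<lambda>z. f (F z))"
proof -
  obtain Q where "open Q" "F x \<in> Q" "smooth_fun B Q f" using f by (auto simp: smooth_near_def)
  then show ?thesis
    by (intro smooth_nearI[OF smooth_map_open_vimage[OF F] _ smooth_fun_compose[OF A B F]]) auto
qed

lemma push_chart_vec:
  assumes A: "smooth_atlas A" and B: "smooth_atlas B" and F: "smooth_map A B UNIV F"
    and c: "(U, \<phi>) \<in> A" "x \<in> U" and d: "(U', \<psi>) \<in> B" "F x \<in> U'"
  shows "push B F x (chart_vec A U \<phi> x w) =
    chart_vec B U' \<psi> (F x) (dderiv (\<lambda>y. \<psi> (F (inv_into U \<phi> y))) (\<phi> x) w)"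
proof
  fix f
  note C = atlas_chart[OF A c(1)] and D = atlas_chart[OF B d(1)]
  let ?m = "\<lambda>y. \<psi> (F (inv_into U \<phi> y))"
  show "push B F x (chart_vec A U \<phi> x w) f = chart_vec B U' \<psi> (F x) (dderiv ?m (\<phi> x) w) f"
  proof (cases "smooth_near B (F x) f")
    case True
    let ?h = "\<lambda>y. f (inv_into U' \<psi> y)"
    have oT: "open (\<phi> ` (U \<inter> F -` U'))"
      by (intro open_chart_image[OF A c(1)] smooth_map_open_vimage[OF F] D(1))
    have m: "(?m has_derivative dderiv ?m (\<phi> x)) (at (\<phi> x))"
      using c d by (intro dderiv_works smooth_on_differentiable[OF smooth_map_chartD[OF F c(1)
          d(1)]]) auto
    have "(?h has_derivative dderiv ?h (\<psi> (F x))) (at (?m (\<phi> x)))"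
      using dderiv_works[OF smooth_near_differentiable[OF B d True]] C(6)[OF c(2)] by simp
    from has_derivative_compose[OF m this]
    have "((\<lambda>y. f (F (inv_into U \<phi> y))) has_derivative
        (\<lambda>k. dderiv ?h (\<psi> (F x)) (dderiv ?m (\<phi> x) k))) (at (\<phi> x))"
      by (rule has_derivative_transform_within_open[OF _ oT]) (use c d C(6) D(6) in auto)
    from dderiv_eq[OF this] show ?thesis
      using True smooth_near_compose[OF A B F True]
      by (simp add: push_def chart_vec_apply[OF A c] chart_vec_apply[OF B d])
  qed (simp add: push_def chart_vec_apply[OF B d])
qed

lemma coords_push:
  assumes A: "smooth_atlas A" and B: "smooth_atlas B" and F: "smooth_map A B UNIV F"
    and c: "(U, \<phi>) \<in> A" "x \<in> U" and d: "(U', \<psi>) \<in> B" "F x \<in> U'"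
    and v: "v \<in> tangent_space A x"
  shows "coords \<psi> (push B F x v) = dderiv (\<lambda>y. \<psi> (F (inv_into U \<phi> y))) (\<phi> x) (coords \<phi> v)"
  using push_chart_vec[OF A B F c d, of "coords \<phi> v"] coords_chart_vec[OF B d]
    tangent_vector_chart[OF A c v] by metis

lemma push_in_tangent_space:
  assumes A: "smooth_atlas A" and B: "smooth_atlas B" and F: "smooth_map A B UNIV F"
    and v: "v \<in> tangent_space A x"
  shows "push B F x v \<in> tangent_space B (F x)"
proof -
  obtain U \<phi> where c: "(U, \<phi>) \<in> A" "x \<in> U" using atlas_covers[OF A] by blast
  obtain U' \<psi> where d: "(U', \<psi>) \<in> B" "F x \<in> U'" using atlas_covers[OF B] by blast
  show ?thesis
    using push_chart_vec[OF A B F c d, of "coords \<phi> v"] tangent_vector_chart[OF A c v]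
      chart_vec_in_tangent_space[OF d] by metis
qed

subsection \<open>Smooth fields along a map\<close>

lemma field_alongD:
  assumes "field_along A B F V Z"
  shows "x \<in> V \<Longrightarrow> Z x \<in> tangent_space B (F x)"
    "open Q \<Longrightarrow> smooth_fun B Q f \<Longrightarrow> smooth_fun A (V \<inter> F -` Q) (\<lambda>x. Z x f)"
  using assms by (auto simp: field_along_def)

lemma field_along_subset:
  assumes "field_along A B F V Z" "W \<subseteq> V" shows "field_along A B F W Z"
  unfolding field_along_def
proof (intro conjI ballI allI impI)
  show "Z x \<in> tangent_space B (F x)" if "x \<in> W" for x
    using field_alongD(1)[OF assms(1)] assms(2) that by blast
  show "smooth_fun A (W \<inter> F -` Q) (\<lambda>x. Z x f)" if "open Q" "smooth_fun B Q f" for Q f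
    by (rule smooth_fun_subset[OF field_alongD(2)[OF assms(1) that]]) (use assms(2) in auto)
qed

lemma field_along_cong:
  assumes A: "smooth_atlas A" and F: "smooth_map A B UNIV F" and V: "open V"
    and Z: "field_along A B F V Z" and eq: "\<And>x. x \<in> V \<Longrightarrow> Z x = Z' x"
  shows "field_along A B F V Z'"
  unfolding field_along_def
proof (intro conjI ballI allI impI)
  show "Z' x \<in> tangent_space B (F x)" if "x \<in> V" for x
    using field_alongD(1)[OF Z that] eq[OF that] by simp
  fix Q f assume Q: "open Q" "smooth_fun B Q f"
  show "smooth_fun A (V \<inter> F -` Q) (\<lambda>x. Z' x f)"
    by (rule smooth_fun_cong[OF A _ _ field_alongD(2)[OF Z Q]])
      (use V smooth_map_open_vimage[OF F Q(1)] eq in auto)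
qed

lemma field_along_scaleR:
  assumes A: "smooth_atlas A" and B: "smooth_atlas B" and F: "smooth_map A B UNIV F" and V: "open V"
    and f: "smooth_fun A V f" and Z: "field_along A B F V Z"
  shows "field_along A B F V (\<lambda>x. f x *\<^sub>R Z x)"
  unfolding field_along_def
proof (intro conjI ballI allI impI)
  show "f x *\<^sub>R Z x \<in> tangent_space B (F x)" if "x \<in> V" for x
    using field_alongD(1)[OF Z that] subspace_tangent_space[OF B] subspace_scale by blast
  fix Q k assume Q: "open Q" "smooth_fun B Q k"
  have "smooth_fun A (V \<inter> F -` Q) (\<lambda>x. f x * Z x k)"
    by (intro smooth_fun_mult[OF A] field_alongD(2)[OF Z Q] smooth_fun_subset[OF f])
      (use V smooth_map_open_vimage[OF F Q(1)] in auto)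
  then show "smooth_fun A (V \<inter> F -` Q) (\<lambda>x. (f x *\<^sub>R Z x) k)" by (simp add: scaleR_fun_def)
qed

lemma field_along_add:
  assumes A: "smooth_atlas A" and B: "smooth_atlas B" and F: "smooth_map A B UNIV F" and V: "open V"
    and Y: "field_along A B F V Y" and Z: "field_along A B F V Z"
  shows "field_along A B F V (\<lambda>x. Y x + Z x)"
  unfolding field_along_def
proof (intro conjI ballI allI impI)
  show "Y x + Z x \<in> tangent_space B (F x)" if "x \<in> V" for x
    using field_alongD(1)[OF Y that] field_alongD(1)[OF Z that] subspace_tangent_space[OF B]
        subspace_add
    by blast
  fix Q k assume Q: "open Q" "smooth_fun B Q k"
  have "smooth_fun A (V \<inter> F -` Q) (\<lambda>x. Y x k + Z x k)"
    by (intro smooth_fun_add[OF A] field_alongD(2)[OF Z Q] field_alongD(2)[OF Y Q])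
      (use V smooth_map_open_vimage[OF F Q(1)] in auto)
  then show "smooth_fun A (V \<inter> F -` Q) (\<lambda>x. (Y x + Z x) k)" by (simp add: plus_fun_def)
qed

lemma field_along_zero:
  assumes B: "smooth_atlas B" shows "field_along A B F V (\<lambda>x. 0)"
  using subspace_0[OF subspace_tangent_space[OF B]]
  by (auto simp: field_along_def smooth_fun_const zero_fun_def)

lemma field_along_sum:
  assumes A: "smooth_atlas A" and B: "smooth_atlas B" and F: "smooth_map A B UNIV F" and V: "open V"
    and Z: "\<And>j. j \<in> I \<Longrightarrow> field_along A B F V (Z j)"
  shows "field_along A B F V (\<lambda>x. \<Sum>j\<in>I. Z j x)"
  using Z by (induction I rule: infinite_finite_induct)
    (auto intro: field_along_zero[OF B] field_along_add[OF A B F V])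

lemma smooth_on_field_coords:
  assumes A: "smooth_atlas A" and B: "smooth_atlas B" and F: "smooth_map A B UNIV F" and V: "open V"
    and Z: "field_along A B F V Z" and c: "(U, \<phi>) \<in> A" and d: "(U', \<psi>) \<in> B"
  shows "smooth_on (\<lambda>y. coords \<psi> (Z (inv_into U \<phi> y))) (\<phi> ` (U \<inter> (V \<inter> F -` U')))"
  unfolding coords_def
proof (intro smooth_on_sum smooth_on_scaleR smooth_on_const)
  note D = atlas_chart[OF B d]
  show "open (\<phi> ` (U \<inter> (V \<inter> F -` U')))"
    using V smooth_map_open_vimage[OF F D(1)] by (intro open_chart_image[OF A c]) auto
  then show "open (\<phi> ` (U \<inter> (V \<inter> F -` U')))" .
  show "smooth_on (\<lambda>y. Z (inv_into U \<phi> y) (\<lambda>z. \<psi> z \<bullet> b)) (\<phi> ` (U \<inter> (V \<inter> F -` U')))" for b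
    by (rule smooth_fun_chartD[OF field_alongD(2)[OF Z D(1) smooth_fun_coordinate[OF B d]] c])
qed

text \<open>A family of tangent vectors along \<open>F\<close> is smooth as soon as its components in charts are.\<close>

lemma field_alongI:
  assumes A: "smooth_atlas A" and B: "smooth_atlas B" and F: "smooth_map A B UNIV F" and V: "open V"
    and Z: "\<And>x. x \<in> V \<Longrightarrow> Z x \<in> tangent_space B (F x)"
    and loc: "\<And>x. x \<in> V \<Longrightarrow> \<exists>U \<phi> U' \<psi> T. (U, \<phi>) \<in> A \<and> x \<in> U \<and> (U', \<psi>) \<in> B \<and> F x \<in> U' \<and>
      open T \<and> \<phi> x \<in> T \<and> smooth_on (\<lambda>y. coords \<psi> (Z (inv_into U \<phi> y))) T"
  shows "field_along A B F V Z"
  unfolding field_along_def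
proof (intro conjI ballI allI impI Z)
  fix Q f assume Q: "open Q" and f: "smooth_fun B Q f"
  show "smooth_fun A (V \<inter> F -` Q) (\<lambda>x. Z x f)"
  proof (rule smooth_fun_chartI[OF A])
    show "open (V \<inter> F -` Q)" using V smooth_map_open_vimage[OF F Q] by auto
    fix x assume x: "x \<in> V \<inter> F -` Q"
    then obtain U \<phi> U' \<psi> T where c: "(U, \<phi>) \<in> A" "x \<in> U" and d: "(U', \<psi>) \<in> B" "F x \<in> U'"
      and T: "open T" "\<phi> x \<in> T" "smooth_on (\<lambda>y. coords \<psi> (Z (inv_into U \<phi> y))) T"
      using loc by blast
    note C = atlas_chart[OF A c(1)] and D = atlas_chart[OF B d(1)]
    define O' where "O' = U \<inter> (V \<inter> F -` (U' \<inter> Q) \<inter> (U \<inter> \<phi> -` T))"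
    have oO: "open (V \<inter> F -` (U' \<inter> Q) \<inter> (U \<inter> \<phi> -` T))"
      using V Q smooth_map_open_vimage[OF F, of "U' \<inter> Q"] D(1) C(1) continuous_open_preimage[OF
          C(3,1) T(1)]
      by auto
    have oT: "open (\<phi> ` O')" unfolding O'_def by (rule open_chart_image[OF A c(1) oO])
    have sub: "\<phi> ` O' \<subseteq> T" "\<phi> ` O' \<subseteq> \<phi> ` (U \<inter> F -` U')" by (auto simp: O'_def)
    let ?h = "\<lambda>y. f (inv_into U' \<psi> y)" and ?m = "\<lambda>y. \<psi> (F (inv_into U \<phi> y))"
      and ?c = "\<lambda>y. coords \<psi> (Z (inv_into U \<phi> y))"
    have h: "smooth_on ?h (\<psi> ` (U' \<inter> Q))" by (rule smooth_fun_chartD[OF f d(1)])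
    have m: "smooth_on ?m (\<phi> ` O')"
      by (rule smooth_on_subset[OF smooth_map_chartD[OF F c(1) d(1)] sub(2)])
    have "smooth_on (\<lambda>y. \<Sum>b\<in>Basis. (?c y \<bullet> b) *\<^sub>R dderiv ?h (?m y) b) (\<phi> ` O')"
    proof (intro smooth_on_sum smooth_on_scaleR smooth_on_inner_const oT smooth_on_subset[OF T(3)
        sub(1)])
      show "smooth_on (\<lambda>y. dderiv ?h (?m y) b) (\<phi> ` O')" for b
        by (rule smooth_on_compose[OF oT open_chart_image[OF B d(1) Q] _ smooth_on_dderiv[OF h] m])
          (use C(6) in \<open>auto simp: O'_def\<close>)
    qed
    then have "smooth_on (\<lambda>y. Z (inv_into U \<phi> y) f) (\<phi> ` O')"
    proof (rule smooth_on_cong[OF oT, rotated])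
      fix y assume "y \<in> \<phi> ` O'"
      then obtain z where z: "z \<in> O'" "y = \<phi> z" by blast
      have zz: "z \<in> U" "z \<in> V" "F z \<in> U'" "F z \<in> Q" "inv_into U \<phi> y = z" using z C(6)
          by (auto simp: O'_def)
      have fz: "smooth_near B (F z) f" by (rule smooth_nearI[OF Q zz(4) f])
      show "(\<Sum>b\<in>Basis. (?c y \<bullet> b) *\<^sub>R dderiv ?h (?m y) b) = Z (inv_into U \<phi> y) f"
        unfolding tangent_vector_apply[OF B d(1) zz(3) Z[OF zz(2)] fz] zz(5)
        by (rule linear_euclidean_expand[symmetric])
          (intro linear_dderiv smooth_near_differentiable[OF B d(1) zz(3) fz])
    qed
    then show "\<exists>U \<phi> Q. (U, \<phi>) \<in> A \<and> x \<in> U \<and> open Q \<and> x \<in> Q \<and>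
        smooth_on (\<lambda>y. Z (inv_into U \<phi> y) f) (\<phi> ` (U \<inter> Q))"
      unfolding O'_def using c d x T(2) oO by (intro exI[of _ U] exI[of _ \<phi>] exI conjI) auto
  qed
qed

lemma vector_field_compose:
  assumes A: "smooth_atlas A" and B: "smooth_atlas B" and F: "smooth_map A B UNIV F"
    and X: "vector_field B X"
  shows "field_along A B F UNIV (\<lambda>x. X (F x))"
  unfolding field_along_def
proof (intro conjI ballI allI impI)
  note X' = X[unfolded vector_field_def]
  show "X (F x) \<in> tangent_space B (F x)" for x using field_alongD(1)[OF X'] by auto
  fix Q f assume Q: "open Q" "smooth_fun B Q f"
  show "smooth_fun A (UNIV \<inter> F -` Q) (\<lambda>x. X (F x) f)"
    using smooth_fun_compose[OF A B F Q(1), of "\<lambda>x. X x f"] field_alongD(2)[OF X' Q] by simp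
qed

lemma push_vector_field:
  assumes A: "smooth_atlas A" and B: "smooth_atlas B" and F: "smooth_map A B UNIV F"
    and W: "vector_field A W"
  shows "field_along A B F UNIV (\<lambda>x. push B F x (W x))"
  unfolding field_along_def
proof (intro conjI ballI allI impI)
  note W' = W[unfolded vector_field_def]
  show "push B F x (W x) \<in> tangent_space B (F x)" for x
    using field_alongD(1)[OF W'] by (intro push_in_tangent_space[OF A B F]) auto
  fix Q f assume Q: "open Q" "smooth_fun B Q f"
  have oQ: "open (F -` Q)" by (rule smooth_map_open_vimage[OF F Q(1)])
  have "smooth_fun A (F -` Q) (\<lambda>x. W x (\<lambda>z. f (F z)))"
    using field_alongD(2)[OF W' oQ smooth_fun_compose[OF A B F Q]] by simp
  then have "smooth_fun A (F -` Q) (\<lambda>x. push B F x (W x) f)"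
    by (rule smooth_fun_cong[OF A oQ, rotated]) (use Q smooth_nearI in \<open>auto simp: push_def\<close>)
  then show "smooth_fun A (UNIV \<inter> F -` Q) (\<lambda>x. push B F x (W x) f)" by simp
qed

subsection \<open>Cut-off functions and extension of local fields\<close>

lemma exists_cutoff:
  fixes A :: "('m::{t2_space,second_countable_topology}, 'e::euclidean_space) chart set"
  assumes A: "smooth_atlas A" and V: "open V" "x \<in> V"
  obtains \<beta> C O' where "smooth_fun A UNIV \<beta>" "closed C" "C \<subseteq> V" "\<And>z. z \<notin> C \<Longrightarrow> \<beta> z = 0"
    "open O'" "x \<in> O'" "O' \<subseteq> V" "\<And>z. z \<in> O' \<Longrightarrow> \<beta> z = 1"
proof -
  obtain U \<phi> where c: "(U, \<phi>) \<in> A" "x \<in> U" using atlas_covers[OF A] by blast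
  note C = atlas_chart[OF A c(1)]
  obtain R where R: "R > 0" "cball (\<phi> x) R \<subseteq> \<phi> ` (U \<inter> V)"
    using open_chart_image[OF A c(1) V(1)] c(2) V(2) open_contains_cball by blast
  obtain \<beta>0 :: "'e \<Rightarrow> real" where b: "smooth_on \<beta>0 UNIV" "\<And>y. y \<in> ball (\<phi> x) (R / 2) \<Longrightarrow> \<beta>0 y = 1"
    "\<And>y. y \<notin> ball (\<phi> x) R \<Longrightarrow> \<beta>0 y = 0"
    using exists_bump[of "R / 2" R "\<phi> x"] R(1) by auto
  define \<beta> where "\<beta> = (\<lambda>z. if z \<in> U then \<beta>0 (\<phi> z) else 0)"
  define K where "K = inv_into U \<phi> ` cball (\<phi> x) R"
  have KV: "K \<subseteq> U \<inter> V" using R(2) C(6) by (auto simp: K_def)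
  have "compact K" unfolding K_def
    using R(2) by (intro compact_continuous_image continuous_on_subset[OF C(4)]) auto
  then have cK: "closed K" by (rule compact_imp_closed)
  have zero: "\<beta> z = 0" if "z \<notin> K" for z
  proof (cases "z \<in> U")
    case True
    have "\<phi> z \<notin> ball (\<phi> x) R"
    proof
      assume "\<phi> z \<in> ball (\<phi> x) R"
      then have "inv_into U \<phi> (\<phi> z) \<in> K" unfolding K_def by (intro imageI) auto
      then show False using C(6)[OF True] that by simp
    qed
    then show ?thesis using b(3) True by (simp add: \<beta>_def)
  qed (simp add: \<beta>_def)
  have "smooth_fun A UNIV \<beta>"
  proof (rule smooth_fun_local[OF A open_UNIV])
    fix z
    show "\<exists>Q. open Q \<and> z \<in> Q \<and> smooth_fun A Q \<beta>"
    proof (cases "z \<in> U")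
      case True
      have "smooth_fun A (U \<inter> UNIV) (\<lambda>z. \<beta>0 (\<phi> z))"
        by (intro smooth_fun_chart_compose[OF A c(1)] smooth_on_subset[OF b(1)]) auto
      then have "smooth_fun A U \<beta>"
        using smooth_fun_cong[OF A C(1), of "\<lambda>z. \<beta>0 (\<phi> z)" \<beta>] by (simp add: \<beta>_def)
      then show ?thesis using True C(1) by blast
    next
      case False
      have "open (- K)" using cK by auto
      moreover from this have "smooth_fun A (- K) \<beta>"
        by (rule smooth_fun_cong[OF A _ _ smooth_fun_const[of _ _ 0]]) (simp add: zero)
      ultimately show ?thesis using False KV by blast
    qed
  qed
  moreover define O' where "O' = V \<inter> (U \<inter> \<phi> -` ball (\<phi> x) (R / 2))"
  have "open O'" unfolding O'_def
    using V(1) continuous_open_preimage[OF C(3,1)] by auto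
  moreover have "x \<in> O'" using c(2) V(2) R(1) by (simp add: O'_def)
  moreover have "\<beta> z = 1" if "z \<in> O'" for z using that b(2) by (simp add: \<beta>_def O'_def)
  ultimately show ?thesis using that[of \<beta> K O'] cK KV zero O'_def by blast
qed

text \<open>A local field is extended by means of a cut-off function. Being a multiple of the given
  field, the extension stays in every family of subspaces that contains the latter.\<close>

lemma extend_field:
  fixes A :: "('n::{t2_space,second_countable_topology}, 'd::euclidean_space) chart set"
  assumes A: "smooth_atlas A" and B: "smooth_atlas B" and F: "smooth_map A B UNIV F"
    and V: "open V" "x \<in> V" and Z: "field_along A B F V Z"
  obtains Z' k O' where "field_along A B F UNIV Z'" "open O'" "x \<in> O'" "O' \<subseteq> V"
    "\<And>z. z \<in> O' \<Longrightarrow> Z' z = Z z" "\<And>z. z \<in> V \<Longrightarrow> Z' z = k z *\<^sub>R Z z" "\<And>z. z \<notin> V \<Longrightarrow> Z' z = 0"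
proof -
  obtain \<beta> C O' where b: "smooth_fun A UNIV \<beta>" "closed C" "C \<subseteq> V" "\<And>z. z \<notin> C \<Longrightarrow> \<beta> z = 0"
    "open O'" "x \<in> O'" "O' \<subseteq> V" "\<And>z. z \<in> O' \<Longrightarrow> \<beta> z = 1"
    using exists_cutoff[OF A V] by metis
  define Z' where "Z' = (\<lambda>z. if z \<in> V then \<beta> z *\<^sub>R Z z else 0)"
  have Z'0: "Z' z = 0" if "z \<notin> C" for z using b(4)[OF that] by (simp add: Z'_def)
  have Z'V: "field_along A B F V Z'"
    by (rule field_along_cong[OF A F V(1)
      field_along_scaleR[OF A B F V(1) smooth_fun_subset[OF b(1)] Z]]) (auto simp: Z'_def)
  have "field_along A B F UNIV Z'"
    unfolding field_along_def
  proof (intro conjI ballI allI impI)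
    show "Z' z \<in> tangent_space B (F z)" for z
      using field_alongD(1)[OF Z'V] subspace_0[OF subspace_tangent_space[OF B]]
      by (cases "z \<in> V") (auto simp: Z'_def)
    fix Q f assume Q: "open Q" "smooth_fun B Q f"
    have oQ: "open (F -` Q)" by (rule smooth_map_open_vimage[OF F Q(1)])
    show "smooth_fun A (UNIV \<inter> F -` Q) (\<lambda>z. Z' z f)"
    proof (rule smooth_fun_local[OF A])
      fix z assume z: "z \<in> UNIV \<inter> F -` Q"
      show "\<exists>Q. open Q \<and> z \<in> Q \<and> smooth_fun A Q (\<lambda>z. Z' z f)"
      proof (cases "z \<in> V")
        case True
        then show ?thesis using field_alongD(2)[OF Z'V Q] z V(1) oQ
          by (intro exI[of _ "V \<inter> F -` Q"]) auto
      next
        case False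
        have "open (- C)" using b(2) by auto
        moreover from this have "smooth_fun A (- C) (\<lambda>z. Z' z f)"
          by (rule smooth_fun_cong[OF A _ _ smooth_fun_const[of _ _ 0]]) (simp add: Z'0)
        ultimately show ?thesis using False b(3) by blast
      qed
    qed (use oQ in auto)
  qed
  moreover have "Z' z = Z z" if "z \<in> O'" for z using that b(7,8) by (auto simp: Z'_def)
  ultimately show ?thesis using that[of Z' O' \<beta>] b(5-7) by (auto simp: Z'_def)
qed

lemma extend_function:
  fixes A :: "('n::{t2_space,second_countable_topology}, 'd::euclidean_space) chart set"
  assumes A: "smooth_atlas A" and V: "open V" "x \<in> V" and f: "smooth_fun A V f"
  obtains f' O' where "smooth_fun A UNIV f'" "open O'" "x \<in> O'" "O' \<subseteq> V"
    "\<And>z. z \<in> O' \<Longrightarrow> f' z = f z"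
proof -
  obtain \<beta> C O' where b: "smooth_fun A UNIV \<beta>" "closed C" "C \<subseteq> V" "\<And>z. z \<notin> C \<Longrightarrow> \<beta> z = 0"
    "open O'" "x \<in> O'" "O' \<subseteq> V" "\<And>z. z \<in> O' \<Longrightarrow> \<beta> z = 1"
    using exists_cutoff[OF A V] by metis
  have "smooth_fun A UNIV (\<lambda>z. \<beta> z * f z)"
  proof (rule smooth_fun_local[OF A open_UNIV])
    fix z
    show "\<exists>Q. open Q \<and> z \<in> Q \<and> smooth_fun A Q (\<lambda>z. \<beta> z * f z)"
    proof (cases "z \<in> V")
      case True
      then show ?thesis using smooth_fun_mult[OF A V(1) smooth_fun_subset[OF b(1)] f] V(1) by blast
    next
      case False
      have "open (- C)" using b(2) by auto
      moreover from this have "smooth_fun A (- C) (\<lambda>z. \<beta> z * f z)"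
        by (rule smooth_fun_cong[OF A _ _ smooth_fun_const[of _ _ 0]]) (simp add: b(4))
      ultimately show ?thesis using False b(3) by blast
    qed
  qed
  then show ?thesis using that[of "\<lambda>z. \<beta> z * f z" O'] b(5-8) by simp
qed

subsection \<open>The Lie bracket in coordinates\<close>

lemma vector_fieldD:
  assumes "vector_field A X"
  shows "X x \<in> tangent_space A x"
    "open Q \<Longrightarrow> smooth_fun A Q f \<Longrightarrow> smooth_fun A Q (\<lambda>x. X x f)"
  using assms field_alongD[of A A "\<lambda>x. x" UNIV X] by (auto simp: vector_field_def)

lemma vector_field_coords_smooth:
  assumes A: "smooth_atlas A" and X: "vector_field A X" and c: "(U, \<phi>) \<in> A"
  shows "smooth_on (\<lambda>y. coords \<phi> (X (inv_into U \<phi> y))) (\<phi> ` U)"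
  using smooth_on_field_coords[OF A A smooth_map_ident[OF A] open_UNIV X[unfolded vector_field_def]
      c c]
  by simp

text \<open>The second derivatives of \<open>f\<close> in \<open>X (Y f) - Y (X f)\<close> cancel by symmetry.\<close>

lemma lie_bracket_chart:
  assumes A: "smooth_atlas A" and X: "vector_field A X" and Y: "vector_field A Y"
    and c: "(U, \<phi>) \<in> A" "x \<in> U"
  defines "X' \<equiv> \<lambda>y. coords \<phi> (X (inv_into U \<phi> y))" and "Y' \<equiv> \<lambda>y. coords \<phi> (Y (inv_into U \<phi> y))"
  shows "lie_bracket A X Y x =
    chart_vec A U \<phi> x (dderiv Y' (\<phi> x) (X' (\<phi> x)) - dderiv X' (\<phi> x) (Y' (\<phi> x)))"
proof
  fix f
  note C = atlas_chart[OF A c(1)]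
  show "lie_bracket A X Y x f =
    chart_vec A U \<phi> x (dderiv Y' (\<phi> x) (X' (\<phi> x)) - dderiv X' (\<phi> x) (Y' (\<phi> x))) f"
  proof (cases "smooth_near A x f")
    case True
    then obtain Q where Q: "open Q" "x \<in> Q" "smooth_fun A Q f" by (auto simp: smooth_near_def)
    let ?f = "\<lambda>y. f (inv_into U \<phi> y)" and ?T = "\<phi> ` (U \<inter> Q)"
    have T: "open ?T" "\<phi> x \<in> ?T" using open_chart_image[OF A c(1) Q(1)] c(2) Q(2) by auto
    have sf: "smooth_on ?f ?T" by (rule smooth_fun_chartD[OF Q(3) c(1)])
    have key: "X x (\<lambda>z. Y z f) = dderiv ?f (\<phi> x) (dderiv (\<lambda>y. coords \<phi> (Y (inv_into U \<phi> y))) (\<phi> x)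
        (coords \<phi> (X x)))
        + dderiv2 ?f (\<phi> x) (coords \<phi> (X x)) (coords \<phi> (Y x))"
      if X: "vector_field A X" and Y: "vector_field A Y" for X Y
    proof -
      let ?Y = "\<lambda>y. coords \<phi> (Y (inv_into U \<phi> y))"
      have "(?Y has_derivative dderiv ?Y (\<phi> x)) (at (\<phi> x))"
        using c(2) by (intro dderiv_works smooth_on_differentiable[OF vector_field_coords_smooth[OF
            A Y c(1)]]) auto
      from has_derivative_dderiv_apply[OF T sf this]
      have "((\<lambda>y. Y (inv_into U \<phi> y) f) has_derivative
          (\<lambda>h. dderiv ?f (\<phi> x) (dderiv ?Y (\<phi> x) h) + dderiv2 ?f (\<phi> x) h (?Y (\<phi> x)))) (at (\<phi> x))"
      proof (rule has_derivative_transform_within_open[OF _ T])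
        fix y assume "y \<in> ?T"
        then obtain z where z: "z \<in> U" "z \<in> Q" "y = \<phi> z" by blast
        show "dderiv ?f y (?Y y) = Y (inv_into U \<phi> y) f"
          using tangent_vector_apply[OF A c(1) z(1) vector_fieldD(1)[OF Y] smooth_nearI[OF Q(1)
              z(2) Q(3)]]
          by (simp add: z(3) C(6)[OF z(1)])
      qed
      from dderiv_eq[OF this] show ?thesis
        using tangent_vector_apply[OF A c vector_fieldD(1)[OF X]
            smooth_nearI[OF Q(1,2) vector_fieldD(2)[OF Y Q(1,3)]]]
        by (simp add: C(6)[OF c(2)])
    qed
    have "linear (dderiv ?f (\<phi> x))" by (intro linear_dderiv smooth_on_differentiable[OF sf] T)
    then show ?thesis
      using True key[OF X Y] key[OF Y X] dderiv2_symmetric[OF T sf]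
      by (simp add: lie_bracket_def chart_vec_apply[OF A c] X'_def Y'_def C(6)[OF c(2)] linear_diff)
  qed (simp add: lie_bracket_def chart_vec_apply[OF A c])
qed

lemma lie_bracket_in_tangent_space:
  assumes A: "smooth_atlas A" and X: "vector_field A X" and Y: "vector_field A Y"
  shows "lie_bracket A X Y x \<in> tangent_space A x"
proof -
  obtain U \<phi> where c: "(U, \<phi>) \<in> A" "x \<in> U" using atlas_covers[OF A] by blast
  show ?thesis unfolding lie_bracket_chart[OF A X Y c] by (rule chart_vec_in_tangent_space[OF c])
qed

section \<open>Frobenius' theorem\<close>

lemma exists_linear_projection:
  fixes K :: "'a::real_vector set"
  assumes "subspace K"
  obtains \<pi> where "linear \<pi>" "\<And>w. \<pi> w \<in> K" "\<And>w. w \<in> K \<Longrightarrow> \<pi> w = w"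
proof -
  obtain B where B: "B \<subseteq> K" "independent B" "K \<subseteq> span B"
    using maximal_independent_subset by blast
  obtain \<pi> :: "'a \<Rightarrow> 'a" where p: "linear \<pi>" "\<forall>x\<in>B. \<pi> x = x" "range \<pi> = span ((\<lambda>x. x) ` B)"
    using linear_independent_extend_subspace[OF B(2), of "\<lambda>x. x"] by blast
  have sB: "span B = K" using B assms by (simp add: span_minimal subset_antisym)
  then have "\<pi> w \<in> K" for w using p(3) rangeI[of \<pi> w] by simp
  moreover have "\<pi> w = w" if "w \<in> span B" for w
    using linear_eq_on_span[OF p(1) linear_ident, of B w] p(2) that by simp
  ultimately show ?thesis using that[of \<pi>] p(1) sB by blast
qed

lemma subbundle_fibre:
  assumes B: "smooth_atlas B" and E: "subbundle_along A B F k E"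
  shows "subspace (E x)" "E x \<subseteq> tangent_space B (F x)"
proof -
  obtain V \<epsilon> where V: "x \<in> V" and f: "frame_on A B F V k E \<epsilon>"
    using E[unfolded subbundle_along_def, rule_format, of x] by blast
  have s: "span ((\<lambda>j. \<epsilon> j x) ` {..<k}) = E x" using V f by (auto simp: frame_on_def)
  show "subspace (E x)" using s subspace_span by metis
  have "(\<lambda>j. \<epsilon> j x) ` {..<k} \<subseteq> tangent_space B (F x)"
    using f V field_alongD(1) by (fastforce simp: frame_on_def)
  then show "E x \<subseteq> tangent_space B (F x)"
    using s span_minimal[OF _ subspace_tangent_space[OF B]] by metis
qed

subsection \<open>Parametrizations in charts\<close>

text \<open>The components of the velocity of \<open>c\<close> are those of the derivative of \<open>\<phi> \<circ> c\<close>.\<close>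

lemma velocity_in_chart:
  assumes A: "smooth_atlas A" and d: "(U, \<phi>) \<in> A" "c y \<in> U"
    and T: "open T" "y \<in> T" "\<And>y. y \<in> T \<Longrightarrow> c y \<in> U"
    and dc: "((\<lambda>y. \<phi> (c y)) has_derivative c') (at y)"
  shows "velocity A c y w = chart_vec A U \<phi> (c y) (c' w)"
proof
  fix f
  show "velocity A c y w f = chart_vec A U \<phi> (c y) (c' w) f"
  proof (cases "smooth_near A (c y) f")
    case True
    let ?f = "\<lambda>y. f (inv_into U \<phi> y)"
    have "((\<lambda>y. ?f (\<phi> (c y))) has_derivative (\<lambda>h. dderiv ?f (\<phi> (c y)) (c' h))) (at y)"
      by (intro has_derivative_compose[OF dc] dderiv_works smooth_near_differentiable[OF A d True])
    then have "((\<lambda>y. f (c y)) has_derivative (\<lambda>h. dderiv ?f (\<phi> (c y)) (c' h))) (at y)"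
      by (rule has_derivative_transform_within_open[OF _ T(1,2)])
        (use T(3) atlas_chart(6)[OF A d(1)] in auto)
    from dderiv_eq[OF this] True show ?thesis
      by (simp add: chart_vec_apply[OF A d]) (simp add: velocity_def)
  next
    case False
    then show ?thesis by (simp add: chart_vec_apply[OF A d]) (simp add: velocity_def)
  qed
qed

subsection \<open>Integrable distributions are involutive\<close>

text \<open>A field \<open>Y\<close> tangent to a parametrized submanifold \<open>m\<close> lifts to a smooth field \<open>w\<close> on the
  parameter space, because \<open>w\<close> solves a system of linear equations; the equations
  \<open>w y - \<pi> (w y) = 0\<close> are added to express that \<open>w y\<close> lies in \<open>K\<close>.\<close>

lemma lift_to_parameters:
  fixes m :: "'d::euclidean_space \<Rightarrow> 'd"
  assumes S: "open S" and \<pi>: "linear \<pi>" "\<And>w. \<pi> w \<in> K" "\<And>w. w \<in> K \<Longrightarrow> \<pi> w = w"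
    and m: "smooth_on m S" and Y: "smooth_on (\<lambda>y. Y (m y)) S"
    and inj: "\<And>y. y \<in> S \<Longrightarrow> inj_on (dderiv m y) K"
    and ex: "\<And>y. y \<in> S \<Longrightarrow> \<exists>w\<in>K. dderiv m y w = Y (m y)"
  obtains w where "smooth_on w S" "\<And>y. y \<in> S \<Longrightarrow> w y \<in> K" "\<And>y. y \<in> S \<Longrightarrow> dderiv m y (w y) = Y (m y)"
proof -
  obtain w where w: "\<And>y. y \<in> S \<Longrightarrow> w y \<in> K" "\<And>y. y \<in> S \<Longrightarrow> dderiv m y (w y) = Y (m y)"
    using ex by metis
  define M where "M = (\<lambda>y v. (dderiv m y v, v - \<pi> v))"
  have lm: "linear (dderiv m y)" if "y \<in> S" for y
    by (intro linear_dderiv smooth_on_differentiable[OF m that])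
  have lid: "linear (\<lambda>v. v - \<pi> v)" using \<pi>(1) by (intro linear_compose_sub linear_ident)
  have "smooth_on w S"
  proof (rule smooth_on_solution[OF S])
    fix y assume y: "y \<in> S"
    show lM: "linear (M y)"
      using lm[OF y] lid by (auto simp: M_def linear_iff)
    show "inj (M y)"
    proof (rule linear_injective_0[OF lM, THEN iffD2], intro allI impI)
      fix v assume "M y v = 0"
      then have "dderiv m y v = dderiv m y 0" "v \<in> K" "0 \<in> K"
        using \<pi>(2)[of v] \<pi>(2)[of 0] linear_0[OF lm[OF y]] linear_0[OF \<pi>(1)]
            by (auto simp: M_def zero_prod_def)
      then show "v = 0" using inj[OF y] by (auto dest: inj_onD)
    qed
  next
    show "smooth_on (\<lambda>y. M y b) S" for b
      unfolding M_def by (intro smooth_on_Pair[OF S] smooth_on_dderiv m smooth_on_const)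
    have "smooth_on (\<lambda>y. (Y (m y), 0::'d)) S"
      by (intro smooth_on_Pair[OF S] Y smooth_on_const)
    then show "smooth_on (\<lambda>y. M y (w y)) S"
      by (rule smooth_on_cong[OF S, rotated]) (use w \<pi>(3) in \<open>auto simp: M_def\<close>)
  qed
  then show ?thesis using w that by blast
qed

text \<open>With \<open>m\<close> the integral manifold in a chart, extended to be constant along the kernel of a
  projection onto \<open>K\<close>, and \<open>u\<close>, \<open>w\<close> the lifts of \<open>X\<close>, \<open>Y\<close>, the bracket of \<open>X\<close> and \<open>Y\<close> is the
  image under the differential of \<open>m\<close> of the bracket of \<open>u\<close> and \<open>w\<close>.\<close>

lemma integrable_imp_involutive:
  fixes A :: "('n::{t2_space,second_countable_topology}, 'd::euclidean_space) chart set"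
  assumes A: "smooth_atlas A" and int: "integrable_distribution A E"
    and X: "vector_field A X" "\<And>x. X x \<in> E x" and Y: "vector_field A Y" "\<And>x. Y x \<in> E x"
  shows "lie_bracket A X Y x \<in> E x"
proof -
  obtain K :: "'d set" and Q and c :: "'d \<Rightarrow> 'n" where K: "subspace K" and Q: "open Q" "0 \<in> Q"
    and c: "smooth_map euclidean_atlas A Q c" and c0: "c 0 = x"
    and vel: "\<And>y. y \<in> Q \<inter> K \<Longrightarrow> inj_on (velocity A c y) K \<and> velocity A c y ` K = E (c y)"
    using int[unfolded integrable_distribution_def, rule_format, of x] by blast
  obtain U \<phi> where d: "(U, \<phi>) \<in> A" "x \<in> U" using atlas_covers[OF A] by blast
  note C = atlas_chart[OF A d(1)]
  obtain \<pi> where \<pi>: "linear \<pi>" "\<And>w. \<pi> w \<in> K" "\<And>w. w \<in> K \<Longrightarrow> \<pi> w = w"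
    using exists_linear_projection[OF K] by blast
  define Q' where "Q' = Q \<inter> c -` U"
  have oQ': "open Q'" unfolding Q'_def
    using c C(1) Q(1) by (intro continuous_open_preimage) (auto simp: smooth_map_def)
  have "inv_into UNIV (\<lambda>x. x) y = y" for y :: 'd by (simp add: inv_into_def)
  then have sc: "smooth_on (\<lambda>y. \<phi> (c y)) Q'"
    using c d(1) by (fastforce simp: smooth_map_def euclidean_atlas_def Q'_def)
  define S where "S = \<pi> -` Q'"
  have oS: "open S" unfolding S_def
    using \<pi>(1) by (intro open_vimage oQ' linear_continuous_on) (simp add:
        linear_conv_bounded_linear)
  have S0: "0 \<in> S" using linear_0[OF \<pi>(1)] Q(2) c0 d(2) by (simp add: S_def Q'_def)
  define m where "m = (\<lambda>y. \<phi> (c (\<pi> y)))"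
  have m: "smooth_on m S" unfolding m_def
    by (rule smooth_on_compose[OF oS oQ' _ sc smooth_on_linear[OF oS \<pi>(1)]]) (auto simp: S_def)
  have inS: "\<pi> y \<in> Q'" "\<pi> y \<in> Q \<inter> K" "c (\<pi> y) \<in> U" if "y \<in> S" for y
    using that \<pi>(2) by (auto simp: S_def Q'_def)
  have vm: "velocity A c (\<pi> y) w = chart_vec A U \<phi> (c (\<pi> y)) (dderiv m y w)"
    if y: "y \<in> S" and w: "w \<in> K" for y w
  proof -
    have 1: "((\<lambda>y. \<phi> (c y)) has_derivative dderiv (\<lambda>y. \<phi> (c y)) (\<pi> y)) (at (\<pi> y))"
      by (intro dderiv_works smooth_on_differentiable[OF sc] inS y)
    have "(\<pi> has_derivative \<pi>) (at y)"
      using \<pi>(1) by (intro bounded_linear_imp_has_derivative) (simp add: linear_conv_bounded_linear)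
    from has_derivative_compose[OF this 1]
    have "dderiv m y = (\<lambda>h. dderiv (\<lambda>y. \<phi> (c y)) (\<pi> y) (\<pi> h))"
      unfolding m_def by (rule dderiv_eq)
    then show ?thesis
      using velocity_in_chart[OF A d(1) inS(3)[OF y] oQ' inS(1)[OF y] _ 1, of w] \<pi>(3)[OF w]
      by (auto simp: Q'_def)
  qed
  have inj: "inj_on (dderiv m y) K" if y: "y \<in> S" for y
    using vel[OF inS(2)[OF y]] vm[OF y] by (auto simp: inj_on_def)
  define Xc Yc where "Xc = (\<lambda>y. coords \<phi> (X (inv_into U \<phi> y)))"
    and "Yc = (\<lambda>y. coords \<phi> (Y (inv_into U \<phi> y)))"
  have lift: "\<exists>w. smooth_on w S \<and> (\<forall>y\<in>S. w y \<in> K \<and>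
      dderiv m y (w y) = coords \<phi> (X (inv_into U \<phi> (m y))))"
    if X: "vector_field A X" "\<And>x. X x \<in> E x" for X
  proof -
    let ?X = "\<lambda>y. coords \<phi> (X (inv_into U \<phi> y))"
    have 1: "smooth_on (\<lambda>y. ?X (m y)) S"
      by (rule smooth_on_compose[OF oS C(2) _ vector_field_coords_smooth[OF A X(1) d(1)] m])
        (use inS(3) in \<open>auto simp: m_def\<close>)
    have 2: "\<exists>w\<in>K. dderiv m y w = ?X (m y)" if y: "y \<in> S" for y
    proof -
      have "X (c (\<pi> y)) \<in> velocity A c (\<pi> y) ` K" using vel[OF inS(2)[OF y]] X(2) by simp
      then obtain w where w: "w \<in> K" "X (c (\<pi> y)) = chart_vec A U \<phi> (c (\<pi> y)) (dderiv m y w)"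
        using vm[OF y] by auto
      then show ?thesis
        using coords_chart_vec[OF A d(1) inS(3)[OF y]] C(6)[OF inS(3)[OF y]]
        by (intro bexI[OF _ w(1)]) (simp add: m_def)
    qed
    obtain w where "smooth_on w S" "\<And>y. y \<in> S \<Longrightarrow> w y \<in> K"
      "\<And>y. y \<in> S \<Longrightarrow> dderiv m y (w y) = ?X (m y)"
      by (rule lift_to_parameters[where Y = ?X, OF oS \<pi> m 1 inj 2]) (assumption | blast)+
    then show ?thesis by blast
  qed
  obtain u where u: "smooth_on u S" "\<And>y. y \<in> S \<Longrightarrow> u y \<in> K" "\<And>y. y \<in> S \<Longrightarrow> dderiv m y (u y) = Xc (m y)"
    using lift[OF X] unfolding Xc_def by blast
  obtain w where w: "smooth_on w S" "\<And>y. y \<in> S \<Longrightarrow> w y \<in> K" "\<And>y. y \<in> S \<Longrightarrow> dderiv m y (w y) = Yc (m y)"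
    using lift[OF Y] unfolding Yc_def by blast
  have m0: "m 0 = \<phi> x" using linear_0[OF \<pi>(1)] c0 by (simp add: m_def)
  have key: "dderiv Z (\<phi> x) (dderiv m 0 h) = dderiv m 0 (dderiv v 0 h) + dderiv2 m 0 h (v 0)"
    if Z: "smooth_on Z (\<phi> ` U)" and v: "smooth_on v S" "\<And>y. y \<in> S \<Longrightarrow> dderiv m y (v y) = Z (m y)"
    for Z v :: "'d \<Rightarrow> 'd" and h
  proof -
    have "(Z has_derivative dderiv Z (\<phi> x)) (at (m 0))"
      unfolding m0 using d(2) by (intro dderiv_works smooth_on_differentiable[OF Z]) auto
    from has_derivative_compose[OF dderiv_works[OF smooth_on_differentiable[OF m S0]] this]
    have 1: "((\<lambda>y. Z (m y)) has_derivative (\<lambda>h. dderiv Z (\<phi> x) (dderiv m 0 h))) (at 0)" .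
    have "((\<lambda>y. dderiv m y (v y)) has_derivative
        (\<lambda>h. dderiv m 0 (dderiv v 0 h) + dderiv2 m 0 h (v 0))) (at 0)"
      by (intro has_derivative_dderiv_apply[OF oS S0 m] dderiv_works smooth_on_differentiable[OF
          v(1) S0])
    then have "((\<lambda>y. Z (m y)) has_derivative
        (\<lambda>h. dderiv m 0 (dderiv v 0 h) + dderiv2 m 0 h (v 0))) (at 0)"
      by (rule has_derivative_transform_within_open[OF _ oS S0]) (rule v(2))
    from has_derivative_unique[OF 1 this] show ?thesis by (simp add: fun_eq_iff)
  qed
  note sX = vector_field_coords_smooth[OF A X(1) d(1), folded Xc_def]
    and sY = vector_field_coords_smooth[OF A Y(1) d(1), folded Yc_def]
  define k where "k = dderiv w 0 (u 0) - dderiv u 0 (w 0)"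
  have lm: "linear (dderiv m 0)" by (intro linear_dderiv smooth_on_differentiable[OF m S0])
  have "dderiv Yc (\<phi> x) (Xc (\<phi> x)) - dderiv Xc (\<phi> x) (Yc (\<phi> x)) = dderiv m 0 k"
    using key[OF sY w(1,3), of "u 0"] key[OF sX u(1,3), of "w 0"] u(3)[OF S0] w(3)[OF S0]
      dderiv2_symmetric[OF oS S0 m, of "u 0" "w 0"] linear_diff[OF lm]
    by (simp add: m0 k_def)
  moreover have "dderiv m 0 k = dderiv m 0 (\<pi> k)"
  proof -
    have "m (y + t *\<^sub>R (k - \<pi> k)) = m y" for y t
      using linear_add[OF \<pi>(1)] linear_scale[OF \<pi>(1)] linear_diff[OF \<pi>(1)] \<pi>(2,3)
          by (simp add: m_def)
    then have "(\<lambda>t::real. m (0 + t *\<^sub>R (k - \<pi> k))) = (\<lambda>t. m 0)" by (rule ext)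
    then have 1: "((\<lambda>t::real. m (0 + t *\<^sub>R (k - \<pi> k))) has_derivative (\<lambda>t. 0)) (at 0)"
      by (simp only: has_derivative_const)
    have 2: "((\<lambda>t::real. 0 + t *\<^sub>R (k - \<pi> k)) has_derivative (\<lambda>t. t *\<^sub>R (k - \<pi> k))) (at 0)"
      by (auto intro!: derivative_eq_intros)
    have 3: "(m has_derivative dderiv m 0) (at (0 + 0 *\<^sub>R (k - \<pi> k)))"
      using dderiv_works[OF smooth_on_differentiable[OF m S0]] by simp
    have "(\<lambda>t::real. 0) = (\<lambda>t. dderiv m 0 (t *\<^sub>R (k - \<pi> k)))"
      by (rule has_derivative_unique[OF 1 has_derivative_compose[OF 2 3]])
    then have "dderiv m 0 (1 *\<^sub>R (k - \<pi> k)) = 0" by metis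
    then show ?thesis using linear_diff[OF lm, of k "\<pi> k"] by simp
  qed
  ultimately have "lie_bracket A X Y x = chart_vec A U \<phi> x (dderiv m 0 (\<pi> k))"
    using lie_bracket_chart[OF A X(1) Y(1) d] by (simp add: Xc_def Yc_def)
  also have "\<dots> = velocity A c 0 (\<pi> k)"
    using vm[OF S0 \<pi>(2)] c0 linear_0[OF \<pi>(1)] by simp
  also have "\<dots> \<in> E x" using vel[OF inS(2)[OF S0]] \<pi>(2)[of k] c0 linear_0[OF \<pi>(1)] by auto
  finally show ?thesis .
qed

subsection \<open>Involutive distributions are integrable\<close>

text \<open>A frame of a distribution near \<open>y0\<close> is replaced by an adapted one: the linear map \<open>P\<close>
  projects onto the fibre at \<open>y0\<close>, it is injective on the neighbouring fibres, and \<open>F y v\<close> is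
  the vector in the fibre at \<open>y\<close> with the same projection as \<open>v\<close>.\<close>

lemma adapted_frame:
  fixes X :: "nat \<Rightarrow> 'd::euclidean_space \<Rightarrow> 'd"
  assumes T: "open T" "y0 \<in> T" and X: "\<And>j. j < k \<Longrightarrow> smooth_on (X j) T"
    and inj: "inj_on (\<lambda>j. X j y0) {..<k}" and ind: "independent ((\<lambda>j. X j y0) ` {..<k})"
  obtains T1 P F where "open T1" "y0 \<in> T1" "T1 \<subseteq> T" "linear P" "\<And>v. P (P v) = P v"
    "\<And>y. y \<in> T1 \<Longrightarrow> linear (F y)" "\<And>v. smooth_on (\<lambda>y. F y v) T1"
    "\<And>y v. y \<in> T1 \<Longrightarrow> P (F y v) = P v"
    "\<And>y v. y \<in> T1 \<Longrightarrow> F y v \<in> span ((\<lambda>j. X j y) ` {..<k})"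
    "\<And>y e. y \<in> T1 \<Longrightarrow> e \<in> span ((\<lambda>j. X j y) ` {..<k}) \<Longrightarrow> P e = 0 \<Longrightarrow> e = 0"
proof -
  have "\<exists>l. linear l \<and> (\<forall>i<k. l (X i y0) = (if i = j then 1 else 0::real))" if j: "j < k" for j
  proof -
    obtain l :: "'d \<Rightarrow> real" where l: "linear l"
      "\<forall>x\<in>(\<lambda>j. X j y0) ` {..<k}. l x = (if x = X j y0 then 1 else 0)"
      using linear_independent_extend[OF ind, of "\<lambda>x. if x = X j y0 then 1 else (0::real)"] by blast
    then show ?thesis using inj j by (intro exI[of _ l]) (auto simp: inj_on_def)
  qed
  then obtain l :: "nat \<Rightarrow> 'd \<Rightarrow> real" where l: "\<And>j. j < k \<Longrightarrow> linear (l j)"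
    "\<And>i j. i < k \<Longrightarrow> j < k \<Longrightarrow> l j (X i y0) = (if i = j then 1 else 0)"
    by metis
  define L where "L = (\<lambda>y v. \<Sum>j<k. l j v *\<^sub>R X j y)"
  define P where "P = L y0"
  have lL: "linear (L y)" for y
  proof -
    have "linear (\<lambda>v. l j v *\<^sub>R X j y)" if "j < k" for j
      using l(1)[OF that] by (simp add: linear_iff scaleR_add_left)
    then show ?thesis unfolding L_def by (intro linear_compose_sum ballI) auto
  qed
  have lP: "linear P" by (simp add: P_def lL)
  have lP': "l i (P v) = l i v" if "i < k" for i v
  proof -
    have "l i (P v) = (\<Sum>j<k. l j v * l i (X j y0))"
      unfolding P_def L_def using l(1)[OF that] by (simp add: linear_sum linear_scale)
    also have "\<dots> = (\<Sum>j<k. if j = i then l j v else 0)"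
      by (intro sum.cong refl) (simp add: l(2) that)
    finally show ?thesis using that by simp
  qed
  have LP: "L y (P v) = L y v" for y v by (simp add: L_def lP')
  then have PP: "P (P v) = P v" for v by (simp add: P_def)
  have LX: "L y (X i y0) = X i y" if "i < k" for i y
  proof -
    have "L y (X i y0) = (\<Sum>j<k. if j = i then X j y else 0)"
      unfolding L_def by (intro sum.cong refl) (simp add: l(2) that)
    then show ?thesis using that by simp
  qed
  have range_L: "span ((\<lambda>j. X j y) ` {..<k}) = range (L y)" for y
  proof
    have "(\<lambda>j. X j y) ` {..<k} \<subseteq> range (L y)" using LX by (metis image_subsetI lessThan_iff rangeI)
    then show "span ((\<lambda>j. X j y) ` {..<k}) \<subseteq> range (L y)"
      by (rule span_minimal) (intro linear_subspace_image lL subspace_UNIV)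
    show "range (L y) \<subseteq> span ((\<lambda>j. X j y) ` {..<k})"
      unfolding L_def by (intro image_subsetI span_sum span_scale span_base imageI)
  qed
  have sL: "smooth_on (\<lambda>y. L y v) T" for v
    unfolding L_def by (intro smooth_on_sum[OF T(1)] smooth_on_scaleR[OF T(1)] smooth_on_const X)
        auto
  define M where "M = (\<lambda>y v. v - P v + P (L y v))"
  have lM: "linear (M y)" for y
    unfolding M_def
    by (intro linear_compose_add linear_compose_sub linear_ident lP linear_compose[OF lL lP,
        unfolded o_def])
  have sM: "smooth_on (\<lambda>y. M y v) T" for v
    unfolding M_def using lP
    by (intro smooth_on_add[OF T(1)] smooth_on_const smooth_on_bounded_linear[OF T(1) _ sL])
      (simp add: linear_conv_bounded_linear)
  have "M y0 v = v" for v by (simp add: M_def P_def[symmetric] PP)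
  then have "inj (M y0)" by (metis injI)
  with linear_family_bounded_below[OF T(1) lM T(2) this smooth_on_continuous_on[OF sM]]
  obtain B T1 where B: "B > 0" and T1: "open T1" "y0 \<in> T1" "T1 \<subseteq> T"
    and low: "\<And>y v. y \<in> T1 \<Longrightarrow> B * norm v \<le> norm (M y v)" by blast
  have injM: "inj (M y)" if "y \<in> T1" for y
  proof (rule linear_injective_0[OF lM, THEN iffD2], intro allI impI)
    fix v assume "M y v = 0"
    then show "v = 0" using low[OF that, of v] B by (simp add: mult_le_0_iff)
  qed
  have MG: "M y (inv (M y) v) = v" if "y \<in> T1" for y v
    by (rule surj_f_inv_f[OF linear_injective_imp_surjective[OF lM injM[OF that]]]) simp
  define F where "F = (\<lambda>y v. L y (inv (M y) (P v)))"
  have lF: "linear (F y)" if "y \<in> T1" for y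
    unfolding F_def
    using linear_compose[OF lP linear_compose[OF inj_linear_imp_inv_linear[OF lM injM[OF that]] lL]]
    by (simp add: o_def)
  have sG: "smooth_on (\<lambda>y. inv (M y) (P v)) T1" for v
  proof (rule smooth_on_solution[OF T1(1) lM injM])
    show "smooth_on (\<lambda>y. M y b) T1" for b by (rule smooth_on_subset[OF sM T1(3)])
    show "smooth_on (\<lambda>y. M y (inv (M y) (P v))) T1"
      by (rule smooth_on_cong[OF T1(1) _ smooth_on_const[of "P v"]]) (simp add: MG)
  qed
  have sF: "smooth_on (\<lambda>y. F y v) T1" for v
    unfolding F_def L_def using l(1) smooth_on_subset[OF X T1(3)]
    by (intro smooth_on_sum[OF T1(1)] smooth_on_scaleR[OF T1(1)] smooth_on_bounded_linear[OF T1(1)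
        _ sG])
      (auto simp: linear_conv_bounded_linear)
  have PF: "P (F y v) = P v" if "y \<in> T1" for y v
  proof -
    let ?w = "inv (M y) (P v)"
    have "P (P v) = P (?w - P ?w + P (F y v))" using MG[OF that, of "P v"]
        by (simp add: M_def F_def)
    then show ?thesis using lP by (simp add: linear_add linear_diff PP)
  qed
  have FE: "F y v \<in> span ((\<lambda>j. X j y) ` {..<k})" for y v
    unfolding range_L F_def by simp
  have P0: "e = 0" if y: "y \<in> T1" and e: "e \<in> span ((\<lambda>j. X j y) ` {..<k})" "P e = 0" for y e
  proof -
    obtain v where v: "e = L y v" using e(1) unfolding range_L by blast
    then have "M y (P v) = 0" using e(2) LP[of y v] PP[of v] by (simp add: M_def)
    then have "P v = 0" using injM[OF y] linear_0[OF lM] by (metis injD)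
    then show "e = 0" using LP[of y v] v linear_0[OF lL] by simp
  qed
  show ?thesis by (rule that[OF T1 lP PP lF sF PF FE P0])
qed

text \<open>In an adapted frame, the integral manifold through \<open>x0\<close> is the solution of the total
  differential equation \<open>Dc(s) v = F (c s) v\<close>, restricted to the range of \<open>P\<close>.\<close>

lemma involutive_imp_integrable:
  fixes A :: "('n::{t2_space,second_countable_topology}, 'd::euclidean_space) chart set"
  assumes A: "smooth_atlas A" and E: "subbundle_along A A (\<lambda>x. x) k E"
    and invol: "\<And>X Y x. vector_field A X \<Longrightarrow> (\<And>x. X x \<in> E x) \<Longrightarrow> vector_field A Y \<Longrightarrow>
      (\<And>x. Y x \<in> E x) \<Longrightarrow> lie_bracket A X Y x \<in> E x"
  shows "integrable_distribution A E"
  unfolding integrable_distribution_def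
proof
  fix x0
  note id = smooth_map_ident[OF A]
  note fib = subbundle_fibre[OF A E]
  obtain V \<epsilon> where V: "open V" "x0 \<in> V" and fr: "frame_on A A (\<lambda>x. x) V k E \<epsilon>"
    using E[unfolded subbundle_along_def, rule_format, of x0] by blast
  obtain U \<phi> where d: "(U, \<phi>) \<in> A" "x0 \<in> U" using atlas_covers[OF A] by blast
  note C = atlas_chart[OF A d(1)]
  define T where "T = \<phi> ` (U \<inter> V)"
  have T: "open T" "\<phi> x0 \<in> T" using open_chart_image[OF A d(1) V(1)] d(2) V(2) by (auto simp: T_def)
  define X where "X = (\<lambda>j y. coords \<phi> (\<epsilon> j (inv_into U \<phi> y)))"
  have sX: "smooth_on (X j) T" if "j < k" for j
    using smooth_on_field_coords[OF A A id V(1) _ d(1) d(1), of "\<epsilon> j"] that fr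
    unfolding X_def T_def frame_on_def by (auto elim!: smooth_on_subset)
  \<comment> \<open>Fibres of \<open>E\<close> in coordinates.\<close>
  have E_coords: "coords \<phi> ` E z = span ((\<lambda>j. X j (\<phi> z)) ` {..<k})" if z: "z \<in> U" "z \<in> V" for z
  proof -
    have "E z = span ((\<lambda>j. \<epsilon> j z) ` {..<k})" using fr z by (auto simp: frame_on_def)
    then show ?thesis
      using linear_span_image[OF linear_coords, of \<phi> "(\<lambda>j. \<epsilon> j z) ` {..<k}"]
      by (simp add: X_def C(6)[OF z(1)] image_image)
  qed
  have inj_coords: "inj_on (coords \<phi>) (E z)" if "z \<in> U" for z
    using fib(2) tangent_vector_eqI[OF A d(1) that] by (intro inj_onI) blast
  have E_chart: "chart_vec A U \<phi> z e \<in> E z"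
    if z: "z \<in> U" "z \<in> V" and e: "e \<in> span ((\<lambda>j. X j (\<phi> z)) ` {..<k})" for z e
  proof -
    obtain v where "v \<in> E z" "e = coords \<phi> v" using e E_coords[OF z] by blast
    then show ?thesis using tangent_vector_chart[OF A d(1) z(1)] fib(2) by (metis subsetD)
  qed
  have f0: "inj_on (\<lambda>j. \<epsilon> j x0) {..<k}" "independent ((\<lambda>j. \<epsilon> j x0) ` {..<k})"
    "span ((\<lambda>j. \<epsilon> j x0) ` {..<k}) = E x0" using fr V(2) by (auto simp: frame_on_def)
  have X0: "(\<lambda>j. X j (\<phi> x0)) = coords \<phi> \<circ> (\<lambda>j. \<epsilon> j x0)" by (simp add: X_def C(6)[OF d(2)] o_def)
  have i1: "inj_on (\<lambda>j. X j (\<phi> x0)) {..<k}"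
    unfolding X0 using f0 inj_coords[OF d(2)]
        by (intro comp_inj_on) (auto intro: inj_on_subset span_base)
  have i2: "independent ((\<lambda>j. X j (\<phi> x0)) ` {..<k})"
    unfolding X0 image_comp[symmetric]
    using linear_independent_injective_image[OF linear_coords f0(2), of \<phi>] inj_coords[OF d(2)]
        f0(3) by simp
  obtain T1 P F where T1: "open T1" "\<phi> x0 \<in> T1" "T1 \<subseteq> T" and P: "linear P" "\<And>v. P (P v) = P v"
    and F: "\<And>y. y \<in> T1 \<Longrightarrow> linear (F y)" "\<And>v. smooth_on (\<lambda>y. F y v) T1"
    and PF: "\<And>y v. y \<in> T1 \<Longrightarrow> P (F y v) = P v"
    and FE: "\<And>y v. y \<in> T1 \<Longrightarrow> F y v \<in> span ((\<lambda>j. X j y) ` {..<k})"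
    and P0: "\<And>y e. y \<in> T1 \<Longrightarrow> e \<in> span ((\<lambda>j. X j y) ` {..<k}) \<Longrightarrow> P e = 0 \<Longrightarrow> e = 0"
    by (rule adapted_frame[OF T sX i1 i2]) blast+
  have bP: "bounded_linear P" using P(1) by (simp add: linear_conv_bounded_linear)
  have T1U: "T1 \<subseteq> \<phi> ` U" using T1(3) by (auto simp: T_def)
  have inT1: "inv_into U \<phi> y \<in> U" "inv_into U \<phi> y \<in> V" "\<phi> (inv_into U \<phi> y) = y" if "y \<in> T1" for y
    using that T1(3) C(6,7) by (auto simp: T_def)
  define V1 where "V1 = U \<inter> \<phi> -` T1"
  have oV1: "open V1" unfolding V1_def by (rule continuous_open_preimage[OF C(3,1) T1(1)])
  have V1: "z \<in> U" "z \<in> V" "\<phi> z \<in> T1" if "z \<in> V1" for z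
    using that inT1(2)[of "\<phi> z"] C(6)[of z] by (auto simp: V1_def)
  \<comment> \<open>The fields \<open>F _ v\<close> commute: they extend to sections of \<open>E\<close>, whose bracket lies in \<open>E\<close>; but its
    image under \<open>P\<close> vanishes, since \<open>P (F y v)\<close> does not depend on \<open>y\<close>.\<close>
  have sym: "dderiv (\<lambda>y. F y w) y (F y v) = dderiv (\<lambda>y. F y v) y (F y w)" if y: "y \<in> T1" for y v w
  proof -
    define z where "z = inv_into U \<phi> y"
    have z: "z \<in> V1" "z \<in> U" "z \<in> V" "\<phi> z = y" using inT1[OF y] y by (auto simp: z_def V1_def)
    have "\<exists>Z O'. vector_field A Z \<and> (\<forall>x. Z x \<in> E x) \<and> open O' \<and> z \<in> O' \<and> O' \<subseteq> V1 \<and>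
        (\<forall>x\<in>O'. Z x = chart_vec A U \<phi> x (F (\<phi> x) v))" for v
    proof -
      let ?Z = "\<lambda>x. chart_vec A U \<phi> x (F (\<phi> x) v)"
      have fZ: "field_along A A (\<lambda>x. x) V1 ?Z"
      proof (rule field_alongI[OF A A id oV1])
        show "?Z x \<in> tangent_space A x" if "x \<in> V1" for x
          by (rule chart_vec_in_tangent_space[OF d(1) V1(1)[OF that]])
        have "smooth_on (\<lambda>y. coords \<phi> (?Z (inv_into U \<phi> y))) T1"
          by (rule smooth_on_cong[OF T1(1) _ F(2)[of v]])
            (use coords_chart_vec[OF A d(1) inT1(1)] inT1(3) in simp)
        then show "\<exists>U \<phi>' U' \<psi> T. (U, \<phi>') \<in> A \<and> x \<in> U \<and> (U', \<psi>) \<in> A \<and> x \<in> U' \<and>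
            open T \<and> \<phi>' x \<in> T \<and> smooth_on (\<lambda>y. coords \<psi> (?Z (inv_into U \<phi>' y))) T" if "x \<in> V1" for x
          using d(1) V1[OF that] T1(1) by blast
      qed
      obtain Z k' O' where Z: "field_along A A (\<lambda>x. x) UNIV Z" "open O'" "z \<in> O'" "O' \<subseteq> V1"
        "\<And>x. x \<in> O' \<Longrightarrow> Z x = ?Z x" "\<And>x. x \<in> V1 \<Longrightarrow> Z x = k' x *\<^sub>R ?Z x" "\<And>x. x \<notin> V1 \<Longrightarrow> Z x = 0"
        by (rule extend_field[OF A A id oV1 z(1) fZ]) blast
      have "Z x \<in> E x" for x
      proof (cases "x \<in> V1")
        case True
        then show ?thesis
          using Z(6)[OF True] subspace_scale[OF fib(1)] E_chart[OF V1(1,2)[OF True] FE[OF V1(3)[OF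
              True]]] by simp
      next
        case False
        then show ?thesis using Z(7) subspace_0[OF fib(1)] by simp
      qed
      then show ?thesis using Z(1-5) unfolding vector_field_def by blast
    qed
    then obtain Z O' where Z: "\<And>v. vector_field A (Z v)" "\<And>v x. Z v x \<in> E x" "\<And>v. open (O' v)"
      "\<And>v. z \<in> O' v" "\<And>v. O' v \<subseteq> V1" "\<And>v x. x \<in> O' v \<Longrightarrow> Z v x = chart_vec A U \<phi> x (F (\<phi> x) v)"
      by metis
    have cZ: "coords \<phi> (Z v (inv_into U \<phi> y')) = F y' v" if "y' \<in> \<phi> ` (U \<inter> O' v)" for v y'
    proof -
      from that obtain x where x: "x \<in> U" "x \<in> O' v" "y' = \<phi> x" by blast
      then show ?thesis using Z(6)[OF x(2)] coords_chart_vec[OF A d(1) x(1)] C(6)[OF x(1)] by simp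
    qed
    have oO: "open (\<phi> ` (U \<inter> O' v))" "y \<in> \<phi> ` (U \<inter> O' v)" for v
      using open_chart_image[OF A d(1) Z(3)] z Z(4) by auto
    define e where "e = dderiv (\<lambda>y. F y w) y (F y v) - dderiv (\<lambda>y. F y v) y (F y w)"
    have "lie_bracket A (Z v) (Z w) z = chart_vec A U \<phi> z e"
    proof -
      have "dderiv (\<lambda>y. coords \<phi> (Z v (inv_into U \<phi> y))) y = dderiv (\<lambda>y. F y v) y" for v
        by (rule dderiv_cong[OF oO(1,2) cZ])
      then show ?thesis
        by (simp add: lie_bracket_chart[OF A Z(1) Z(1) d(1) z(2)] z(4) cZ[OF oO(2)] e_def)
    qed
    moreover have "lie_bracket A (Z v) (Z w) z \<in> E z" by (rule invol[OF Z(1,2) Z(1,2)])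
    ultimately have "e \<in> coords \<phi> ` E z"
      using coords_chart_vec[OF A d(1) z(2), of e] by (metis imageI)
    then have e: "e \<in> span ((\<lambda>j. X j y) ` {..<k})" using E_coords[OF z(2,3)] z(4) by simp
    have "P (dderiv (\<lambda>y. F y v) y h) = 0" for v h
    proof -
      have "((\<lambda>y. P (F y v)) has_derivative (\<lambda>h. P (dderiv (\<lambda>y. F y v) y h))) (at y)"
        by (intro bounded_linear.has_derivative[OF bP] dderiv_works smooth_on_differentiable[OF
            F(2) y])
      moreover have "((\<lambda>y. P (F y v)) has_derivative (\<lambda>h. 0)) (at y)"
        by (rule has_derivative_transform_within_open[OF has_derivative_const[of "P v"] T1(1) y])
            (simp add: PF)
      ultimately show ?thesis using has_derivative_unique by (metis (no_types, lifting))
    qed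
    then have "P e = 0" using P(1) by (simp add: e_def linear_diff)
    from P0[OF y e this] show ?thesis by (simp add: e_def)
  qed
  obtain \<rho> c where \<rho>: "\<rho> > 0" and c0: "c 0 = \<phi> x0" and cT: "c ` ball 0 \<rho> \<subseteq> T1"
    and dc: "\<And>s. s \<in> ball 0 \<rho> \<Longrightarrow> (c has_derivative F (c s)) (at s)" and sc: "smooth_on c (ball 0 \<rho>)"
    by (rule total_differential_equation[OF T1(1,2) F sym]) (assumption | (rule that; simp))+
  define \<gamma> where "\<gamma> = (\<lambda>s. inv_into U \<phi> (c s))"
  define K where "K = range P"
  have K: "subspace K" unfolding K_def by (intro linear_subspace_image P subspace_UNIV)
  have PK: "P s = s" if "s \<in> K" for s using that P(2) by (auto simp: K_def)
  have \<gamma>U: "\<gamma> s \<in> U" "\<gamma> s \<in> V" "\<phi> (\<gamma> s) = c s" "c s \<in> T1" if "s \<in> ball 0 \<rho>" for s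
  proof -
    show "c s \<in> T1" using cT that by blast
    from inT1[OF this] show "\<gamma> s \<in> U" "\<gamma> s \<in> V" "\<phi> (\<gamma> s) = c s" by (auto simp: \<gamma>_def)
  qed
  have cont: "continuous_on (ball 0 \<rho>) \<gamma>" unfolding \<gamma>_def
    by (rule continuous_on_compose2[OF C(4) smooth_on_continuous_on[OF sc]]) (use cT T1U in blast)
  have vel: "velocity A \<gamma> s w = chart_vec A U \<phi> (\<gamma> s) (F (c s) w)" if s: "s \<in> ball 0 \<rho>" for s w
  proof (rule velocity_in_chart[OF A d(1) _ open_ball s])
    show "((\<lambda>s. \<phi> (\<gamma> s)) has_derivative F (c s)) (at s)"
      by (rule has_derivative_transform_within_open[OF dc[OF s] open_ball s]) (simp add: \<gamma>U)
  qed (use \<gamma>U s in auto)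
  have smooth: "smooth_map euclidean_atlas A (ball 0 \<rho>) \<gamma>"
    unfolding smooth_map_def
  proof (intro conjI cont, clarify)
    fix W :: "'d set" and \<theta> U' \<psi>
    assume w: "(W, \<theta>) \<in> euclidean_atlas" and d': "(U', \<psi>) \<in> A"
    have W: "W = UNIV" "\<theta> = (\<lambda>x. x)" using w by (auto simp: euclidean_atlas_def)
    have inv_id: "inv_into UNIV (\<lambda>x. x) y = y" for y :: 'd by (simp add: inv_into_def)
    have o1: "open (ball 0 \<rho> \<inter> \<gamma> -` U')"
      using continuous_open_preimage[OF cont open_ball atlas_chart(1)[OF A d']] .
    have "smooth_on (\<lambda>s. \<psi> (inv_into U \<phi> (c s))) (ball 0 \<rho> \<inter> \<gamma> -` U')"
    proof (rule smooth_on_compose[OF o1 open_chart_image[OF A d(1) atlas_chart(1)[OF A d']] _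
          transition_smooth[OF A d(1) d'] smooth_on_subset[OF sc]])
      show "c ` (ball 0 \<rho> \<inter> \<gamma> -` U') \<subseteq> \<phi> ` (U \<inter> U')" 
      proof (rule image_subsetI)
        fix s assume "s \<in> ball 0 \<rho> \<inter> \<gamma> -` U'"
        then show "c s \<in> \<phi> ` (U \<inter> U')" using imageI[of "\<gamma> s" "U \<inter> U'" \<phi>] \<gamma>U by simp
      qed
    qed auto
    then show "smooth_on (\<lambda>y. \<psi> (\<gamma> (inv_into W \<theta> y))) (\<theta> ` (W \<inter> ball 0 \<rho> \<inter> \<gamma> -` U'))"
      by (simp add: W inv_id \<gamma>_def)
  qed
  have inj: "inj_on \<gamma> (ball 0 \<rho> \<inter> K)"
  proof (rule inj_onI)
    \<comment> \<open>On \<open>K\<close>, the map \<open>P \<circ> c\<close> is a translation.\<close>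
    have "\<exists>a. \<forall>s\<in>ball 0 \<rho>. P (c s) - P s = a"
    proof (rule has_derivative_zero_constant[OF convex_ball])
      fix s :: 'd assume s: "s \<in> ball 0 \<rho>"
      have "((\<lambda>s. P (c s) - P s) has_derivative (\<lambda>h. P (F (c s) h) - P h)) (at s)"
        by (intro has_derivative_diff bounded_linear.has_derivative[OF bP dc[OF s]]
          bounded_linear_imp_has_derivative bP)
      then show "((\<lambda>s. P (c s) - P s) has_derivative (\<lambda>h. 0)) (at s within ball 0 \<rho>)"
        using PF[OF \<gamma>U(4)[OF s]] by (simp add: has_derivative_at_withinI)
    qed
    then obtain a where a: "\<And>s. s \<in> ball 0 \<rho> \<Longrightarrow> P (c s) - P s = a" by blast
    fix s t assume s: "s \<in> ball 0 \<rho> \<inter> K" and t: "t \<in> ball 0 \<rho> \<inter> K" and "\<gamma> s = \<gamma> t"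
    then have "c s = c t" using \<gamma>U(3) by (metis IntE)
    then have "P (c t) - s = P (c t) - t" using a[of s] a[of t] PK s t by simp
    then show "s = t" by simp
  qed
  have iv: "inj_on (velocity A \<gamma> s) K \<and> velocity A \<gamma> s ` K = E (\<gamma> s)" if s: "s \<in> ball 0 \<rho>" for s
  proof
    note g = \<gamma>U[OF s]
    show "inj_on (velocity A \<gamma> s) K"
    proof (rule inj_onI)
      fix v w assume vw: "v \<in> K" "w \<in> K" "velocity A \<gamma> s v = velocity A \<gamma> s w"
      then have "F (c s) v = F (c s) w" using coords_chart_vec[OF A d(1) g(1)] vel[OF s] by metis
      then show "v = w" using PF[OF g(4)] PK vw by metis
    qed
    show "velocity A \<gamma> s ` K = E (\<gamma> s)"
    proof
      show "velocity A \<gamma> s ` K \<subseteq> E (\<gamma> s)"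
        using E_chart[OF g(1,2)] FE[OF g(4)] g(3) by (auto simp: vel[OF s])
      show "E (\<gamma> s) \<subseteq> velocity A \<gamma> s ` K"
      proof
        fix v assume v: "v \<in> E (\<gamma> s)"
        define e where "e = coords \<phi> v"
        have e: "e \<in> span ((\<lambda>j. X j (c s)) ` {..<k})"
          using v E_coords[OF g(1,2)] g(3) by (auto simp: e_def)
        have "F (c s) (P e) - e = 0"
          by (rule P0[OF g(4) span_diff[OF FE[OF g(4)] e]]) (use PF[OF g(4)] P in \<open>simp add:
              linear_diff\<close>)
        then have "velocity A \<gamma> s (P e) = v"
          using vel[OF s] tangent_vector_chart[OF A d(1) g(1)] fib(2) v by (auto simp: e_def)
        then show "v \<in> velocity A \<gamma> s ` K" by (auto simp: K_def)
      qed
    qed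
  qed
  have "\<gamma> 0 = x0" using c0 C(6)[OF d(2)] by (simp add: \<gamma>_def)
  then show "\<exists>(K :: 'd set) Q c. subspace K \<and> open Q \<and> 0 \<in> Q \<and> smooth_map euclidean_atlas A Q c \<and>
      c 0 = x0 \<and>
      inj_on c (Q \<inter> K) \<and> (\<forall>y\<in>Q \<inter> K. inj_on (velocity A c y) K \<and> velocity A c y ` K = E (c y))"
    using K \<rho> smooth inj iv
    by (intro exI[of _ K] exI[of _ "ball 0 \<rho>"] exI[of _ \<gamma>]) auto
qed

theorem Frobenius:
  fixes A :: "('n::{t2_space,second_countable_topology}, 'd::euclidean_space) chart set"
  assumes "smooth_atlas A" "subbundle_along A A (\<lambda>x. x) k E"
  shows "integrable_distribution A E \<longleftrightarrow>
    (\<forall>X Y. vector_field A X \<longrightarrow> (\<forall>x. X x \<in> E x) \<longrightarrow> vector_field A Y \<longrightarrow> (\<forall>x. Y x \<in> E x) \<longrightarrow>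
      (\<forall>x. lie_bracket A X Y x \<in> E x))"
  using integrable_imp_involutive[OF assms(1)] involutive_imp_integrable[OF assms] by blast

section \<open>Connections along an immersion\<close>

subsection \<open>The distribution on the submanifold\<close>

lemma inj_differential:
  assumes A: "smooth_atlas A" and B: "smooth_atlas B" and F: "smooth_map A B UNIV F"
    and c: "(U, \<phi>) \<in> A" "x \<in> U" and d: "(U', \<psi>) \<in> B" "F x \<in> U'"
    and inj: "inj_on (push B F x) (tangent_space A x)"
  shows "inj (dderiv (\<lambda>y. \<psi> (F (inv_into U \<phi> y))) (\<phi> x))"
proof (rule injI)
  fix v w
  assume "dderiv (\<lambda>y. \<psi> (F (inv_into U \<phi> y))) (\<phi> x) v = dderiv (\<lambda>y. \<psi> (F (inv_into U \<phi> y))) (\<phi> x) w"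
  then have "push B F x (chart_vec A U \<phi> x v) = push B F x (chart_vec A U \<phi> x w)"
    by (simp add: push_chart_vec[OF A B F c d])
  then have "chart_vec A U \<phi> x v = chart_vec A U \<phi> x w"
    using inj chart_vec_in_tangent_space[OF c] by (simp add: inj_on_eq_iff)
  then show "v = w" using coords_chart_vec[OF A c] by metis
qed

lemma independent_of_image:
  fixes f :: "'v::real_vector \<Rightarrow> 'w::real_vector"
  assumes f: "linear f" and "finite S" "inj_on f S" and ind: "independent (f ` S)"
  shows "independent S"
proof (rule independent_if_scalars_zero[OF assms(2)])
  fix c x assume 0: "(\<Sum>x\<in>S. c x *\<^sub>R x) = 0" and x: "x \<in> S"
  have "(\<Sum>y\<in>f ` S. c (inv_into S f y) *\<^sub>R y) = (\<Sum>x\<in>S. c x *\<^sub>R f x)"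
    by (subst sum.reindex[OF assms(3)]) (simp add: assms(3))
  also have "\<dots> = f (\<Sum>x\<in>S. c x *\<^sub>R x)" by (simp add: linear_sum[OF f] linear_scale[OF f])
  also have "\<dots> = 0" by (simp only: 0 linear_0[OF f])
  finally have "c (inv_into S f (f x)) = 0"
    by (intro independentD[OF ind _ subset_refl, of "\<lambda>y. c (inv_into S f y)"]) (use assms(2) x in
        auto)
  then show "c x = 0" using assms(3) x by simp
qed

text \<open>A smooth frame of \<open>E\<close> along the immersion is the image of a frame of vector fields on the
  submanifold. The components of the latter solve a system of linear equations whose
  coefficients are those of the differential, so they are smooth.\<close>

lemma subbundle_pullback:
  assumes A: "smooth_atlas A" and B: "smooth_atlas B" and F: "smooth_map A B UNIV F"
    and inj: "\<And>x. inj_on (push B F x) (tangent_space A x)"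
    and E: "subbundle_along A B F k E" and sub: "\<And>x. E x \<subseteq> tangent_along A B F x"
  shows "subbundle_along A A (\<lambda>x. x) k (intrinsic_distribution A B F E)"
  unfolding subbundle_along_def
proof
  fix x
  obtain V \<epsilon> where V: "open V" "x \<in> V" and fr: "frame_on A B F V k E \<epsilon>"
    using E[unfolded subbundle_along_def, rule_format, of x] by blast
  define e where "e = (\<lambda>j z. inv_into (tangent_space A z) (push B F z) (\<epsilon> j z))"
  have e: "e j z \<in> tangent_space A z" "push B F z (e j z) = \<epsilon> j z" if "j < k" "z \<in> V" for j z
  proof -
    have "\<epsilon> j z \<in> span ((\<lambda>j. \<epsilon> j z) ` {..<k})" using that by (intro span_base) auto
    then have "\<epsilon> j z \<in> push B F z ` tangent_space A z"
      using fr that sub[of z] by (auto simp: frame_on_def tangent_along_def)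
    then show "e j z \<in> tangent_space A z" "push B F z (e j z) = \<epsilon> j z"
      unfolding e_def by (rule inv_into_into, rule f_inv_into_f)
  qed
  have "field_along A A (\<lambda>x. x) V (e j)" if j: "j < k" for j
  proof (rule field_alongI[OF A A smooth_map_ident[OF A] V(1)])
    show "e j z \<in> tangent_space A z" if "z \<in> V" for z using e(1)[OF j that] .
    fix z assume z: "z \<in> V"
    obtain U \<phi> where c: "(U, \<phi>) \<in> A" "z \<in> U" using atlas_covers[OF A] by blast
    obtain U' \<psi> where d: "(U', \<psi>) \<in> B" "F z \<in> U'" using atlas_covers[OF B] by blast
    note C = atlas_chart[OF A c(1)] and D = atlas_chart[OF B d(1)]
    let ?T = "\<phi> ` (U \<inter> (V \<inter> F -` U'))" and ?m = "\<lambda>y. \<psi> (F (inv_into U \<phi> y))"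
    have oT: "open ?T" using V(1) smooth_map_open_vimage[OF F D(1)]
      by (intro open_chart_image[OF A c(1)]) auto
    have m: "smooth_on ?m ?T" by (rule smooth_on_subset[OF smooth_map_chartD[OF F c(1) d(1)]]) auto
    have "smooth_on (\<lambda>y. coords \<phi> (e j (inv_into U \<phi> y))) ?T"
    proof (rule smooth_on_solution[where M = "dderiv ?m", OF oT])
      show "linear (dderiv ?m y)" if "y \<in> ?T" for y
        by (intro linear_dderiv smooth_on_differentiable[OF m that])
      show "inj (dderiv ?m y)" if "y \<in> ?T" for y
        using that inj_differential[OF A B F c(1) _ d(1) _ inj] by auto
      show "smooth_on (\<lambda>y. dderiv ?m y b) ?T" for b by (rule smooth_on_dderiv[OF m])
      have "field_along A B F V (\<epsilon> j)" using fr j by (simp add: frame_on_def)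
      from smooth_on_field_coords[OF A B F V(1) this c(1) d(1)]
      show "smooth_on (\<lambda>y. dderiv ?m y (coords \<phi> (e j (inv_into U \<phi> y)))) ?T"
      proof (rule smooth_on_cong[OF oT, rotated])
        fix y assume "y \<in> ?T"
        then obtain u where u: "u \<in> U" "u \<in> V" "F u \<in> U'" "y = \<phi> u" by blast
        show "coords \<psi> (\<epsilon> j (inv_into U \<phi> y)) = dderiv ?m y (coords \<phi> (e j (inv_into U \<phi> y)))"
          using coords_push[OF A B F c(1) u(1) d(1) u(3) e(1)[OF j u(2)]] e(2)[OF j u(2)]
          by (simp add: u(4) C(6)[OF u(1)])
      qed
    qed
    then show "\<exists>U \<phi> U' \<psi> T. (U, \<phi>) \<in> A \<and> z \<in> U \<and> (U', \<psi>) \<in> A \<and> z \<in> U' \<and>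
        open T \<and> \<phi> z \<in> T \<and> smooth_on (\<lambda>y. coords \<psi> (e j (inv_into U \<phi> y))) T"
      using c d z oT by (intro exI[of _ U] exI[of _ \<phi>] exI[of _ U] exI[of _ \<phi>] exI[of _ ?T]) auto
  qed
  moreover have "inj_on (\<lambda>j. e j z) {..<k} \<and> independent ((\<lambda>j. e j z) ` {..<k}) \<and>
      span ((\<lambda>j. e j z) ` {..<k}) = intrinsic_distribution A B F E z" if z: "z \<in> V" for z
  proof (intro conjI)
    have f: "inj_on (\<lambda>j. \<epsilon> j z) {..<k}" "independent ((\<lambda>j. \<epsilon> j z) ` {..<k})"
      "span ((\<lambda>j. \<epsilon> j z) ` {..<k}) = E z" using fr z by (auto simp: frame_on_def)
    have im: "push B F z ` (\<lambda>j. e j z) ` {..<k} = (\<lambda>j. \<epsilon> j z) ` {..<k}"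
      unfolding image_image using e(2)[OF _ z] by (intro image_cong) auto
    have spT: "span ((\<lambda>j. e j z) ` {..<k}) \<subseteq> tangent_space A z"
      using e(1)[OF _ z] by (intro span_minimal subspace_tangent_space[OF A]) auto
    have sp: "push B F z ` span ((\<lambda>j. e j z) ` {..<k}) = E z"
      using linear_span_image[OF linear_push, of B F z "(\<lambda>j. e j z) ` {..<k}"] im f(3) by simp
    show "inj_on (\<lambda>j. e j z) {..<k}"
    proof (rule inj_onI)
      fix j l assume jl: "j \<in> {..<k}" "l \<in> {..<k}" "e j z = e l z"
      then have "\<epsilon> j z = \<epsilon> l z" using e(2)[OF _ z, of j] e(2)[OF _ z, of l] by simp
      then show "j = l" using inj_onD[OF f(1)] jl(1,2) by blast
    qed
    have "inj_on (push B F z) ((\<lambda>j. e j z) ` {..<k})"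
      by (rule inj_on_subset[OF inj]) (use e(1)[OF _ z] in auto)
    moreover have "independent (push B F z ` (\<lambda>j. e j z) ` {..<k})" unfolding im by (rule f(2))
    ultimately show "independent ((\<lambda>j. e j z) ` {..<k})"
      by (intro independent_of_image[OF linear_push, of _ B F z] finite_imageI finite_lessThan)
    show "span ((\<lambda>j. e j z) ` {..<k}) = intrinsic_distribution A B F E z"
    proof
      show "span ((\<lambda>j. e j z) ` {..<k}) \<subseteq> intrinsic_distribution A B F E z"
        using sp spT by (auto simp: intrinsic_distribution_def)
      show "intrinsic_distribution A B F E z \<subseteq> span ((\<lambda>j. e j z) ` {..<k})"
      proof
        fix v assume v: "v \<in> intrinsic_distribution A B F E z"
        then have "push B F z v \<in> push B F z ` span ((\<lambda>j. e j z) ` {..<k})"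
          unfolding sp by (simp add: intrinsic_distribution_def)
        then show "v \<in> span ((\<lambda>j. e j z) ` {..<k})"
          using inj_onD[OF inj[of z]] v spT by (auto simp: intrinsic_distribution_def)
      qed
    qed
  qed
  ultimately show "\<exists>V e. open V \<and> x \<in> V \<and>
      frame_on A A (\<lambda>x. x) V k (intrinsic_distribution A B F E) e"
    using V unfolding frame_on_def by blast
qed

subsection \<open>Expansion of fields in coordinate fields\<close>

lemma field_along_local:
  assumes A: "smooth_atlas A" and F: "smooth_map A B UNIV F" and V: "open V"
    and loc: "\<And>x. x \<in> V \<Longrightarrow> \<exists>O'. open O' \<and> x \<in> O' \<and> field_along A B F O' Z"
  shows "field_along A B F V Z"
  unfolding field_along_def
proof (intro conjI ballI allI impI)
  show "Z x \<in> tangent_space B (F x)" if "x \<in> V" for x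
    using loc[OF that] field_alongD(1) by blast
  fix Q f assume Q: "open Q" "smooth_fun B Q f"
  show "smooth_fun A (V \<inter> F -` Q) (\<lambda>x. Z x f)"
  proof (rule smooth_fun_local[OF A])
    show "open (V \<inter> F -` Q)" using V smooth_map_open_vimage[OF F Q(1)] by auto
    fix x assume x: "x \<in> V \<inter> F -` Q"
    then obtain O' where O': "open O'" "x \<in> O'" "field_along A B F O' Z" using loc by blast
    then show "\<exists>R. open R \<and> x \<in> R \<and> smooth_fun A R (\<lambda>x. Z x f)"
      using field_alongD(2)[OF O'(3) Q] x smooth_map_open_vimage[OF F Q(1)]
      by (intro exI[of _ "O' \<inter> F -` Q"]) auto
  qed
qed

lemma exists_coordinate_fields:
  fixes B :: "('m::{t2_space,second_countable_topology}, 'e::euclidean_space) chart set"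
  assumes B: "smooth_atlas B" and d: "(U, \<psi>) \<in> B" "y \<in> U"
  obtains E O' where "\<And>b. vector_field B (E b)" "open O'" "y \<in> O'" "O' \<subseteq> U"
    "\<And>b z. b \<in> Basis \<Longrightarrow> z \<in> O' \<Longrightarrow> E b z = chart_vec B U \<psi> z b"
proof -
  note D = atlas_chart[OF B d(1)] and id = smooth_map_ident[OF B]
  have "\<exists>Z O'. vector_field B Z \<and> open O' \<and> y \<in> O' \<and> O' \<subseteq> U \<and> (\<forall>z\<in>O'. Z z = chart_vec B U \<psi> z b)"
      for b
  proof -
    let ?Z = "\<lambda>z. chart_vec B U \<psi> z b"
    have fZ: "field_along B B (\<lambda>x. x) U ?Z"
    proof (rule field_alongI[OF B B id D(1)])
      show "?Z x \<in> tangent_space B x" if "x \<in> U" for x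
        by (rule chart_vec_in_tangent_space[OF d(1) that])
      have "smooth_on (\<lambda>y. coords \<psi> (?Z (inv_into U \<psi> y))) (\<psi> ` U)"
        by (rule smooth_on_cong[OF D(2) _ smooth_on_const[of b]])
          (use coords_chart_vec[OF B d(1) D(8)] D(7) in simp)
      then show "\<exists>U \<phi>' U' \<theta> T. (U, \<phi>') \<in> B \<and> x \<in> U \<and> (U', \<theta>) \<in> B \<and> x \<in> U' \<and>
          open T \<and> \<phi>' x \<in> T \<and> smooth_on (\<lambda>y. coords \<theta> (?Z (inv_into U \<phi>' y))) T" if "x \<in> U" for x
        using d(1) that D(2) by blast
    qed
    obtain Z k' O' where "field_along B B (\<lambda>x. x) UNIV Z" "open O'" "y \<in> O'" "O' \<subseteq> U"
      "\<And>x. x \<in> O' \<Longrightarrow> Z x = ?Z x"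
      by (rule extend_field[OF B B id D(1) d(2) fZ]) blast
    then show ?thesis unfolding vector_field_def by blast
  qed
  then obtain E O' where E: "\<And>b. vector_field B (E b)" "\<And>b. open (O' b)" "\<And>b. y \<in> O' b"
    "\<And>b. O' b \<subseteq> U" "\<And>b z. z \<in> O' b \<Longrightarrow> E b z = chart_vec B U \<psi> z b" by metis
  show ?thesis
  proof (rule that[OF E(1)])
    show "open (U \<inter> (\<Inter>b\<in>Basis. O' b))" using E(2) D(1) by (intro open_Int open_INT) auto
    show "E b z = chart_vec B U \<psi> z b" if "b \<in> Basis" "z \<in> U \<inter> (\<Inter>b\<in>Basis. O' b)" for b z
      using that E(5)[of z b] by auto
  qed (use E d(2) in auto)
qed

lemma field_expansion:
  fixes A :: "('n::{t2_space,second_countable_topology}, 'd::euclidean_space) chart set"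
    and B :: "('m::{t2_space,second_countable_topology}, 'e::euclidean_space) chart set"
  assumes A: "smooth_atlas A" and B: "smooth_atlas B" and F: "smooth_map A B UNIV F"
    and d: "(U, \<psi>) \<in> B" and O': "open O'" "F x \<in> O'" "O' \<subseteq> U"
    and E: "\<And>b z. b \<in> Basis \<Longrightarrow> z \<in> O' \<Longrightarrow> E b z = chart_vec B U \<psi> z b"
    and Z: "field_along A B F UNIV Z"
  obtains \<zeta> R where "\<And>b. smooth_fun A UNIV (\<zeta> b)" "open R" "x \<in> R"
    "\<And>b z. b \<in> Basis \<Longrightarrow> z \<in> R \<Longrightarrow> \<zeta> b z = Z z (\<lambda>u. \<psi> u \<bullet> b)"
    "\<And>z. z \<in> R \<Longrightarrow> Z z = (\<Sum>b\<in>Basis. \<zeta> b z *\<^sub>R E b (F z))"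
proof -
  note D = atlas_chart[OF B d]
  have oU: "open (F -` U)" "x \<in> F -` U" using smooth_map_open_vimage[OF F D(1)] O' by auto
  have "\<exists>f R. smooth_fun A UNIV f \<and> open R \<and> x \<in> R \<and> (\<forall>z\<in>R. f z = Z z (\<lambda>u. \<psi> u \<bullet> b))" for b
  proof -
    have "smooth_fun A (F -` U) (\<lambda>z. Z z (\<lambda>u. \<psi> u \<bullet> b))"
      using field_alongD(2)[OF Z D(1) smooth_fun_coordinate[OF B d]] by simp
    then show ?thesis by (rule extend_function[OF A oU]) blast
  qed
  then obtain \<zeta> R where \<zeta>: "\<And>b. smooth_fun A UNIV (\<zeta> b)" "\<And>b. open (R b)" "\<And>b. x \<in> R b"
    "\<And>b z. z \<in> R b \<Longrightarrow> \<zeta> b z = Z z (\<lambda>u. \<psi> u \<bullet> b)" by metis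
  let ?R = "F -` O' \<inter> (\<Inter>b\<in>Basis. R b)"
  show ?thesis
  proof (rule that[OF \<zeta>(1)])
    show "open ?R" using \<zeta>(2) smooth_map_open_vimage[OF F O'(1)] by (intro open_Int open_INT) auto
    show "x \<in> ?R" using O'(2) \<zeta>(3) by auto
    show c: "\<zeta> b z = Z z (\<lambda>u. \<psi> u \<bullet> b)" if "b \<in> Basis" "z \<in> ?R" for b z using \<zeta>(4) that by auto
    fix z assume z: "z \<in> ?R"
    then have zU: "F z \<in> U" "F z \<in> O'" using O'(3) by auto
    have "Z z = chart_vec B U \<psi> (F z) (coords \<psi> (Z z))"
      using tangent_vector_chart[OF B d zU(1) field_alongD(1)[OF Z UNIV_I]] by simp
    also have "\<dots> = (\<Sum>b\<in>Basis. (coords \<psi> (Z z) \<bullet> b) *\<^sub>R chart_vec B U \<psi> (F z) b)"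
      by (rule linear_euclidean_expand[OF linear_chart_vec[OF B d zU(1)]])
    also have "\<dots> = (\<Sum>b\<in>Basis. \<zeta> b z *\<^sub>R E b (F z))"
    proof (intro sum.cong refl)
      fix b :: 'e assume b: "b \<in> Basis"
      then show "(coords \<psi> (Z z) \<bullet> b) *\<^sub>R chart_vec B U \<psi> (F z) b = \<zeta> b z *\<^sub>R E b (F z)"
        using c[OF b z] E[OF b zU(2)] coords_inner[OF b, of \<psi> "Z z"] by simp
    qed
    finally show "Z z = (\<Sum>b\<in>Basis. \<zeta> b z *\<^sub>R E b (F z))" .
  qed
qed

lemma vector_field_combination:
  assumes B: "smooth_atlas B" and "\<And>b. b \<in> I \<Longrightarrow> vector_field B (E b)"
  shows "vector_field B (\<lambda>z. \<Sum>b\<in>I. c b *\<^sub>R E b z)"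
  using assms(2) unfolding vector_field_def
  by (intro field_along_sum[OF B B smooth_map_ident[OF B] open_UNIV]
      field_along_scaleR[OF B B smooth_map_ident[OF B] open_UNIV] smooth_fun_const)

subsection \<open>The induced connection in coordinate fields\<close>

lemma induced_connectionD:
  assumes "induced_connection_along A B i nabla D"
  shows "vector_field A W \<Longrightarrow> field_along A B i UNIV Z \<Longrightarrow> field_along A B i UNIV (D W Z)"
    "vector_field A W \<Longrightarrow> field_along A B i UNIV Z \<Longrightarrow> field_along A B i UNIV Z' \<Longrightarrow>
      D W (\<lambda>z. Z z + Z' z) x = D W Z x + D W Z' x"
    "smooth_fun A UNIV f \<Longrightarrow> vector_field A W \<Longrightarrow> field_along A B i UNIV Z \<Longrightarrow>
      D W (\<lambda>z. f z *\<^sub>R Z z) x = W x f *\<^sub>R Z x + f x *\<^sub>R D W Z x"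
    "vector_field A W \<Longrightarrow> vector_field B X \<Longrightarrow> vector_field B Y \<Longrightarrow>
      X (i x) = push B i x (W x) \<Longrightarrow> D W (\<lambda>z. Y (i z)) x = nabla X Y (i x)"
  using assms unfolding induced_connection_along_def by (blast, blast, blast, blast)

text \<open>The operator \<open>D W\<close> is local, by the Leibniz rule for a cut-off function.\<close>

lemma induced_connection_cong:
  fixes A :: "('n::{t2_space,second_countable_topology}, 'd::euclidean_space) chart set"
  assumes A: "smooth_atlas A" and D: "induced_connection_along A B i nabla D"
    and W: "vector_field A W" and Z: "field_along A B i UNIV Z" "field_along A B i UNIV Z'"
    and R: "open R" "x \<in> R" "\<And>z. z \<in> R \<Longrightarrow> Z z = Z' z"
  shows "D W Z x = D W Z' x"
proof -
  obtain \<beta> C O' where b: "smooth_fun A UNIV \<beta>" "C \<subseteq> R" "\<And>z. z \<notin> C \<Longrightarrow> \<beta> z = 0"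
    "open O'" "x \<in> O'" "\<And>z. z \<in> O' \<Longrightarrow> \<beta> z = 1"
    using exists_cutoff[OF A R(1,2)] by metis
  have "W x \<beta> = W x (\<lambda>z. 1)"
    by (rule tangent_vector_cong[OF A vector_fieldD(1)[OF W] b(4-6)])
  then have W0: "W x \<beta> = 0" using tangent_vector_const[OF A vector_fieldD(1)[OF W]] by simp
  have "(\<lambda>z. \<beta> z *\<^sub>R Z z) = (\<lambda>z. \<beta> z *\<^sub>R Z' z)"
    using b(2,3) R(3) by (metis scaleR_zero_left subsetD)
  then have "D W (\<lambda>z. \<beta> z *\<^sub>R Z z) x = D W (\<lambda>z. \<beta> z *\<^sub>R Z' z) x" by simp
  then show ?thesis
    using induced_connectionD(3)[OF D b(1) W Z(1), of x] induced_connectionD(3)[OF D b(1) W Z(2),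
        of x]
      W0 b(6)[OF b(5)] by simp
qed

text \<open>In terms of fields that are restrictions of ambient ones, the axioms of the induced
  connection determine it.\<close>

lemma induced_connection_expansion:
  fixes A :: "('n::{t2_space,second_countable_topology}, 'd::euclidean_space) chart set"
  assumes A: "smooth_atlas A" and B: "smooth_atlas B" and i: "smooth_map A B UNIV i"
    and D: "induced_connection_along A B i nabla D"
    and W: "vector_field A W" and Z: "field_along A B i UNIV Z" and I: "finite I"
    and \<zeta>: "\<And>b. b \<in> I \<Longrightarrow> smooth_fun A UNIV (\<zeta> b)" and E: "\<And>b. b \<in> I \<Longrightarrow> vector_field B (E b)"
    and R: "open R" "x \<in> R" "\<And>z. z \<in> R \<Longrightarrow> Z z = (\<Sum>b\<in>I. \<zeta> b z *\<^sub>R E b (i z))"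
    and X: "vector_field B X" "X (i x) = push B i x (W x)"
  shows "D W Z x = (\<Sum>b\<in>I. W x (\<zeta> b) *\<^sub>R E b (i x) + \<zeta> b x *\<^sub>R nabla X (E b) (i x))"
proof -
  have fE: "field_along A B i UNIV (\<lambda>z. E b (i z))" if "b \<in> I" for b
    by (rule vector_field_compose[OF A B i E[OF that]])
  have f: "field_along A B i UNIV (\<lambda>z. \<zeta> b z *\<^sub>R E b (i z))" if "b \<in> I" for b
    by (rule field_along_scaleR[OF A B i open_UNIV \<zeta>[OF that] fE[OF that]])
  have "D W (\<lambda>z. \<Sum>b\<in>J. \<zeta> b z *\<^sub>R E b (i z)) x =
      (\<Sum>b\<in>J. W x (\<zeta> b) *\<^sub>R E b (i x) + \<zeta> b x *\<^sub>R nabla X (E b) (i x))" if "finite J" "J \<subseteq> I" for J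
    using that
  proof (induction J rule: finite_induct)
    case empty
    have "D W (\<lambda>z. 0 *\<^sub>R Z z) x = W x (\<lambda>z. 0) *\<^sub>R Z x + 0 *\<^sub>R D W Z x"
      by (rule induced_connectionD(3)[OF D smooth_fun_const W Z])
    then have "D W (\<lambda>z. 0) x = 0" using tangent_vector_const[OF A vector_fieldD(1)[OF W]] by simp
    then show ?case by (simp only: sum.empty)
  next
    case (insert b J)
    have "field_along A B i UNIV (\<lambda>z. \<Sum>b\<in>J. \<zeta> b z *\<^sub>R E b (i z))"
      using insert.prems by (intro field_along_sum[OF A B i open_UNIV] f) auto
    from induced_connectionD(2)[OF D W f[of b] this, of x]
    have 1: "D W (\<lambda>z. \<zeta> b z *\<^sub>R E b (i z) + (\<Sum>b\<in>J. \<zeta> b z *\<^sub>R E b (i z))) x =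
        D W (\<lambda>z. \<zeta> b z *\<^sub>R E b (i z)) x + D W (\<lambda>z. \<Sum>b\<in>J. \<zeta> b z *\<^sub>R E b (i z)) x"
      using insert.prems by blast
    have 2: "D W (\<lambda>z. \<zeta> b z *\<^sub>R E b (i z)) x =
        W x (\<zeta> b) *\<^sub>R E b (i x) + \<zeta> b x *\<^sub>R nabla X (E b) (i x)"
      using insert.prems induced_connectionD(3)[OF D \<zeta>[of b] W fE[of b], of x]
        induced_connectionD(4)[OF D W X(1) E[of b] X(2)] by simp
    have 3: "D W (\<lambda>z. \<Sum>b\<in>J. \<zeta> b z *\<^sub>R E b (i z)) x =
        (\<Sum>b\<in>J. W x (\<zeta> b) *\<^sub>R E b (i x) + \<zeta> b x *\<^sub>R nabla X (E b) (i x))"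
      using insert.IH insert.prems by blast
    show ?case by (simp only: sum.insert[OF insert.hyps] 1 2 3)
  qed
  from this[OF I order_refl] show ?thesis
    using induced_connection_cong[OF A D W Z field_along_sum[OF A B i open_UNIV f] R] by simp
qed

lemma endomorphism_sum:
  assumes B: "smooth_atlas B" and J: "endomorphism_field B J" and "finite I"
    and "\<And>b. b \<in> I \<Longrightarrow> v b \<in> tangent_space B y"
  shows "J y (\<Sum>b\<in>I. c b *\<^sub>R v b) = (\<Sum>b\<in>I. c b *\<^sub>R J y (v b))"
proof -
  note T = subspace_tangent_space[OF B, of y]
  have lin: "J y (a *\<^sub>R u + b *\<^sub>R w) = a *\<^sub>R J y u + b *\<^sub>R J y w"
    if "u \<in> tangent_space B y" "w \<in> tangent_space B y" for a b u w
    using J that unfolding endomorphism_field_def by blast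
  show ?thesis using assms(3,4)
  proof (induction I rule: finite_induct)
    case empty
    have "J y 0 = 0" using lin[OF subspace_0[OF T] subspace_0[OF T], of 0 0] by simp
    then show ?case by (simp only: sum.empty)
  next
    case (insert b I)
    have "(\<Sum>b\<in>I. c b *\<^sub>R v b) \<in> tangent_space B y"
      using insert.prems by (intro subspace_sum[OF T] subspace_scale[OF T]) auto
    then have 1: "J y (c b *\<^sub>R v b + (\<Sum>b\<in>I. c b *\<^sub>R v b)) =
        c b *\<^sub>R J y (v b) + J y (\<Sum>b\<in>I. c b *\<^sub>R v b)"
      using insert.prems lin[of "v b" "\<Sum>b\<in>I. c b *\<^sub>R v b" "c b" 1] by simp
    have 2: "J y (\<Sum>b\<in>I. c b *\<^sub>R v b) = (\<Sum>b\<in>I. c b *\<^sub>R J y (v b))"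
      using insert.IH insert.prems by blast
    show ?case by (simp only: sum.insert[OF insert.hyps] 1 2)
  qed
qed

text \<open>A parallel endomorphism field of the ambient manifold commutes with the induced connection.\<close>

lemma induced_connection_parallel:
  fixes A :: "('n::{t2_space,second_countable_topology}, 'd::euclidean_space) chart set"
    and B :: "('m::{t2_space,second_countable_topology}, 'e::euclidean_space) chart set"
  assumes A: "smooth_atlas A" and B: "smooth_atlas B" and i: "smooth_map A B UNIV i"
    and J: "endomorphism_field B J" and par: "parallel_endomorphism B nabla J"
    and nab: "affine_connection B nabla"
    and D: "induced_connection_along A B i nabla D" and Z: "field_along A B i UNIV Z"
  shows "field_along A B i UNIV (\<lambda>z. J (i z) (Z z))"
    and "vector_field A W \<Longrightarrow> D W (\<lambda>z. J (i z) (Z z)) x = J (i x) (D W Z x)"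
proof -
  have JE: "vector_field B (\<lambda>z. J z (E z))" if "vector_field B E" for E
    using J that unfolding endomorphism_field_def by blast
  have loc: "\<exists>\<zeta> R (E :: 'e \<Rightarrow> 'm \<Rightarrow> 'm tvec). (\<forall>b. smooth_fun A UNIV (\<zeta> b)) \<and>
      (\<forall>b. vector_field B (E b)) \<and> open R \<and> x \<in> R \<and>
      (\<forall>z\<in>R. Z z = (\<Sum>b\<in>Basis. \<zeta> b z *\<^sub>R E b (i z))) \<and>
      (\<forall>z\<in>R. J (i z) (Z z) = (\<Sum>b\<in>Basis. \<zeta> b z *\<^sub>R J (i z) (E b (i z)))) \<and>
      (\<forall>v\<in>tangent_space B (i x). \<exists>X. vector_field B X \<and> X (i x) = v)" for x
  proof -
    obtain U \<psi> where d: "(U, \<psi>) \<in> B" "i x \<in> U" using atlas_covers[OF B] by blast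
    obtain E :: "'e \<Rightarrow> 'm \<Rightarrow> 'm tvec" and O'
        where E: "\<And>b. vector_field B (E b)" "open O'" "i x \<in> O'" "O' \<subseteq> U"
      "\<And>b z. b \<in> Basis \<Longrightarrow> z \<in> O' \<Longrightarrow> E b z = chart_vec B U \<psi> z b"
      using exists_coordinate_fields[OF B d] by metis
    obtain \<zeta> R where \<zeta>: "\<And>b. smooth_fun A UNIV (\<zeta> b)" "open R" "x \<in> R"
      "\<And>z. z \<in> R \<Longrightarrow> Z z = (\<Sum>b\<in>Basis. \<zeta> b z *\<^sub>R E b (i z))"
      by (rule field_expansion[where E = E, OF A B i d(1) E(2-5) Z]) blast+
    have "J (i z) (Z z) = (\<Sum>b\<in>Basis. \<zeta> b z *\<^sub>R J (i z) (E b (i z)))" if "z \<in> R" for z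
      unfolding \<zeta>(4)[OF that] by (rule endomorphism_sum[OF B J finite_Basis vector_fieldD(1)[OF
          E(1)]])
    moreover have "\<exists>X. vector_field B X \<and> X (i x) = v" if v: "v \<in> tangent_space B (i x)" for v
    proof -
      have "(\<Sum>b\<in>Basis. (coords \<psi> v \<bullet> b) *\<^sub>R E b (i x)) = v"
        using linear_euclidean_expand[OF linear_chart_vec[OF B d], of "coords \<psi> v"]
          tangent_vector_chart[OF B d v] E(3,5) by simp
      then show ?thesis
        by (intro exI[of _ "\<lambda>z. \<Sum>b\<in>Basis. (coords \<psi> v \<bullet> b) *\<^sub>R E b z"] conjI
          vector_field_combination[OF B E(1)])
    qed
    ultimately show ?thesis using \<zeta> E(1)
      by (intro exI[of _ \<zeta>] exI[of _ R] exI[of _ E] conjI allI ballI) auto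
  qed
  show fJ: "field_along A B i UNIV (\<lambda>z. J (i z) (Z z))"
  proof (rule field_along_local[OF A i open_UNIV])
    fix x
    obtain \<zeta> R and E :: "'e \<Rightarrow> 'm \<Rightarrow> 'm tvec"
        where R: "\<And>b. smooth_fun A UNIV (\<zeta> b)" "\<And>b. vector_field B (E b)" "open R" "x \<in> R"
      "\<And>z. z \<in> R \<Longrightarrow> J (i z) (Z z) = (\<Sum>b\<in>Basis. \<zeta> b z *\<^sub>R J (i z) (E b (i z)))"
      using loc[of x] by blast
    have "field_along A B i R (\<lambda>z. J (i z) (Z z))"
    proof (rule field_along_cong[OF A i R(3)])
      show "field_along A B i R (\<lambda>z. \<Sum>b\<in>Basis. \<zeta> b z *\<^sub>R J (i z) (E b (i z)))"
        by (intro field_along_sum[OF A B i R(3)] field_along_scaleR[OF A B i R(3)]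
            smooth_fun_subset[OF R(1)] field_along_subset[OF vector_field_compose[OF A B i JE[OF
                R(2)]]]) auto
    qed (simp add: R(5))
    then show "\<exists>R. open R \<and> x \<in> R \<and> field_along A B i R (\<lambda>z. J (i z) (Z z))" using R by blast
  qed
  assume W: "vector_field A W"
  obtain \<zeta> R and E :: "'e \<Rightarrow> 'm \<Rightarrow> 'm tvec"
      where R: "\<And>b. smooth_fun A UNIV (\<zeta> b)" "\<And>b. vector_field B (E b)" "open R" "x \<in> R"
    "\<And>z. z \<in> R \<Longrightarrow> Z z = (\<Sum>b\<in>Basis. \<zeta> b z *\<^sub>R E b (i z))"
    "\<And>z. z \<in> R \<Longrightarrow> J (i z) (Z z) = (\<Sum>b\<in>Basis. \<zeta> b z *\<^sub>R J (i z) (E b (i z)))"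
    "\<forall>v\<in>tangent_space B (i x). \<exists>X. vector_field B X \<and> X (i x) = v"
    using loc[of x] by blast
  obtain X where X: "vector_field B X" "X (i x) = push B i x (W x)"
    using R(7) push_in_tangent_space[OF A B i vector_fieldD(1)[OF W]] by blast
  have nE: "nabla X (E b) (i x) \<in> tangent_space B (i x)" for b
    by (rule vector_fieldD(1)) (use nab[unfolded affine_connection_def, THEN conjunct1] X(1) R(2)
        in blast)
  have "D W (\<lambda>z. J (i z) (Z z)) x =
      (\<Sum>b\<in>Basis. W x (\<zeta> b) *\<^sub>R J (i x) (E b (i x)) + \<zeta> b x *\<^sub>R nabla X (\<lambda>z. J z (E b z)) (i x))"
    by (rule induced_connection_expansion[where E = "\<lambda>b z. J z (E b z)",
          OF A B i D W fJ finite_Basis R(1) JE[OF R(2)] R(3,4,6) X])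
  also have "\<dots> = (\<Sum>b\<in>Basis. W x (\<zeta> b) *\<^sub>R J (i x) (E b (i x))
      + \<zeta> b x *\<^sub>R J (i x) (nabla X (E b) (i x)))"
    using par X(1) R(2) by (simp add: parallel_endomorphism_def)
  also have "\<dots> = J (i x) (\<Sum>b\<in>Basis. W x (\<zeta> b) *\<^sub>R E b (i x))
      + J (i x) (\<Sum>b\<in>Basis. \<zeta> b x *\<^sub>R nabla X (E b) (i x))"
    by (simp add: sum.distrib endomorphism_sum[OF B J finite_Basis vector_fieldD(1)[OF R(2)]]
        endomorphism_sum[OF B J finite_Basis nE])
  also have "\<dots> = J (i x) ((\<Sum>b\<in>Basis. W x (\<zeta> b) *\<^sub>R E b (i x))
      + (\<Sum>b\<in>Basis. \<zeta> b x *\<^sub>R nabla X (E b) (i x)))"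
  proof -
    note T = subspace_tangent_space[OF B, of "i x"]
    have "(\<Sum>b\<in>Basis. W x (\<zeta> b) *\<^sub>R E b (i x)) \<in> tangent_space B (i x)"
      "(\<Sum>b\<in>Basis. \<zeta> b x *\<^sub>R nabla X (E b) (i x)) \<in> tangent_space B (i x)"
      by (intro subspace_sum[OF T] subspace_scale[OF T] vector_fieldD(1)[OF R(2)] nE)+
    then have "J (i x) (1 *\<^sub>R (\<Sum>b\<in>Basis. W x (\<zeta> b) *\<^sub>R E b (i x))
        + 1 *\<^sub>R (\<Sum>b\<in>Basis. \<zeta> b x *\<^sub>R nabla X (E b) (i x))) =
      1 *\<^sub>R J (i x) (\<Sum>b\<in>Basis. W x (\<zeta> b) *\<^sub>R E b (i x)) + 1 *\<^sub>R J (i x) (\<Sum>b\<in>Basis. \<zeta> b x *\<^sub>R nabla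
          X (E b) (i x))"
      using J unfolding endomorphism_field_def by blast
    then show ?thesis by simp
  qed
  also have "\<dots> = J (i x) (D W Z x)"
    using induced_connection_expansion[OF A B i D W Z finite_Basis R(1,2,3,4,5) X]
        by (simp add: sum.distrib)
  finally show "D W (\<lambda>z. J (i z) (Z z)) x = J (i x) (D W Z x)" .
qed

lemma affine_connection_combination:
  assumes B: "smooth_atlas B" and nab: "affine_connection B nabla" and X: "vector_field B X"
    and "finite I" "\<And>b. b \<in> I \<Longrightarrow> vector_field B (E b)"
  shows "nabla X (\<lambda>z. \<Sum>b\<in>I. c b *\<^sub>R E b z) y = (\<Sum>b\<in>I. c b *\<^sub>R nabla X (E b) y)"
proof -
  have add: "nabla X (\<lambda>z. Y z + Y' z) y = nabla X Y y + nabla X Y' y"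
    if "vector_field B Y" "vector_field B Y'" for Y Y'
    using nab X that unfolding affine_connection_def by blast
  have leib: "nabla X (\<lambda>z. a *\<^sub>R Y z) y = X y (\<lambda>z. a) *\<^sub>R Y y + a *\<^sub>R nabla X Y y"
    if "vector_field B Y" for Y a
    using nab X that smooth_fun_const[of B UNIV a] unfolding affine_connection_def by blast
  have X0: "X y (\<lambda>z. a) = 0" for a by (rule tangent_vector_const[OF B vector_fieldD(1)[OF X]])
  have vf: "vector_field B (\<lambda>z. a *\<^sub>R Y z)" if "vector_field B Y" for a Y
    using vector_field_combination[OF B, of "{()}" "\<lambda>_. Y" "\<lambda>_. a"] that by simp
  show ?thesis using assms(4,5)
  proof (induction I rule: finite_induct)
    case empty
    have "nabla X (\<lambda>z. 0) y = 0" using leib[OF X, of 0] X0 by simp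
    then show ?case by (simp only: sum.empty)
  next
    case (insert b I)
    have 1: "nabla X (\<lambda>z. c b *\<^sub>R E b z + (\<Sum>b\<in>I. c b *\<^sub>R E b z)) y =
        nabla X (\<lambda>z. c b *\<^sub>R E b z) y + nabla X (\<lambda>z. \<Sum>b\<in>I. c b *\<^sub>R E b z) y"
      using insert.prems by (intro add vf vector_field_combination[OF B]) auto
    have 2: "nabla X (\<lambda>z. c b *\<^sub>R E b z) y = c b *\<^sub>R nabla X (E b) y"
      using leib[of "E b" "c b"] X0 insert.prems by simp
    have 3: "nabla X (\<lambda>z. \<Sum>b\<in>I. c b *\<^sub>R E b z) y = (\<Sum>b\<in>I. c b *\<^sub>R nabla X (E b) y)"
      using insert.IH insert.prems by blast
    show ?case by (simp only: sum.insert[OF insert.hyps] 1 2 3)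
  qed
qed

text \<open>The induced connection of a torsion-free connection is torsion-free.\<close>

lemma induced_connection_torsion_free:
  fixes A :: "('n::{t2_space,second_countable_topology}, 'd::euclidean_space) chart set"
    and B :: "('m::{t2_space,second_countable_topology}, 'e::euclidean_space) chart set"
  assumes A: "smooth_atlas A" and B: "smooth_atlas B" and i: "smooth_map A B UNIV i"
    and nab: "affine_connection B nabla"
    and tor: "\<And>X Y y. vector_field B X \<Longrightarrow> vector_field B Y \<Longrightarrow>
      nabla X Y y - nabla Y X y = lie_bracket B X Y y"
    and D: "induced_connection_along A B i nabla D"
    and W: "vector_field A W" and U: "vector_field A U"
  shows "D W (\<lambda>z. push B i z (U z)) x - D U (\<lambda>z. push B i z (W z)) x =
      push B i x (lie_bracket A W U x)"
proof -
  obtain V \<psi> where d: "(V, \<psi>) \<in> B" "i x \<in> V" using atlas_covers[OF B] by blast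
  note C = atlas_chart[OF B d(1)]
  obtain E :: "'e \<Rightarrow> 'm \<Rightarrow> 'm tvec" and O'
      where E: "\<And>b. vector_field B (E b)" "open O'" "i x \<in> O'" "O' \<subseteq> V"
    "\<And>b z. b \<in> Basis \<Longrightarrow> z \<in> O' \<Longrightarrow> E b z = chart_vec B V \<psi> z b"
    using exists_coordinate_fields[OF B d] by metis
  define comb where "comb = (\<lambda>w z. \<Sum>b\<in>Basis. (w \<bullet> b) *\<^sub>R E b z)"
  have comb: "comb w z = chart_vec B V \<psi> z w" if "z \<in> O'" for w z
  proof -
    have "comb w z = (\<Sum>b\<in>Basis. (w \<bullet> b) *\<^sub>R chart_vec B V \<psi> z b)"
      unfolding comb_def using E(5) that by (intro sum.cong) auto
    also have "\<dots> = chart_vec B V \<psi> z w"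
      by (rule linear_euclidean_expand[symmetric, OF linear_chart_vec[OF B d(1)]]) (use that E(4)
          in blast)
    finally show ?thesis .
  qed
  have vcomb: "vector_field B (comb w)" for w
    unfolding comb_def by (rule vector_field_combination[OF B E(1)])
  have bracket0: "lie_bracket B (comb v) (comb w) (i x) = 0" for v w
  proof -
    have "dderiv (\<lambda>y. coords \<psi> (comb w (inv_into V \<psi> y))) (\<psi> (i x)) = dderiv (\<lambda>y. w) (\<psi> (i x))"
        for w
    proof (rule dderiv_cong[OF open_chart_image[OF B d(1) E(2)]])
      show "\<psi> (i x) \<in> \<psi> ` (V \<inter> O')" using E(3) d(2) by auto
      fix y assume "y \<in> \<psi> ` (V \<inter> O')"
      then obtain z where "z \<in> V" "z \<in> O'" "y = \<psi> z" by blast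
      then show "coords \<psi> (comb w (inv_into V \<psi> y)) = w"
        using comb[of z w] coords_chart_vec[OF B d(1)] C(6) by simp
    qed
    then show ?thesis
      using linear_0[OF linear_chart_vec[OF B d]]
          by (simp add: lie_bracket_chart[OF B vcomb vcomb d])
  qed
  have nX: "nabla X (comb w) y = (\<Sum>b\<in>Basis. (w \<bullet> b) *\<^sub>R nabla X (E b) y)" if "vector_field B X"
      for X w y
    unfolding comb_def by (rule affine_connection_combination[OF B nab that finite_Basis E(1)])
  have expand: "D W (\<lambda>z. push B i z (U z)) x =
      (\<Sum>b\<in>Basis. W x (\<lambda>z. U z (\<lambda>u. \<psi> (i u) \<bullet> b)) *\<^sub>R E b (i x)) +
      nabla (comb (coords \<psi> (push B i x (W x)))) (comb (coords \<psi> (push B i x (U x)))) (i x)"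
    if W: "vector_field A W" and U: "vector_field A U" for W U
  proof -
    let ?Z = "\<lambda>z. push B i z (U z)" and ?X = "comb (coords \<psi> (push B i x (W x)))"
    have fZ: "field_along A B i UNIV ?Z" by (rule push_vector_field[OF A B i U])
    obtain \<zeta> R where \<zeta>: "\<And>b. smooth_fun A UNIV (\<zeta> b)" "open R" "x \<in> R"
      "\<And>b z. b \<in> Basis \<Longrightarrow> z \<in> R \<Longrightarrow> \<zeta> b z = ?Z z (\<lambda>u. \<psi> u \<bullet> b)"
      "\<And>z. z \<in> R \<Longrightarrow> ?Z z = (\<Sum>b\<in>Basis. \<zeta> b z *\<^sub>R E b (i z))"
      by (rule field_expansion[where E = E, OF A B i d(1) E(2-5) fZ]) blast+
    have X: "?X (i x) = push B i x (W x)"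
      using comb[OF E(3)] tangent_vector_chart[OF B d push_in_tangent_space[OF A B i
          vector_fieldD(1)[OF W]]]
      by simp
    have W\<zeta>: "W x (\<zeta> b) = W x (\<lambda>z. U z (\<lambda>u. \<psi> (i u) \<bullet> b))" if b: "b \<in> Basis" for b
    proof (rule tangent_vector_cong[OF A vector_fieldD(1)[OF W]])
      show "open (R \<inter> i -` V)" "x \<in> R \<inter> i -` V"
        using \<zeta>(2,3) smooth_map_open_vimage[OF i C(1)] d(2) by auto
      show "\<zeta> b z = U z (\<lambda>u. \<psi> (i u) \<bullet> b)" if "z \<in> R \<inter> i -` V" for z
        using that \<zeta>(4)[OF b] smooth_near_coordinate[OF B d(1), of "i z" b] by (simp add: push_def)
    qed
    have "(\<Sum>b\<in>Basis. \<zeta> b x *\<^sub>R nabla ?X (E b) (i x)) = nabla ?X (comb (coords \<psi> (?Z x))) (i x)"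
      unfolding nX[OF vcomb] by (intro sum.cong refl) (simp add: \<zeta>(4)[OF _ \<zeta>(3)] coords_inner)
    then show ?thesis
      using induced_connection_expansion[OF A B i D W fZ finite_Basis \<zeta>(1) E(1) \<zeta>(2,3,5) vcomb X] W\<zeta>
      by (simp add: sum.distrib)
  qed
  let ?c = "\<lambda>b u. \<psi> (i u) \<bullet> b"
  have sn: "smooth_near A x (?c b)" for b
    by (rule smooth_near_compose[OF A B i smooth_near_coordinate[OF B d]])
  let ?wv = "coords \<psi> (push B i x (W x))" and ?uv = "coords \<psi> (push B i x (U x))"
  have "D W (\<lambda>z. push B i z (U z)) x - D U (\<lambda>z. push B i z (W z)) x =
      (\<Sum>b\<in>Basis. (W x (\<lambda>z. U z (?c b)) - U x (\<lambda>z. W z (?c b))) *\<^sub>R E b (i x)) +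
      (nabla (comb ?wv) (comb ?uv) (i x) - nabla (comb ?uv) (comb ?wv) (i x))"
    by (simp add: expand[OF W U] expand[OF U W] scaleR_diff_left sum_subtractf)
  also have "nabla (comb ?wv) (comb ?uv) (i x) - nabla (comb ?uv) (comb ?wv) (i x) = 0"
    using tor[OF vcomb vcomb] bracket0 by simp
  also have "(\<Sum>b\<in>Basis. (W x (\<lambda>z. U z (?c b)) - U x (\<lambda>z. W z (?c b))) *\<^sub>R E b (i x)) =
      comb (coords \<psi> (push B i x (lie_bracket A W U x))) (i x)"
    unfolding comb_def using sn smooth_near_coordinate[OF B d]
    by (intro sum.cong refl) (simp add: coords_inner push_def lie_bracket_def)
  also have "comb (coords \<psi> (push B i x (lie_bracket A W U x))) (i x) =
      push B i x (lie_bracket A W U x)"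
    unfolding comb[OF E(3)]
    by (rule tangent_vector_chart[OF B d push_in_tangent_space[OF A B i
        lie_bracket_in_tangent_space[OF A W U]]])
  finally show ?thesis by (simp only: add_0_right)
qed

section \<open>The screen distribution\<close>

lemma direct_sum_right_subset: "direct_sum E H T \<Longrightarrow> H \<subseteq> T"
proof
  fix v assume s: "direct_sum E H T" and "v \<in> H"
  moreover have "0 \<in> E" using s by (auto simp: direct_sum_def)
  ultimately show "v \<in> T" unfolding direct_sum_def
      by (metis (mono_tags, lifting) add_0 mem_Collect_eq)
qed

text \<open>The dual frames show that \<open>Rad\<close> is paired non-degenerately with \<open>ltr\<close>, by global sections.\<close>

lemma radical_pairing_nondegenerate:
  fixes A :: "('n::{t2_space,second_countable_topology}, 'd::euclidean_space) chart set"
    and B :: "('m::{t2_space,second_countable_topology}, 'e::euclidean_space) chart set"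
  assumes g: "semi_riemannian B g" and ll: "lightlike_submanifold A B i g r"
    and ltr: "lightlike_transversal_bundle A B i g r S Str ltr"
    and v: "v \<in> radical_along A B i g x" "v \<noteq> 0"
  obtains N where "section_of A B i ltr N" "g (i x) v (N x) \<noteq> 0"
proof -
  have A: "smooth_atlas A" and i: "smooth_map A B UNIV i"
    using ll by (auto simp: lightlike_submanifold_def immersed_submanifold_def)
  have B: "smooth_atlas B" using g by (simp add: semi_riemannian_def)
  have lsub: "subbundle_along A B i r ltr" using ltr by (simp add: lightlike_transversal_bundle_def)
  have rad: "subbundle_along A B i r (radical_along A B i g)"
    using ll by (simp add: lightlike_submanifold_def)
  obtain V \<xi> where V: "open V" "x \<in> V" and \<xi>: "frame_on A B i V r (radical_along A B i g) \<xi>"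
    using rad[unfolded subbundle_along_def, rule_format, of x] by blast
  have "\<forall>V \<xi>. open V \<longrightarrow> frame_on A B i V r (radical_along A B i g) \<xi> \<longrightarrow>
      (\<exists>N. frame_on A B i V r ltr N \<and> (\<forall>x\<in>V. \<forall>j<r. \<forall>k<r.
        g (i x) (\<xi> j x) (N k x) = (if j = k then 1 else 0) \<and> g (i x) (N j x) (N k x) = 0))"
    using ltr unfolding lightlike_transversal_bundle_def by (elim conjE)
  from this[rule_format, OF V(1) \<xi>] obtain N where N: "frame_on A B i V r ltr N"
    and dual': "\<forall>x\<in>V. \<forall>j<r. \<forall>k<r.
        g (i x) (\<xi> j x) (N k x) = (if j = k then 1 else 0) \<and> g (i x) (N j x) (N k x) = 0"
    by (elim exE conjE)
  have dual: "g (i z) (\<xi> j z) (N k z) = (if j = k then 1 else 0)" if "z \<in> V" "j < r" "k < r"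
      for z j k
    using dual' that by simp
  have lin: "g (i x) (a *\<^sub>R u + b *\<^sub>R v) w = a * g (i x) u w + b * g (i x) v w"
    if "u \<in> tangent_space B (i x)" "v \<in> tangent_space B (i x)" "w \<in> tangent_space B (i x)"
        for a b u v w
    using g that unfolding semi_riemannian_def by blast
  note T = subspace_tangent_space[OF B, of "i x"]
  have \<xi>T: "\<xi> j x \<in> tangent_space B (i x)" if "j < r" for j
    using \<xi> that V(2) field_alongD(1) unfolding frame_on_def by blast
  have NT: "N j x \<in> tangent_space B (i x)" if "j < r" for j
    using N that V(2) field_alongD(1) unfolding frame_on_def by blast
  have inj: "inj_on (\<lambda>j. \<xi> j x) {..<r}" and sp: "span ((\<lambda>j. \<xi> j x) ` {..<r}) =
      radical_along A B i g x"
    using \<xi> V(2) by (auto simp: frame_on_def)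
  obtain c where "v = (\<Sum>w\<in>(\<lambda>j. \<xi> j x) ` {..<r}. c w *\<^sub>R w)"
    using v(1) unfolding sp[symmetric] by (subst (asm) span_finite) auto
  then have vc: "v = (\<Sum>j<r. c (\<xi> j x) *\<^sub>R \<xi> j x)" by (simp add: sum.reindex[OF inj])
  have gsum: "g (i x) (\<Sum>j\<in>J. c (\<xi> j x) *\<^sub>R \<xi> j x) w = (\<Sum>j\<in>J. c (\<xi> j x) * g (i x) (\<xi> j x) w)"
    if "finite J" "J \<subseteq> {..<r}" "w \<in> tangent_space B (i x)" for J w
    using that
  proof (induction J rule: finite_induct)
    case empty
    have "g (i x) 0 w = 0" using lin[OF subspace_0[OF T] subspace_0[OF T] empty(2), of 0 0] by simp
    then show ?case by (simp only: sum.empty)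
  next
    case (insert j J)
    have "(\<Sum>j\<in>J. c (\<xi> j x) *\<^sub>R \<xi> j x) \<in> tangent_space B (i x)"
      using insert.prems \<xi>T by (intro subspace_sum[OF T] subspace_scale[OF T]) auto
    then have "g (i x) (c (\<xi> j x) *\<^sub>R \<xi> j x + 1 *\<^sub>R (\<Sum>j\<in>J. c (\<xi> j x) *\<^sub>R \<xi> j x)) w =
        c (\<xi> j x) * g (i x) (\<xi> j x) w + 1 * g (i x) (\<Sum>j\<in>J. c (\<xi> j x) *\<^sub>R \<xi> j x) w"
      using insert.prems \<xi>T by (intro lin) auto
    then show ?case using insert by (simp only: sum.insert[OF insert.hyps] scaleR_one) simp
  qed
  have "\<exists>j<r. c (\<xi> j x) \<noteq> 0"
  proof (rule ccontr)
    assume "\<not> (\<exists>j<r. c (\<xi> j x) \<noteq> 0)"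
    then have "v = 0" unfolding vc by (intro sum.neutral) auto
    then show False using v(2) by simp
  qed
  then obtain k where k: "k < r" "c (\<xi> k x) \<noteq> 0" by blast
  have "g (i x) v (N k x) = (\<Sum>j<r. c (\<xi> j x) * g (i x) (\<xi> j x) (N k x))"
    unfolding vc by (rule gsum[OF _ _ NT[OF k(1)]]) auto
  also have "\<dots> = (\<Sum>j<r. if j = k then c (\<xi> j x) else 0)"
    using dual[OF V(2) _ k(1)] by (intro sum.cong) auto
  finally have gk: "g (i x) v (N k x) = c (\<xi> k x)" using k(1) by simp
  have fN: "field_along A B i V (N k)" using N k(1) by (simp add: frame_on_def)
  obtain N' k' O' where N': "field_along A B i UNIV N'" "x \<in> O'" "\<And>z. z \<in> O' \<Longrightarrow> N' z = N k z"
    "\<And>z. z \<in> V \<Longrightarrow> N' z = k' z *\<^sub>R N k z" "\<And>z. z \<notin> V \<Longrightarrow> N' z = 0"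
    by (rule extend_field[OF A B i V fN]) blast
  have "N' z \<in> ltr z" for z
  proof (cases "z \<in> V")
    case True
    then have "span ((\<lambda>j. N j z) ` {..<r}) = ltr z" using N by (auto simp: frame_on_def)
    moreover have "N k z \<in> span ((\<lambda>j. N j z) ` {..<r})" using k(1) by (intro span_base) auto
    ultimately show ?thesis using N'(4)[OF True] subspace_scale[OF subbundle_fibre(1)[OF B lsub]]
        by simp
  next
    case False
    then show ?thesis using N'(5) subspace_0[OF subbundle_fibre(1)[OF B lsub]] by simp
  qed
  then have "section_of A B i ltr N'" using N'(1) by (simp add: section_of_def)
  then show ?thesis using that[of N'] N'(3)[OF N'(2)] gk k(2) by simp
qed

text \<open>The \<open>J ltr\<close>-component of \<open>h\<^sup>s(W, J U) - h\<^sup>s(U, J W)\<close> measures the \<open>Rad\<close>-component \<open>\<rho>\<close> of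
  \<open>[W, U]\<close>: since tangent and \<open>ltr\<close>-parts are orthogonal to \<open>J N\<close>, it is
  \<open>g (J [W, U]) (J N) = p * g (J [W, U]) N + q * g [W, U] N\<close>, and only \<open>q * g \<rho> N\<close> survives.\<close>

lemma screen_bracket_pairing:
  fixes A :: "('n::{t2_space,second_countable_topology}, 'd::euclidean_space) chart set"
    and B :: "('m::{t2_space,second_countable_topology}, 'e::euclidean_space) chart set"
  assumes lm: "locally_metallic p q B g J nabla"
    and ll: "lightlike_submanifold A B i g r"
    and scr: "screen_distribution A B i g S"
    and str: "screen_transversal_bundle A B i g Str"
    and ltr: "lightlike_transversal_bundle A B i g r S Str ltr"
    and rst: "radical_screen_transversal A B i g J S Str"
    and Jltr: "\<And>x. J (i x) ` ltr x \<subseteq> Str x"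
    and D: "induced_connection_along A B i nabla D"
    and gauss: "gauss_formula A B i ltr Str D nablaN hl hs"
    and W: "vector_field A W" "\<And>x. W x \<in> intrinsic_distribution A B i S x"
    and U: "vector_field A U" "\<And>x. U x \<in> intrinsic_distribution A B i S x"
    and N: "n \<in> ltr x"
    and dec: "push B i x (lie_bracket A W U x) = \<rho> + \<sigma>" "\<rho> \<in> radical_along A B i g x" "\<sigma> \<in> S x"
  shows "g (i x) (hs W (\<lambda>z. J (i z) (push B i z (U z))) x - hs U (\<lambda>z. J (i z) (push B i z (W z))) x)
      (J (i x) n) = q * g (i x) \<rho> n"
proof -
  have A: "smooth_atlas A" and i: "smooth_map A B UNIV i"
    using ll by (auto simp: lightlike_submanifold_def immersed_submanifold_def)
  have met: "metallic_semi_riemannian p q B g J" and lc: "levi_civita B g nabla"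
    and par: "parallel_endomorphism B nabla J" using lm by (auto simp: locally_metallic_def)
  have sr: "semi_riemannian B g" and J: "endomorphism_field B J"
    and J2: "\<And>y u. u \<in> tangent_space B y \<Longrightarrow> J y (J y u) = real p *\<^sub>R J y u + real q *\<^sub>R u"
    and gJ: "\<And>y u v. u \<in> tangent_space B y \<Longrightarrow> v \<in> tangent_space B y \<Longrightarrow> g y (J y u) v = g y u (J y v)"
    using met by (auto simp: metallic_semi_riemannian_def)
  have B: "smooth_atlas B" using sr by (simp add: semi_riemannian_def)
  have nab: "affine_connection B nabla"
    and tor: "\<And>X Y y. vector_field B X \<Longrightarrow> vector_field B Y \<Longrightarrow>
      nabla X Y y - nabla Y X y = lie_bracket B X Y y" using lc by (auto simp: levi_civita_def)
  let ?T = "tangent_space B (i x)"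
  note T = subspace_tangent_space[OF B, of "i x"]
  have lin: "g (i x) (a *\<^sub>R u + b *\<^sub>R v) w = a * g (i x) u w + b * g (i x) v w"
    if "u \<in> ?T" "v \<in> ?T" "w \<in> ?T" for a b u v w
    using sr that unfolding semi_riemannian_def by blast
  have sym: "g (i x) u v = g (i x) v u" if "u \<in> ?T" "v \<in> ?T" for u v
    using sr that unfolding semi_riemannian_def by blast
  have add: "g (i x) (u + v) w = g (i x) u w + g (i x) v w"
    and diff: "g (i x) (u - v) w = g (i x) u w - g (i x) v w"
    if "u \<in> ?T" "v \<in> ?T" "w \<in> ?T" for u v w
    using lin[OF that, of 1 1] lin[OF that, of 1 "- 1"] by simp_all
  have JT: "J (i x) u \<in> ?T" if "u \<in> ?T" for u
    using J that unfolding endomorphism_field_def by blast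
  have Jadd: "J (i x) (u + v) = J (i x) u + J (i x) v"
      and Jdiff: "J (i x) (u - v) = J (i x) u - J (i x) v"
    if "u \<in> ?T" "v \<in> ?T" for u v
  proof -
    have "J (i x) (a *\<^sub>R u + b *\<^sub>R v) = a *\<^sub>R J (i x) u + b *\<^sub>R J (i x) v" for a b
      using J that unfolding endomorphism_field_def by blast
    from this[of 1 1] this[of 1 "- 1"]
    show "J (i x) (u + v) = J (i x) u + J (i x) v" "J (i x) (u - v) = J (i x) u - J (i x) v"
        by simp_all
  qed
  have S: "S z \<subseteq> tangent_along A B i z" for z
    using scr by (intro direct_sum_right_subset) (auto simp: screen_distribution_def)
  have tT: "tangent_along A B i x \<subseteq> ?T"
    using push_in_tangent_space[OF A B i] by (auto simp: tangent_along_def)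
  have strN: "Str x \<subseteq> normal_along A B i g x"
    using str by (intro direct_sum_right_subset) (auto simp: screen_transversal_bundle_def)
  then have strT: "Str x \<subseteq> ?T" by (auto simp: normal_along_def)
  have ltrT: "ltr x \<subseteq> ?T"
    by (rule subbundle_fibre(2)[OF B, of A i r]) (use ltr in \<open>simp add:
        lightlike_transversal_bundle_def\<close>)
  have orth: "orthogonal_sets (g (i x)) (ltr x) (S x)" "orthogonal_sets (g (i x)) (ltr x) (Str x)"
    using ltr by (simp_all add: lightlike_transversal_bundle_def)
  have o1: "g (i x) l s = 0" if "l \<in> ltr x" "s \<in> S x" for l s
    using orth(1) that unfolding orthogonal_sets_def by blast
  have o2: "g (i x) l s = 0" if "l \<in> ltr x" "s \<in> Str x" for l s
    using orth(2) that unfolding orthogonal_sets_def by blast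
  have o3: "g (i x) t s = 0" if "t \<in> tangent_along A B i x" "s \<in> Str x" for t s
  proof -
    have "g (i x) s t = 0" using that strN unfolding normal_along_def by blast
    then show ?thesis using sym[of t s] that tT strT by auto
  qed
  have nT: "n \<in> ?T" and Jn: "J (i x) n \<in> Str x" using N ltrT Jltr by auto
  have JnT: "J (i x) n \<in> ?T" using JT[OF nT] .
  have push_S: "push B i z (X z) \<in> S z" if "\<And>x. X x \<in> intrinsic_distribution A B i S x" for X z
    using that[of z] by (simp add: intrinsic_distribution_def)
  have JS: "J (i z) ` S z = S z" for z using rst by (simp add: radical_screen_transversal_def)
  have sec: "section_of A B i (tangent_along A B i) (\<lambda>z. J (i z) (push B i z (X z)))"
    if X: "vector_field A X" "\<And>x. X x \<in> intrinsic_distribution A B i S x" for X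
    unfolding section_of_def
  proof (intro conjI allI)
    show "field_along A B i UNIV (\<lambda>z. J (i z) (push B i z (X z)))"
      by (rule induced_connection_parallel(1)[OF A B i J par nab D push_vector_field[OF A B i
          X(1)]])
    show "J (i z) (push B i z (X z)) \<in> tangent_along A B i z" for z
      using push_S[OF X(2), of z] JS[of z] S[of z] by blast
  qed
  have hs: "\<exists>t l. hs Y (\<lambda>z. J (i z) (push B i z (X z))) x =
      J (i x) (D Y (\<lambda>z. push B i z (X z)) x) - t - l \<and> t \<in> tangent_along A B i x \<and> l \<in> ltr x \<and>
      D Y (\<lambda>z. push B i z (X z)) x \<in> ?T"
    if X: "vector_field A X" "\<And>x. X x \<in> intrinsic_distribution A B i S x" and Y: "vector_field A Y"
        for X Y
  proof -
    let ?Z = "\<lambda>z. J (i z) (push B i z (X z))"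
    note fX = push_vector_field[OF A B i X(1)]
    have eq: "D Y ?Z x = nablaN Y ?Z x + hl Y ?Z x + hs Y ?Z x"
      and g12: "nablaN Y ?Z x \<in> tangent_along A B i x" "hl Y ?Z x \<in> ltr x"
      using gauss Y sec[OF X] unfolding gauss_formula_def section_of_def by blast+
    from eq have "hs Y ?Z x = D Y ?Z x - nablaN Y ?Z x - hl Y ?Z x"
      by (simp only: diff_diff_eq add_diff_cancel_left')
    moreover have "D Y ?Z x = J (i x) (D Y (\<lambda>z. push B i z (X z)) x)"
      by (rule induced_connection_parallel(2)[OF A B i J par nab D fX Y])
    moreover have "D Y (\<lambda>z. push B i z (X z)) x \<in> ?T"
      using field_alongD(1)[OF induced_connectionD(1)[OF D Y fX]] by simp
    ultimately show ?thesis
      using g12 by (intro exI[of _ "nablaN Y ?Z x"] exI[of _ "hl Y ?Z x"] conjI) simp_all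
  qed
  obtain t1 l1 where 1: "hs W (\<lambda>z. J (i z) (push B i z (U z))) x =
      J (i x) (D W (\<lambda>z. push B i z (U z)) x) - t1 - l1" "t1 \<in> tangent_along A B i x" "l1 \<in> ltr x"
      "D W (\<lambda>z. push B i z (U z)) x \<in> ?T" using hs[OF U W(1)] by blast
  obtain t2 l2 where 2: "hs U (\<lambda>z. J (i z) (push B i z (W z))) x =
      J (i x) (D U (\<lambda>z. push B i z (W z)) x) - t2 - l2" "t2 \<in> tangent_along A B i x" "l2 \<in> ltr x"
      "D U (\<lambda>z. push B i z (W z)) x \<in> ?T" using hs[OF W U(1)] by blast
  have red: "g (i x) (J (i x) d - t - l) (J (i x) n) = g (i x) (J (i x) d) (J (i x) n)"
    if "d \<in> ?T" "t \<in> tangent_along A B i x" "l \<in> ltr x" for d t l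
  proof -
    have "g (i x) (J (i x) d - t - l) (J (i x) n) =
        g (i x) (J (i x) d) (J (i x) n) - g (i x) t (J (i x) n) - g (i x) l (J (i x) n)"
      using that tT ltrT JnT JT[OF that(1)] subspace_diff[OF T] by (subst diff, auto)+
    then show ?thesis using o3[OF that(2) Jn] o2[OF that(3) Jn] by simp
  qed
  have hsT: "J (i x) d - t - l \<in> ?T" if "d \<in> ?T" "t \<in> tangent_along A B i x" "l \<in> ltr x" for d t l
    using that tT ltrT JT subspace_diff[OF T] by (metis subsetD)
  let ?b = "push B i x (lie_bracket A W U x)"
  have bT: "?b \<in> ?T" by (rule push_in_tangent_space[OF A B i lie_bracket_in_tangent_space[OF A W(1)
      U(1)]])
  have "g (i x) (hs W (\<lambda>z. J (i z) (push B i z (U z))) x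
      - hs U (\<lambda>z. J (i z) (push B i z (W z))) x) (J (i x) n)
    = g (i x) (J (i x) (D W (\<lambda>z. push B i z (U z)) x)) (J (i x) n)
      - g (i x) (J (i x) (D U (\<lambda>z. push B i z (W z)) x)) (J (i x) n)"
    unfolding 1(1) 2(1) diff[OF hsT[OF 1(4,2,3)] hsT[OF 2(4,2,3)] JnT] red[OF 1(4,2,3)] red[OF
        2(4,2,3)] ..
  also have "\<dots> = g (i x) (J (i x) ?b) (J (i x) n)"
  proof -
    have "D W (\<lambda>z. push B i z (U z)) x - D U (\<lambda>z. push B i z (W z)) x = ?b"
      by (rule induced_connection_torsion_free[OF A B i nab _ D W(1) U(1)]) (rule tor)
    then show ?thesis
      unfolding diff[OF JT[OF 1(4)] JT[OF 2(4)] JnT, symmetric] Jdiff[OF 1(4) 2(4), symmetric]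
          by simp
  qed
  also have "\<dots> = g (i x) (J (i x) (J (i x) ?b)) n" by (rule gJ[OF JT[OF bT] nT, symmetric])
  also have "\<dots> = p * g (i x) (J (i x) ?b) n + q * g (i x) ?b n"
    unfolding J2[OF bT] by (rule lin[OF JT[OF bT] bT nT])
  also have "g (i x) ?b n = g (i x) \<rho> n"
  proof -
    have "\<rho> \<in> ?T" "\<sigma> \<in> ?T" using dec(2,3) S tT by (auto simp: radical_along_def)
    then show ?thesis using o1[OF N dec(3)] sym[of \<sigma> n] nT by (simp add: dec(1) add)
  qed
  also have "g (i x) (J (i x) ?b) n = 0"
  proof -
    have r: "\<rho> \<in> ?T" "\<sigma> \<in> ?T" using dec(2,3) S tT by (auto simp: radical_along_def)
    have "J (i x) \<rho> \<in> Str x" using rst dec(2) unfolding radical_screen_transversal_def by blast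
    then have "g (i x) (J (i x) \<rho>) n = 0" using o2[OF N] sym[OF JT[OF r(1)] nT] by simp
    moreover have "J (i x) \<sigma> \<in> S x" using JS[of x] dec(3) by blast
    then have "g (i x) (J (i x) \<sigma>) n = 0" using o1[OF N] sym[OF JT[OF r(2)] nT] by simp
    ultimately show ?thesis unfolding dec(1) Jadd[OF r] by (simp add: add JT r nT)
  qed
  finally show ?thesis by (simp only: mult_zero_right add_0_left)
qed

theorem theorem3p13:
  fixes p q r :: nat
    and B :: "('m::{t2_space,second_countable_topology}, 'e::euclidean_space) chart set"
    and g :: "'m \<Rightarrow> 'm tvec \<Rightarrow> 'm tvec \<Rightarrow> real"
    and J :: "'m \<Rightarrow> 'm tvec \<Rightarrow> 'm tvec"
    and nabla :: "('m \<Rightarrow> 'm tvec) \<Rightarrow> ('m \<Rightarrow> 'm tvec) \<Rightarrow> 'm \<Rightarrow> 'm tvec"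
    and A :: "('n::{t2_space,second_countable_topology}, 'd::euclidean_space) chart set"
    and i :: "'n \<Rightarrow> 'm"
    and S Str ltr :: "'n \<Rightarrow> 'm tvec set"
    and D nablaN hl hs :: "('n \<Rightarrow> 'n tvec) \<Rightarrow> ('n \<Rightarrow> 'm tvec) \<Rightarrow> 'n \<Rightarrow> 'm tvec"
  assumes "0 < p" and "0 < q"
    and "locally_metallic p q B g J nabla"
    and "lightlike_submanifold A B i g r"
    and "screen_distribution A B i g S"
    and "screen_transversal_bundle A B i g Str"
    and "lightlike_transversal_bundle A B i g r S Str ltr"
    and "radical_screen_transversal A B i g J S Str"
    and "screen_transversal_splitting A B i g J Str ltr"
    and "induced_connection_along A B i nabla D"
    and "gauss_formula A B i ltr Str D nablaN hl hs"
  shows "integrable_distribution A (intrinsic_distribution A B i S) \<longleftrightarrow>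
    (\<forall>W U. vector_field A W \<longrightarrow> (\<forall>x. W x \<in> intrinsic_distribution A B i S x) \<longrightarrow>
           vector_field A U \<longrightarrow> (\<forall>x. U x \<in> intrinsic_distribution A B i S x) \<longrightarrow>
       no_component_in_J_ltr A B i g J ltr
         (\<lambda>x. hs W (\<lambda>z. J (i z) (push B i z (U z))) x - hs U (\<lambda>z. J (i z) (push B i z (W z))) x))"
proof -
  have A: "smooth_atlas A" and i: "smooth_map A B UNIV i"
    and inj: "\<And>x. inj_on (push B i x) (tangent_space A x)"
    using assms(4) by (auto simp: lightlike_submanifold_def immersed_submanifold_def)
  have sr: "semi_riemannian B g"
    using assms(3) by (simp add: locally_metallic_def metallic_semi_riemannian_def)
  then have B: "smooth_atlas B" by (simp add: semi_riemannian_def)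
  have dsum: "direct_sum (radical_along A B i g x) (S x) (tangent_along A B i x)" for x
    using assms(5) by (simp add: screen_distribution_def)
  obtain k where k: "subbundle_along A B i k S" using assms(5)
      by (auto simp: screen_distribution_def)
  have Jltr: "J (i x) ` ltr x \<subseteq> Str x" for x using assms(9)
      by (simp add: screen_transversal_splitting_def)
  let ?E = "intrinsic_distribution A B i S"
  let ?h = "\<lambda>W U x. hs W (\<lambda>z. J (i z) (push B i z (U z))) x
      - hs U (\<lambda>z. J (i z) (push B i z (W z))) x"
  have E: "subbundle_along A A (\<lambda>x. x) k ?E"
    by (rule subbundle_pullback[OF A B i inj k direct_sum_right_subset[OF dsum]])
  note pairing = screen_bracket_pairing[OF assms(3-8) Jltr assms(10,11)]
  have "(\<forall>x. lie_bracket A W U x \<in> ?E x) \<longleftrightarrow> no_component_in_J_ltr A B i g J ltr (?h W U)"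
    if W: "vector_field A W" "\<forall>x. W x \<in> ?E x" and U: "vector_field A U" "\<forall>x. U x \<in> ?E x" for W U
  proof -
    note pair = pairing[OF W(1) W(2)[rule_format] U(1) U(2)[rule_format]]
    have bT: "lie_bracket A W U x \<in> tangent_space A x" for x
      by (rule lie_bracket_in_tangent_space[OF A W(1) U(1)])
    show ?thesis
    proof
      assume inv: "\<forall>x. lie_bracket A W U x \<in> ?E x"
      show "no_component_in_J_ltr A B i g J ltr (?h W U)"
        unfolding no_component_in_J_ltr_def
      proof (intro allI impI)
        fix N x assume N: "section_of A B i ltr N"
        have NT: "N x \<in> tangent_space B (i x)" and Nl: "N x \<in> ltr x"
          using N field_alongD(1)[of A B i UNIV N x] by (auto simp: section_of_def)
        \<comment> \<open>The bracket has the decomposition with radical part 0.\<close>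
        have r0: "0 \<in> radical_along A B i g x" using dsum[of x] by (auto simp: direct_sum_def)
        have s: "push B i x (lie_bracket A W U x) \<in> S x"
          using inv by (simp add: intrinsic_distribution_def)
        have T0: "0 \<in> tangent_space B (i x)" by (rule subspace_0[OF subspace_tangent_space[OF B]])
        have "g (i x) (0 *\<^sub>R 0 + 0 *\<^sub>R 0) (N x) = 0 * g (i x) 0 (N x) + 0 * g (i x) 0 (N x)"
          using sr T0 NT unfolding semi_riemannian_def by blast
        then have "g (i x) 0 (N x) = 0" by simp
        then show "g (i x) (?h W U x) (J (i x) (N x)) = 0"
          using pair[OF Nl add_0[symmetric] r0 s] by simp
      qed
    next
      assume no: "no_component_in_J_ltr A B i g J ltr (?h W U)"
      show "\<forall>x. lie_bracket A W U x \<in> ?E x"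
      proof
        fix x
        have "push B i x (lie_bracket A W U x) \<in> tangent_along A B i x"
          using bT by (auto simp: tangent_along_def)
        then obtain \<rho> \<sigma> where d: "push B i x (lie_bracket A W U x) = \<rho> + \<sigma>"
          "\<rho> \<in> radical_along A B i g x" "\<sigma> \<in> S x"
          using dsum[of x] unfolding direct_sum_def by blast
        have "\<rho> = 0"
        proof (rule ccontr)
          assume "\<rho> \<noteq> 0"
          then obtain N where N: "section_of A B i ltr N" "g (i x) \<rho> (N x) \<noteq> 0"
            using radical_pairing_nondegenerate[OF sr assms(4,7) d(2)] by metis
          then have "N x \<in> ltr x" by (simp add: section_of_def)
          from pair[OF this d] have "real q * g (i x) \<rho> (N x) = 0"
            using no N(1) by (simp add: no_component_in_J_ltr_def)
          then show False using N(2) \<open>0 < q\<close> by simp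
        qed
        then show "lie_bracket A W U x \<in> ?E x"
          using d bT[of x] by (simp add: intrinsic_distribution_def)
      qed
    qed
  qed
  then show ?thesis unfolding Frobenius[OF A E] by blast
qed

end
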